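(* Let $M$ be a compact $3$-dimensional manifold with boundary, and let $(H\xrightarrow{\partial}G,\rhd)$ be a crossed module in which $H$ and $G$ are finite groups. Let $K$ be a triangulation of $M$ (a finite simplicial complex together with a homeomorphism $|K|\cong M$), let $K_i$ denote the set of $i$-simplices of $K$, and fix a total order on the vertex set $K_0$. Write every simplex with its vertices listed in increasing order, so an edge is $(jk)$ with $j<k$, a triangle is $(jkl)$ with $j<k<l$, and a tetrahedron is $(jklm)$ with $j<k<l<m$. For each assignment of a colour $g_{jk}\in G$ to every edge $(jk)\in K_1$ and a colour $h_{jkl}\in H$ to every triangle $(jkl)\in K_2$, set, for each triangle $(jkl)\in K_2$, $$g_{jkl}:=\partial(h_{jkl})\,g_{kl}\,g_{jk}\,g_{jl}^{-1}\in G,$$ and for each tetrahedron $(jklm)\in K_3$, $$h_{jklm}:=h_{jlm}\,(g_{lm}\rhd h_{jkl})\,h_{klm}^{-1}\,h_{jkm}^{-1}\in H.$$ For a finite group $X$ define $\delta_X:X\to\mathbb{Z}$ by $\delta_X(x)=|X|$ if $x=e_X$ and $\delta_X(x)=0$ otherwise. Define $$Z(M)=|G|^{-|K_0|+|K_1|-|K_2|}\,|H|^{|K_0|-|K_1|+|K_2|-|K_3|}\left(\prod_{(jk)\in K_1}\frac{1}{|G|}\sum_{g_{jk}\in G}\right)\left(\prod_{(jkl)\in K_2}\frac{1}{|H|}\sum_{h_{jkl}\in H}\right)\left(\prod_{(jkl)\in K_2}\delta_G(g_{jkl})\right)\left(\prod_{(jklm)\in K_3}\delta_H(h_{jklm})\right),$$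 i.e. $|G|^{-|K_1|}|H|^{-|K_2|}$ times the prefactor times the sum, over all colourings $(g_{jk})_{(jk)\in K_1}$, $(h_{jkl})_{(jkl)\in K_2}$, of the products of the $\delta$-terms. Then $Z(M)$ does not depend on the choice of the triangulation $K$ of $M$ nor on the choice of the total order on $K_0$; hence it is a topological invariant of $M$.
   Context: A crossed module $(H\xrightarrow{\partial}G,\rhd)$ consists of groups $H,G$, a group homomorphism $\partial:H\to G$, the conjugation action of $G$ on itself ($g_1\rhd g_2=g_1g_2g_1^{-1}$), and a left action $\rhd$ of $G$ on $H$ such that: (i) for each $g\in G$ the map $h\mapsto g\rhd h$ is a group automorphism of $H$; (ii) $\partial(g\rhd h)=g\,\partial(h)\,g^{-1}$ for all $g\in G$, $h\in H$; (iii) (Peiffer identity) $\partial(h)\rhd h'=h\,h'\,h^{-1}$ for all $h,h'\in H$. *)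

theory Defs
  imports "HOL-Analysis.Analysis" "HOL-Algebra.Group"
begin

definition crossed_module ::
  "'h monoid \<Rightarrow> 'g monoid \<Rightarrow> ('h \<Rightarrow> 'g) \<Rightarrow> ('g \<Rightarrow> 'h \<Rightarrow> 'h) \<Rightarrow> bool" where
  "crossed_module H G bd act \<longleftrightarrow>
     group H \<and> group G \<and> bd \<in> hom H G \<and>
     \<comment> \<open>left action of G on H\<close>
     (\<forall>g\<in>carrier G. \<forall>h\<in>carrier H. act g h \<in> carrier H) \<and>
     (\<forall>h\<in>carrier H. act \<one>\<^bsub>G\<^esub> h = h) \<and>
     (\<forall>g1\<in>carrier G. \<forall>g2\<in>carrier G. \<forall>h\<in>carrier H.
        act (g1 \<otimes>\<^bsub>G\<^esub> g2) h = act g1 (act g2 h)) \<and>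
     \<comment> \<open>(i) each g acts by a group automorphism of H\<close>
     (\<forall>g\<in>carrier G. act g \<in> iso H H) \<and>
     \<comment> \<open>(ii) equivariance of the boundary map\<close>
     (\<forall>g\<in>carrier G. \<forall>h\<in>carrier H.
        bd (act g h) = g \<otimes>\<^bsub>G\<^esub> bd h \<otimes>\<^bsub>G\<^esub> inv\<^bsub>G\<^esub> g) \<and>
     \<comment> \<open>(iii) Peiffer identity\<close>
     (\<forall>h\<in>carrier H. \<forall>h'\<in>carrier H.
        act (bd h) h' = h \<otimes>\<^bsub>H\<^esub> h' \<otimes>\<^bsub>H\<^esub> inv\<^bsub>H\<^esub> h)"

definition half_space3 :: "(real^3) set" where
  "half_space3 = {x. 0 \<le> x $ 1}"

definition manifold3_with_boundary :: "'m topology \<Rightarrow> bool" where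
  "manifold3_with_boundary M \<longleftrightarrow>
     Hausdorff_space M \<and> second_countable M \<and>
     (\<forall>x\<in>topspace M. \<exists>U V. openin M U \<and> x \<in> U \<and>
        openin (subtopology euclidean half_space3) V \<and>
        (subtopology M U) homeomorphic_space (subtopology euclidean V))"

definition compact_3manifold_with_boundary :: "'m topology \<Rightarrow> bool" where
  "compact_3manifold_with_boundary M \<longleftrightarrow> compact_space M \<and> manifold3_with_boundary M"

definition is_triangulation_of :: "'a::euclidean_space set set \<Rightarrow> 'm topology \<Rightarrow> bool" where
  "is_triangulation_of K M \<longleftrightarrow>
     simplicial_complex K \<and> (subtopology euclidean (\<Union>K)) homeomorphic_space M"

definition simplices :: "'a::euclidean_space set set \<Rightarrow> int \<Rightarrow> 'a set set" where
  "simplices K i = {S \<in> K. i simplex S}"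

definition vertices_of :: "'a::euclidean_space set \<Rightarrow> 'a set" where
  "vertices_of S = {v. v extreme_point_of S}"

definition vertex_set :: "'a::euclidean_space set set \<Rightarrow> 'a set" where
  "vertex_set K = {v. {v} \<in> simplices K 0}"

text \<open>A total order on the vertex set, encoded by an injective ranking rho into nat
  (j < k iff rho j < rho k).\<close>
definition vertex_order :: "'a::euclidean_space set set \<Rightarrow> ('a \<Rightarrow> nat) \<Rightarrow> bool" where
  "vertex_order K rho \<longleftrightarrow> inj_on rho (vertex_set K)"

definition vtx :: "('a \<Rightarrow> nat) \<Rightarrow> 'a::euclidean_space set \<Rightarrow> nat \<Rightarrow> 'a" where
  "vtx rho S i = (THE v. v \<in> vertices_of S \<and> card {w \<in> vertices_of S. rho w < rho v} = i)"

definition sx :: "'a::real_vector list \<Rightarrow> 'a set" where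
  "sx vs = convex hull (set vs)"

definition delta :: "'x monoid \<Rightarrow> 'x \<Rightarrow> real" where
  "delta X x = (if x = \<one>\<^bsub>X\<^esub> then real (card (carrier X)) else 0)"

definition g_tri ::
  "'g monoid \<Rightarrow> ('h \<Rightarrow> 'g) \<Rightarrow> ('a::euclidean_space \<Rightarrow> nat) \<Rightarrow> ('a set \<Rightarrow> 'g) \<Rightarrow> ('a set \<Rightarrow> 'h)
     \<Rightarrow> 'a set \<Rightarrow> 'g" where
  "g_tri G bd rho g h T =
     (let j = vtx rho T 0; k = vtx rho T 1; l = vtx rho T 2 in
       bd (h T) \<otimes>\<^bsub>G\<^esub> g (sx [k,l]) \<otimes>\<^bsub>G\<^esub> g (sx [j,k]) \<otimes>\<^bsub>G\<^esub> inv\<^bsub>G\<^esub> (g (sx [j,l])))"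

definition h_tet ::
  "'h monoid \<Rightarrow> ('g \<Rightarrow> 'h \<Rightarrow> 'h) \<Rightarrow> ('a::euclidean_space \<Rightarrow> nat) \<Rightarrow> ('a set \<Rightarrow> 'g) \<Rightarrow> ('a set \<Rightarrow> 'h)
     \<Rightarrow> 'a set \<Rightarrow> 'h" where
  "h_tet H act rho g h T =
     (let j = vtx rho T 0; k = vtx rho T 1; l = vtx rho T 2; m = vtx rho T 3 in
       h (sx [j,l,m]) \<otimes>\<^bsub>H\<^esub> act (g (sx [l,m])) (h (sx [j,k,l]))
         \<otimes>\<^bsub>H\<^esub> inv\<^bsub>H\<^esub> (h (sx [k,l,m])) \<otimes>\<^bsub>H\<^esub> inv\<^bsub>H\<^esub> (h (sx [j,k,m])))"

definition Z_inv ::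
  "'h monoid \<Rightarrow> 'g monoid \<Rightarrow> ('h \<Rightarrow> 'g) \<Rightarrow> ('g \<Rightarrow> 'h \<Rightarrow> 'h)
     \<Rightarrow> 'a::euclidean_space set set \<Rightarrow> ('a \<Rightarrow> nat) \<Rightarrow> real" where
  "Z_inv H G bd act K rho =
     (let nG = real (card (carrier G)); nH = real (card (carrier H));
          n0 = int (card (simplices K 0)); n1 = int (card (simplices K 1));
          n2 = int (card (simplices K 2)); n3 = int (card (simplices K 3))
      in nG powi (- n0 + n1 - n2) * nH powi (n0 - n1 + n2 - n3)
         * (nG powi (- n1) * nH powi (- n2))
         * (\<Sum>g \<in> simplices K 1 \<rightarrow>\<^sub>E carrier G. \<Sum>h \<in> simplices K 2 \<rightarrow>\<^sub>E carrier H.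
              (\<Prod>T \<in> simplices K 2. delta G (g_tri G bd rho g h T))
            * (\<Prod>T \<in> simplices K 3. delta H (h_tet H act rho g h T))))"

end

theory Submission
  imports Defs
begin

text \<open>The delta functions turn \<open>Z(M)\<close> into the number of flat colourings of the complex, divided by a
  weight that is multiplicative over its simplices. If a complex arises from another by elementary
  expansions, every flat colouring of the smaller one has exactly as many extensions as the quotient
  of the weights; this is the only place where the crossed module axioms enter.

  Say that a pair of complexes has the extension property if colourings extend from the relative
  boundary of the blow-up of the pair over any simplex. Such pairs satisfy two-out-of-three and
  two-out-of-six, and counting shows that they have the same normalised number of colourings. For the
  nerves of families of subsets of the space, adding sets contained in given ones yields such a pair,
  and so does adding the star cover of a triangulation to that of its barycentric subdivision.

  Given two triangulations of one space, sufficiently fine subdivisions have star covers that refine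
  each other alternately, and two-out-of-six identifies their counts. Hence \<open>Z(M)\<close> depends only on
  the homeomorphism type of the polyhedron, and on no order of the vertices.\<close>

section \<open>Crossed modules\<close>

text \<open>A priori two triangulations of one space need have no common subdivision, so local moves
  between complexes are out of reach. Star covers live in the space itself, and fine ones refine
  each other whatever the two piecewise linear structures are; only inclusions of nerves remain to
  be understood. Flat colourings are maps to the classifying space of the crossed module, and the
  normalised count is the homotopy cardinality of the space of such maps: the weight
  \<open>|G|\<close> of a vertex and \<open>|H|\<close> of an edge account for gauge
  transformations, \<open>1/|H|\<close> per vertex for transformations between these. A uniform
  number of extensions is awkward to carry through cancellations. The extension property is the
  lifting property of a trivial fibration: it asks for existence only, but over every index simplex
  at once, so it composes and cancels by gluing and by filling horns, and exact counts are recovered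
  from it. Blow-ups replace products with simplices because they need no compatible vertex
  order.\<close>

text \<open>Abstract simplicial complexes; the empty simplex is excluded.\<close>

definition asc :: "'v set set \<Rightarrow> bool" where
  "asc K \<longleftrightarrow> finite K \<and> (\<forall>S\<in>K. finite S \<and> S \<noteq> {}) \<and> (\<forall>S\<in>K. \<forall>T. T \<subseteq> S \<longrightarrow> T \<noteq> {} \<longrightarrow> T \<in> K)"

locale finite_crossed_module =
  fixes H :: "'h monoid" and G :: "'g monoid"
    and bd :: "'h \<Rightarrow> 'g" and act :: "'g \<Rightarrow> 'h \<Rightarrow> 'h"
  assumes crossed: "crossed_module H G bd act"
    and finH: "finite (carrier H)" and finG: "finite (carrier G)"
begin

sublocale G: group G
  using crossed by (simp add: crossed_module_def)

sublocale H: group H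
  using crossed by (simp add: crossed_module_def)

lemma bd_closed [simp, intro]: "x \<in> carrier H \<Longrightarrow> bd x \<in> carrier G"
  using crossed by (auto simp: crossed_module_def hom_def)

lemma bd_mult [simp]:
  "x \<in> carrier H \<Longrightarrow> y \<in> carrier H \<Longrightarrow> bd (x \<otimes>\<^bsub>H\<^esub> y) = bd x \<otimes>\<^bsub>G\<^esub> bd y"
  using crossed by (auto simp: crossed_module_def hom_def)

lemma act_closed [simp, intro]:
  "g \<in> carrier G \<Longrightarrow> x \<in> carrier H \<Longrightarrow> act g x \<in> carrier H"
  using crossed by (auto simp: crossed_module_def)

lemma act_comp:
  "a \<in> carrier G \<Longrightarrow> b \<in> carrier G \<Longrightarrow> x \<in> carrier H \<Longrightarrow> act (a \<otimes>\<^bsub>G\<^esub> b) x = act a (act b x)"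
  using crossed by (auto simp: crossed_module_def)

lemma act_one: "x \<in> carrier H \<Longrightarrow> act \<one>\<^bsub>G\<^esub> x = x"
  using crossed by (auto simp: crossed_module_def)

lemma act_mult:
  "g \<in> carrier G \<Longrightarrow> x \<in> carrier H \<Longrightarrow> y \<in> carrier H \<Longrightarrow>
     act g (x \<otimes>\<^bsub>H\<^esub> y) = act g x \<otimes>\<^bsub>H\<^esub> act g y"
  using crossed by (auto simp: crossed_module_def iso_def hom_def)

lemma act_inj:
  assumes "g \<in> carrier G" "x \<in> carrier H" "y \<in> carrier H"
  shows "act g x = act g y \<longleftrightarrow> x = y"
proof -
  have "act (inv\<^bsub>G\<^esub> g) (act g z) = z" if "z \<in> carrier H" for z
    using that assms by (simp flip: act_comp add: act_one)
  then show ?thesis using assms by metis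
qed

text \<open>Equivariance, and next the Peiffer identity, are restated without inverses: each moves
  one factor past another, which suits rewriting in long products.\<close>

lemma bd_act_swap:
  assumes "g \<in> carrier G" "x \<in> carrier H"
  shows "bd (act g x) \<otimes>\<^bsub>G\<^esub> g = g \<otimes>\<^bsub>G\<^esub> bd x"
proof -
  have "bd (act g x) = g \<otimes>\<^bsub>G\<^esub> bd x \<otimes>\<^bsub>G\<^esub> inv\<^bsub>G\<^esub> g"
    using crossed assms by (auto simp: crossed_module_def)
  then show ?thesis using assms by (simp add: G.m_assoc)
qed

lemma peiffer_swap:
  assumes "x \<in> carrier H" "y \<in> carrier H"
  shows "act (bd x) y \<otimes>\<^bsub>H\<^esub> x = x \<otimes>\<^bsub>H\<^esub> y"
proof -
  have "act (bd x) y = x \<otimes>\<^bsub>H\<^esub> y \<otimes>\<^bsub>H\<^esub> inv\<^bsub>H\<^esub> x"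
    using crossed assms by (auto simp: crossed_module_def)
  then show ?thesis using assms by (simp add: H.m_assoc)
qed

text \<open>Triviality of \<open>g_tri\<close>, and in \<open>tet_eq\<close> that of
  \<open>h_tet\<close>, with the inverses moved to the other side; this is why \<open>hjkm\<close>
  precedes \<open>hklm\<close> there.\<close>

definition tri_eq :: "'h \<Rightarrow> 'g \<Rightarrow> 'g \<Rightarrow> 'g \<Rightarrow> bool" where
  "tri_eq h gkl gjk gjl \<longleftrightarrow> bd h \<otimes>\<^bsub>G\<^esub> gkl \<otimes>\<^bsub>G\<^esub> gjk = gjl"

definition tet_eq :: "'h \<Rightarrow> 'g \<Rightarrow> 'h \<Rightarrow> 'h \<Rightarrow> 'h \<Rightarrow> bool" where
  "tet_eq hjlm glm hjkl hjkm hklm \<longleftrightarrow> hjlm \<otimes>\<^bsub>H\<^esub> act glm hjkl = hjkm \<otimes>\<^bsub>H\<^esub> hklm"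

text \<open>Apply \<open>bd\<close> to the tetrahedron relation and multiply by the path
  \<open>ucd\<close>, \<open>ubc\<close>, \<open>uab\<close>. Equivariance exposes the faces
  \<open>abc\<close> and \<open>acd\<close> on one side, \<open>bcd\<close> and \<open>abd\<close>
  on the other.\<close>

lemma tet_face_paths:
  assumes "hbcd \<in> carrier H" "hacd \<in> carrier H" "habd \<in> carrier H" "habc \<in> carrier H"
    and "uab \<in> carrier G" "uac \<in> carrier G" "uad \<in> carrier G"
        "ubc \<in> carrier G" "ubd \<in> carrier G" "ucd \<in> carrier G"
    and tet: "tet_eq hacd ucd habc habd hbcd"
  shows "bd hacd \<otimes>\<^bsub>G\<^esub> (ucd \<otimes>\<^bsub>G\<^esub> (bd habc \<otimes>\<^bsub>G\<^esub> ubc \<otimes>\<^bsub>G\<^esub> uab))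
       = bd habd \<otimes>\<^bsub>G\<^esub> (bd hbcd \<otimes>\<^bsub>G\<^esub> ucd \<otimes>\<^bsub>G\<^esub> ubc) \<otimes>\<^bsub>G\<^esub> uab"
proof -
  have "bd hacd \<otimes>\<^bsub>G\<^esub> (ucd \<otimes>\<^bsub>G\<^esub> (bd habc \<otimes>\<^bsub>G\<^esub> ubc \<otimes>\<^bsub>G\<^esub> uab))
      = bd hacd \<otimes>\<^bsub>G\<^esub> (ucd \<otimes>\<^bsub>G\<^esub> bd habc) \<otimes>\<^bsub>G\<^esub> ubc \<otimes>\<^bsub>G\<^esub> uab"
    using assms by (simp add: G.m_assoc)
  also have "\<dots> = bd (hacd \<otimes>\<^bsub>H\<^esub> act ucd habc) \<otimes>\<^bsub>G\<^esub> ucd \<otimes>\<^bsub>G\<^esub> ubc \<otimes>\<^bsub>G\<^esub> uab"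
    using assms by (simp add: G.m_assoc bd_act_swap[of ucd habc, symmetric])
  also have "\<dots> = bd (habd \<otimes>\<^bsub>H\<^esub> hbcd) \<otimes>\<^bsub>G\<^esub> ucd \<otimes>\<^bsub>G\<^esub> ubc \<otimes>\<^bsub>G\<^esub> uab"
    using tet by (simp add: tet_eq_def)
  finally show ?thesis using assms by (simp add: G.m_assoc)
qed

text \<open>Substituting three flat faces into \<open>tet_face_paths\<close> leaves the relation of
  the fourth. Hence a free triangle of a tetrahedron needs no equation of its own: the colour that
  the tetrahedron forces on it is already flat.\<close>

lemma tet_fourth_face:
  assumes C: "hbcd \<in> carrier H" "hacd \<in> carrier H" "habd \<in> carrier H" "habc \<in> carrier H"
    "uab \<in> carrier G" "uac \<in> carrier G" "uad \<in> carrier G"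
        "ubc \<in> carrier G" "ubd \<in> carrier G" "ucd \<in> carrier G"
    and tet: "tet_eq hacd ucd habc habd hbcd"
  shows "tri_eq hacd ucd uac uad \<Longrightarrow> tri_eq habd ubd uab uad \<Longrightarrow> tri_eq habc ubc uab uac
          \<Longrightarrow> tri_eq hbcd ucd ubc ubd" (is "PROP ?A")
    and "tri_eq hbcd ucd ubc ubd \<Longrightarrow> tri_eq habd ubd uab uad \<Longrightarrow> tri_eq habc ubc uab uac
          \<Longrightarrow> tri_eq hacd ucd uac uad" (is "PROP ?B")
    and "tri_eq hbcd ucd ubc ubd \<Longrightarrow> tri_eq hacd ucd uac uad \<Longrightarrow> tri_eq habc ubc uab uac
          \<Longrightarrow> tri_eq habd ubd uab uad" (is "PROP ?C")
    and "tri_eq hbcd ucd ubc ubd \<Longrightarrow> tri_eq hacd ucd uac uad \<Longrightarrow> tri_eq habd ubd uab uad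
          \<Longrightarrow> tri_eq habc ubc uab uac" (is "PROP ?D")
proof -
  note P = tet_face_paths[OF C tet]
  have as: "bd hacd \<otimes>\<^bsub>G\<^esub> (ucd \<otimes>\<^bsub>G\<^esub> uac) = bd hacd \<otimes>\<^bsub>G\<^esub> ucd \<otimes>\<^bsub>G\<^esub> uac"
    using C by (simp add: G.m_assoc)
  show "PROP ?A"
  proof -
    assume 1: "tri_eq hacd ucd uac uad" and 2: "tri_eq habd ubd uab uad"
      and 3: "tri_eq habc ubc uab uac"
    have "bd habd \<otimes>\<^bsub>G\<^esub> (bd hbcd \<otimes>\<^bsub>G\<^esub> ucd \<otimes>\<^bsub>G\<^esub> ubc) \<otimes>\<^bsub>G\<^esub> uab = bd habd \<otimes>\<^bsub>G\<^esub> ubd \<otimes>\<^bsub>G\<^esub> uab"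
      using P as 1 2 3 unfolding tri_eq_def by metis
    then show "tri_eq hbcd ucd ubc ubd"
      using C by (simp add: tri_eq_def)
  qed
  show "PROP ?B"
    using P as unfolding tri_eq_def by metis
  show "PROP ?C"
    using P as unfolding tri_eq_def by metis
  show "PROP ?D"
  proof -
    assume 1: "tri_eq hbcd ucd ubc ubd" and 2: "tri_eq hacd ucd uac uad"
      and 3: "tri_eq habd ubd uab uad"
    have "bd hacd \<otimes>\<^bsub>G\<^esub> (ucd \<otimes>\<^bsub>G\<^esub> (bd habc \<otimes>\<^bsub>G\<^esub> ubc \<otimes>\<^bsub>G\<^esub> uab)) = bd hacd \<otimes>\<^bsub>G\<^esub> (ucd \<otimes>\<^bsub>G\<^esub> uac)"
      using P as 1 2 3 unfolding tri_eq_def by metis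
    then show "tri_eq habc ubc uab uac"
      using C by (simp add: tri_eq_def)
  qed
qed

text \<open>The five tetrahedra of a 4-simplex \<open>abcde\<close> are the five sides of a pentagon of elements
  of \<open>H\<close>; the Peiffer identity is what makes two of the sides meet.\<close>

lemma pentagon:
  assumes C: "habc \<in> carrier H" "habd \<in> carrier H" "habe \<in> carrier H" "hacd \<in> carrier H"
    "hace \<in> carrier H" "hade \<in> carrier H" "hbcd \<in> carrier H" "hbce \<in> carrier H"
    "hbde \<in> carrier H" "hcde \<in> carrier H" "ucd \<in> carrier G" "uce \<in> carrier G" "ude \<in> carrier G"
    and cde: "tri_eq hcde ude ucd uce"
  obtains p1 p2 p3 p4 p5 where
    "tet_eq hade ude hacd hace hcde \<longleftrightarrow> p1 = p2"
    "tet_eq hace uce habc habe hbce \<longleftrightarrow> p2 = p3"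
    "tet_eq hbde ude hbcd hbce hcde \<longleftrightarrow> p3 = p4"
    "tet_eq hade ude habd habe hbde \<longleftrightarrow> p4 = p5"
    "tet_eq hacd ucd habc habd hbcd \<longleftrightarrow> p5 = (p1 :: 'h)"
proof -
  let ?g = "act ude"
  \<comment> \<open>\<open>y\<close> is the colour of \<open>abc\<close> transported along
    \<open>cd\<close> and then \<open>de\<close>. Each \<open>p\<close> is a product of three
    factors, and cyclic neighbours share an outer factor, whose cancellation leaves one tetrahedron
    relation.\<close>
  define y where "y = ?g (act ucd habc)"
  define p1 p2 p3 p4 p5 where
    p1_def: "p1 = hade \<otimes>\<^bsub>H\<^esub> ?g hacd \<otimes>\<^bsub>H\<^esub> y"
    and p2_def: "p2 = hace \<otimes>\<^bsub>H\<^esub> act uce habc \<otimes>\<^bsub>H\<^esub> hcde"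
    and p3_def: "p3 = habe \<otimes>\<^bsub>H\<^esub> hbce \<otimes>\<^bsub>H\<^esub> hcde"
    and p4_def: "p4 = habe \<otimes>\<^bsub>H\<^esub> hbde \<otimes>\<^bsub>H\<^esub> ?g hbcd"
    and p5_def: "p5 = hade \<otimes>\<^bsub>H\<^esub> ?g habd \<otimes>\<^bsub>H\<^esub> ?g hbcd"
  have yC: "y \<in> carrier H" using C by (simp add: y_def)
  \<comment> \<open>By flatness of \<open>cde\<close>, \<open>uce\<close> is \<open>bd hcde\<close>
    times the path through \<open>d\<close>, and the Peiffer identity moves \<open>hcde\<close> past
    \<open>y\<close>. This gives \<open>p2\<close> the second shape that its comparison with
    \<open>p1\<close> needs.\<close>
  have "uce = bd hcde \<otimes>\<^bsub>G\<^esub> (ude \<otimes>\<^bsub>G\<^esub> ucd)"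
    using cde C by (simp add: tri_eq_def G.m_assoc)
  then have "act uce habc = act (bd hcde) y"
    using C by (simp add: y_def act_comp)
  then have swap: "act uce habc \<otimes>\<^bsub>H\<^esub> hcde = hcde \<otimes>\<^bsub>H\<^esub> y"
    using peiffer_swap[OF C(10) yC] by simp
  have "p2 = hace \<otimes>\<^bsub>H\<^esub> (act uce habc \<otimes>\<^bsub>H\<^esub> hcde)"
    using C by (simp add: p2_def H.m_assoc)
  also have "\<dots> = hace \<otimes>\<^bsub>H\<^esub> hcde \<otimes>\<^bsub>H\<^esub> y"
    using C yC by (simp add: swap H.m_assoc)
  finally have p2': "p2 = hace \<otimes>\<^bsub>H\<^esub> hcde \<otimes>\<^bsub>H\<^esub> y" .
  have p5': "p5 = hade \<otimes>\<^bsub>H\<^esub> ?g (habd \<otimes>\<^bsub>H\<^esub> hbcd)"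
    using C by (simp add: p5_def H.m_assoc act_mult)
  have p1': "p1 = hade \<otimes>\<^bsub>H\<^esub> ?g (hacd \<otimes>\<^bsub>H\<^esub> act ucd habc)"
    using C by (simp add: p1_def y_def H.m_assoc act_mult)
  have p3': "p3 = habe \<otimes>\<^bsub>H\<^esub> (hbce \<otimes>\<^bsub>H\<^esub> hcde)" and p4': "p4 = habe \<otimes>\<^bsub>H\<^esub> (hbde \<otimes>\<^bsub>H\<^esub> ?g hbcd)"
    using C by (simp_all add: p3_def p4_def H.m_assoc)
  show thesis
  proof (rule that)
    show "tet_eq hade ude hacd hace hcde \<longleftrightarrow> p1 = p2"
      using C yC unfolding tet_eq_def p1_def p2' by simp
    show "tet_eq hace uce habc habe hbce \<longleftrightarrow> p2 = p3"
      using C yC unfolding tet_eq_def p2_def p3_def by simp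
    show "tet_eq hbde ude hbcd hbce hcde \<longleftrightarrow> p3 = p4"
      using C yC unfolding tet_eq_def p3' p4' by auto
    show "tet_eq hade ude habd habe hbde \<longleftrightarrow> p4 = p5"
      using C yC unfolding tet_eq_def p4_def p5_def by auto
    show "tet_eq hacd ucd habc habd hbcd \<longleftrightarrow> p5 = p1"
      using C yC unfolding tet_eq_def p5' p1' by (auto simp: act_inj)
  qed
qed

end

section \<open>Flat colourings\<close>

lemma sorted_enumeration:
  assumes "finite U" "inj_on r U"
  obtains xs where "set xs = U" "length xs = card U" "sorted_wrt (\<lambda>x y. r x < (r y :: nat)) xs"
proof -
  let ?f = "inv_into U r"
  let ?ys = "sorted_list_of_set (r ` U)"
  have ys: "set ?ys = r ` U" "sorted_wrt (<) ?ys" "length ?ys = card (r ` U)"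
    using assms(1) by (auto simp: strict_sorted_list_of_set)
  have rf: "r (?f y) = y" if "y \<in> r ` U" for y
    using that by (rule f_inv_into_f)
  show thesis
  proof
    show "set (map ?f ?ys) = U"
      using assms ys(1) by (auto simp: image_image)
    show "length (map ?f ?ys) = card U"
      using assms ys(3) by (simp add: card_image)
    have "sorted_wrt (\<lambda>a b. r (?f a) < r (?f b)) ?ys"
      using ys(2) by (rule sorted_wrt_mono_rel[rotated]) (use ys(1) rf in auto)
    then show "sorted_wrt (\<lambda>x y. r x < r y) (map ?f ?ys)"
      by (simp add: sorted_wrt_map)
  qed
qed

lemma sorted_enumeration_unique:
  assumes "sorted_wrt (\<lambda>x y. r x < (r y :: nat)) xs" "sorted_wrt (\<lambda>x y. r x < r y) ys"
    and "set xs = set ys"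
  shows "xs = ys"
proof -
  have s: "sorted_wrt (<) (map r xs)" "sorted_wrt (<) (map r ys)"
    using assms by (simp_all add: sorted_wrt_map)
  have "map r xs = map r ys"
    using s assms(3) by (intro strict_sorted_equal) auto
  moreover have "inj_on r (set ys)"
  proof -
    have "distinct (map r ys)"
      using s(2) strict_sorted_iff by blast
    then show ?thesis by (simp add: distinct_map)
  qed
  ultimately show ?thesis
    using assms(3) by (metis inj_on_map_eq_map sup.idem)
qed

lemma sorted3:
  assumes "card U = 3" "inj_on r U"
  obtains j k l where "U = {j,k,l}" "r j < (r k :: nat)" "r k < r l"
proof -
  have "finite U" using assms(1) card.infinite by fastforce
  from sorted_enumeration[OF this assms(2)] obtain xs
    where xs: "set xs = U" "length xs = card U" "sorted_wrt (\<lambda>x y. r x < r y) xs" .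
  from xs(2) assms(1) obtain j k l where "xs = [j,k,l]"
    by (auto simp: numeral_3_eq_3 length_Suc_conv)
  with xs that show thesis by auto
qed

lemma sorted4:
  assumes "card U = 4" "inj_on r U"
  obtains j k l m where "U = {j,k,l,m}" "r j < (r k :: nat)" "r k < r l" "r l < r m"
proof -
  have "finite U" using assms(1) card.infinite by fastforce
  from sorted_enumeration[OF this assms(2)] obtain xs
    where xs: "set xs = U" "length xs = card U" "sorted_wrt (\<lambda>x y. r x < r y) xs" .
  from xs(2) assms(1) obtain j k l m where "xs = [j,k,l,m]"
    by (auto simp: eval_nat_numeral length_Suc_conv)
  with xs that show thesis by auto
qed

lemma sorted5:
  assumes "card U = 5" "inj_on r U"
  obtains j k l m n where "U = {j,k,l,m,n}" "r j < (r k :: nat)" "r k < r l" "r l < r m" "r m < r n"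
proof -
  have "finite U" using assms(1) card.infinite by fastforce
  from sorted_enumeration[OF this assms(2)] obtain xs
    where xs: "set xs = U" "length xs = card U" "sorted_wrt (\<lambda>x y. r x < r y) xs" .
  from xs(2) assms(1) obtain j k l m n where "xs = [j,k,l,m,n]"
    by (auto simp: eval_nat_numeral length_Suc_conv)
  with xs that show thesis by auto
qed

section \<open>Complexes, restriction of colourings, flatness\<close>

lemma asc_mono: "asc K \<Longrightarrow> S \<in> K \<Longrightarrow> T \<subseteq> S \<Longrightarrow> T \<noteq> {} \<Longrightarrow> T \<in> K"
  unfolding asc_def by blast

lemma asc_finite: "asc K \<Longrightarrow> finite K"
  unfolding asc_def by blast

lemma asc_simplex: "asc K \<Longrightarrow> S \<in> K \<Longrightarrow> finite S \<and> S \<noteq> {}"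
  unfolding asc_def by blast

lemma finite_vertices: "asc K \<Longrightarrow> finite (\<Union>K)"
  using asc_finite asc_simplex by blast

definition agree :: "'v set set \<Rightarrow> ('v set \<Rightarrow> 'g) \<Rightarrow> ('v set \<Rightarrow> 'h) \<Rightarrow> ('v set \<Rightarrow> 'g) \<Rightarrow> ('v set \<Rightarrow> 'h) \<Rightarrow> bool" where
  "agree D g h g' h' \<longleftrightarrow> (\<forall>S\<in>D. (card S = 2 \<longrightarrow> g S = g' S) \<and> (card S = 3 \<longrightarrow> h S = h' S))"

abbreviation edges :: "'v set set \<Rightarrow> 'v set set" where "edges K \<equiv> {S \<in> K. card S = 2}"
abbreviation triangles :: "'v set set \<Rightarrow> 'v set set" where "triangles K \<equiv> {S \<in> K. card S = 3}"

text \<open>Values off the edges and triangles become \<open>undefined\<close>, so that equal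
  colourings are equal functions and can be counted.\<close>

definition rst :: "'v set set \<Rightarrow> ('v set \<Rightarrow> 'g) \<times> ('v set \<Rightarrow> 'h) \<Rightarrow> ('v set \<Rightarrow> 'g) \<times> ('v set \<Rightarrow> 'h)" where
  "rst K = (\<lambda>(g, h). (restrict g (edges K), restrict h (triangles K)))"

lemma rst_rst: "L \<subseteq> M \<Longrightarrow> rst L (rst M c) = rst L c"
  by (auto simp: rst_def fun_eq_iff split: prod.splits)

context finite_crossed_module
begin

text \<open>Quantifying over all increasing enumerations avoids extracting one. The strict
  inequalities force distinct vertices, so sets of sizes other than 2, 3, 4 carry no
  condition.\<close>

definition flat_at :: "('v \<Rightarrow> nat) \<Rightarrow> ('v set \<Rightarrow> 'g) \<Rightarrow> ('v set \<Rightarrow> 'h) \<Rightarrow> 'v set \<Rightarrow> bool" where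
  "flat_at r g h U \<longleftrightarrow>
     (card U = 2 \<longrightarrow> g U \<in> carrier G) \<and> (card U = 3 \<longrightarrow> h U \<in> carrier H) \<and>
     (\<forall>j k l. U = {j,k,l} \<longrightarrow> r j < r k \<longrightarrow> r k < r l \<longrightarrow>
        tri_eq (h {j,k,l}) (g {k,l}) (g {j,k}) (g {j,l})) \<and>
     (\<forall>j k l m. U = {j,k,l,m} \<longrightarrow> r j < r k \<longrightarrow> r k < r l \<longrightarrow> r l < r m \<longrightarrow>
        tet_eq (h {j,l,m}) (g {l,m}) (h {j,k,l}) (h {j,k,m}) (h {k,l,m}))"

definition flat :: "('v \<Rightarrow> nat) \<Rightarrow> 'v set set \<Rightarrow> ('v set \<Rightarrow> 'g) \<Rightarrow> ('v set \<Rightarrow> 'h) \<Rightarrow> bool" where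
  "flat r K g h \<longleftrightarrow> (\<forall>U\<in>K. flat_at r g h U)"

lemma flat_at_cong:
  assumes "\<And>V. V \<subseteq> U \<Longrightarrow> card V = 2 \<Longrightarrow> g V = g' V" "\<And>V. V \<subseteq> U \<Longrightarrow> card V = 3 \<Longrightarrow> h V = h' V"
  shows "flat_at r g h U \<longleftrightarrow> flat_at r g' h' U"
proof -
  have "flat_at r g' h' U" if f: "flat_at r g h U" and
      eg: "\<And>V. V \<subseteq> U \<Longrightarrow> card V = 2 \<Longrightarrow> g V = g' V" and eh: "\<And>V. V \<subseteq> U \<Longrightarrow> card V = 3 \<Longrightarrow> h V = h' V"
    for g h g' h'
    unfolding flat_at_def
  proof (intro conjI allI impI)
    show "g' U \<in> carrier G" if "card U = 2"
      using that f eg[of U] by (auto simp: flat_at_def)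
    show "h' U \<in> carrier H" if "card U = 3"
      using that f eh[of U] by (auto simp: flat_at_def)
  next
    fix j k l assume a: "U = {j,k,l}" "r j < r k" "r k < r l"
    have "card {j,k} = 2" "card {k,l} = 2" "card {j,l} = 2" "card {j,k,l} = 3"
      using a(2,3) by (subst card_insert_disjoint, auto)+
    then have "h {j,k,l} = h' {j,k,l}" "g {k,l} = g' {k,l}" "g {j,k} = g' {j,k}" "g {j,l} = g' {j,l}"
      using a(1) by (simp_all add: eg eh)
    moreover have "tri_eq (h {j,k,l}) (g {k,l}) (g {j,k}) (g {j,l})"
      using f a unfolding flat_at_def by blast
    ultimately show "tri_eq (h' {j,k,l}) (g' {k,l}) (g' {j,k}) (g' {j,l})" by simp
  next
    fix j k l m assume a: "U = {j,k,l,m}" "r j < r k" "r k < r l" "r l < r m"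
    have "card {l,m} = 2" "card {j,k,l} = 3" "card {k,l,m} = 3" "card {j,l,m} = 3" "card {j,k,m} = 3"
      using a(2-4) by (subst card_insert_disjoint, auto)+
    then have "h {j,l,m} = h' {j,l,m}" "g {l,m} = g' {l,m}" "h {j,k,l} = h' {j,k,l}"
       "h {j,k,m} = h' {j,k,m}" "h {k,l,m} = h' {k,l,m}"
      using a(1) by (simp_all add: eg eh)
    moreover have "tet_eq (h {j,l,m}) (g {l,m}) (h {j,k,l}) (h {j,k,m}) (h {k,l,m})"
      using f a unfolding flat_at_def by blast
    ultimately show "tet_eq (h' {j,l,m}) (g' {l,m}) (h' {j,k,l}) (h' {j,k,m}) (h' {k,l,m})" by simp
  qed
  from this[of g h g' h'] this[of g' h' g h] show ?thesis
    using assms by metis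
qed

lemma flat_at_edge: "card U = 2 \<Longrightarrow> flat_at r g h U \<longleftrightarrow> g U \<in> carrier G"
proof -
  assume c: "card U = 2"
  have "U \<noteq> {j,k,l}" if "r j < r k" "r k < r l" for j k l
  proof -
    have "card {j,k,l} = 3" using that by (subst card_insert_disjoint, auto)+
    then show ?thesis using c by auto
  qed
  moreover have "U \<noteq> {j,k,l,m}" if "r j < r k" "r k < r l" "r l < r m" for j k l m
  proof -
    have "card {j,k,l,m} = 4" using that by (subst card_insert_disjoint, auto)+
    then show ?thesis using c by auto
  qed
  moreover have "card U \<noteq> 3" using c by simp
  ultimately show ?thesis using c unfolding flat_at_def by blast
qed

lemma flat_at_triangle:
  assumes s: "r j < r k" "r k < r l"
  shows "flat_at r g h {j,k,l} \<longleftrightarrow>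
    h {j,k,l} \<in> carrier H \<and> tri_eq (h {j,k,l}) (g {k,l}) (g {j,k}) (g {j,l})"
proof -
  have c: "card {j,k,l} = 3" using s by (subst card_insert_disjoint, auto)+
  have u: "j' = j \<and> k' = k \<and> l' = l"
    if "{j,k,l} = {j',k',l'}" "r j' < r k'" "r k' < r l'" for j' k' l'
    using sorted_enumeration_unique[of r "[j,k,l]" "[j',k',l']"] s that by auto
  have "{j,k,l} \<noteq> {j',k',l',m'}" if "r j' < r k'" "r k' < r l'" "r l' < r m'" for j' k' l' m'
  proof -
    have "card {j',k',l',m'} = 4" using that by (subst card_insert_disjoint, auto)+
    then show ?thesis using c by auto
  qed
  note n4 = this
  have "flat_at r g h {j,k,l}"
    if "h {j,k,l} \<in> carrier H" "tri_eq (h {j,k,l}) (g {k,l}) (g {j,k}) (g {j,l})"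
    unfolding flat_at_def
  proof (intro conjI allI impI)
    fix j' k' l' assume "{j,k,l} = {j',k',l'}" "r j' < r k'" "r k' < r l'"
    from u[OF this] that(2) show "tri_eq (h {j',k',l'}) (g {k',l'}) (g {j',k'}) (g {j',l'})" by simp
  qed (use c n4 that in simp_all)
  moreover have "h {j,k,l} \<in> carrier H \<and> tri_eq (h {j,k,l}) (g {k,l}) (g {j,k}) (g {j,l})"
    if "flat_at r g h {j,k,l}"
    using that c s unfolding flat_at_def by blast
  ultimately show ?thesis by blast
qed

lemma flat_at_tetrahedron:
  assumes s: "r j < r k" "r k < r l" "r l < r m"
  shows "flat_at r g h {j,k,l,m} \<longleftrightarrow>
    tet_eq (h {j,l,m}) (g {l,m}) (h {j,k,l}) (h {j,k,m}) (h {k,l,m})"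
proof -
  have c: "card {j,k,l,m} = 4" using s by (subst card_insert_disjoint, auto)+
  have u: "j' = j \<and> k' = k \<and> l' = l \<and> m' = m"
    if "{j,k,l,m} = {j',k',l',m'}" "r j' < r k'" "r k' < r l'" "r l' < r m'" for j' k' l' m'
    using sorted_enumeration_unique[of r "[j,k,l,m]" "[j',k',l',m']"] s that by auto
  have "{j,k,l,m} \<noteq> {j',k',l'}" if "r j' < r k'" "r k' < r l'" for j' k' l'
  proof -
    have "card {j',k',l'} = 3" using that by (subst card_insert_disjoint, auto)+
    then show ?thesis using c by auto
  qed
  note n3 = this
  have "flat_at r g h {j,k,l,m}"
    if "tet_eq (h {j,l,m}) (g {l,m}) (h {j,k,l}) (h {j,k,m}) (h {k,l,m})"
    unfolding flat_at_def
  proof (intro conjI allI impI)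
    fix j' k' l' m' assume "{j,k,l,m} = {j',k',l',m'}" "r j' < r k'" "r k' < r l'" "r l' < r m'"
    from u[OF this] that
    show "tet_eq (h {j',l',m'}) (g {l',m'}) (h {j',k',l'}) (h {j',k',m'}) (h {k',l',m'})" by simp
  qed (use c n3 that in simp_all)
  moreover have "tet_eq (h {j,l,m}) (g {l,m}) (h {j,k,l}) (h {j,k,m}) (h {k,l,m})"
    if "flat_at r g h {j,k,l,m}"
    using that s unfolding flat_at_def by blast
  ultimately show ?thesis by blast
qed

lemma flat_at_other:
  assumes "card U \<noteq> 2" "card U \<noteq> 3" "card U \<noteq> 4"
  shows "flat_at r g h U"
proof -
  have "U \<noteq> {j,k,l}" if "r j < r k" "r k < r l" for j k l
  proof -
    have "card {j,k,l} = 3" using that by (subst card_insert_disjoint, auto)+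
    then show ?thesis using assms by auto
  qed
  moreover have "U \<noteq> {j,k,l,m}" if "r j < r k" "r k < r l" "r l < r m" for j k l m
  proof -
    have "card {j,k,l,m} = 4" using that by (subst card_insert_disjoint, auto)+
    then show ?thesis using assms by auto
  qed
  ultimately show ?thesis using assms unfolding flat_at_def by blast
qed

lemma flat_cong:
  assumes "asc K" "agree K g h g' h'"
  shows "flat r K g h \<longleftrightarrow> flat r K g' h'"
proof -
  have "flat_at r g h U \<longleftrightarrow> flat_at r g' h' U" if "U \<in> K" for U
  proof (rule flat_at_cong)
    fix V assume V: "V \<subseteq> U"
    have "V \<in> K" if "card V \<noteq> 0"
      using that asc_mono[OF assms(1) \<open>U \<in> K\<close> V] by (cases "V = {}") auto
    then show "card V = 2 \<Longrightarrow> g V = g' V" "card V = 3 \<Longrightarrow> h V = h' V"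
      using assms(2) by (auto simp: agree_def)
  qed
  then show ?thesis by (auto simp: flat_def)
qed

lemma flat_subset: "flat r K g h \<Longrightarrow> L \<subseteq> K \<Longrightarrow> flat r L g h"
  by (auto simp: flat_def)

section \<open>Counting colourings and their extensions\<close>

definition col :: "('v \<Rightarrow> nat) \<Rightarrow> 'v set set \<Rightarrow> (('v set \<Rightarrow> 'g) \<times> ('v set \<Rightarrow> 'h)) set" where
  "col r K = {(g, h). g \<in> extensional (edges K) \<and> h \<in> extensional (triangles K) \<and> flat r K g h}"

definition exts :: "('v \<Rightarrow> nat) \<Rightarrow> 'v set set \<Rightarrow> 'v set set \<Rightarrow> ('v set \<Rightarrow> 'g) \<times> ('v set \<Rightarrow> 'h)
    \<Rightarrow> (('v set \<Rightarrow> 'g) \<times> ('v set \<Rightarrow> 'h)) set" where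
  "exts r L K c = {c' \<in> col r K. rst L c' = c}"

text \<open>The normalisation of the invariant, up to the cancelling contributions of the delta functions.\<close>

definition wt :: "'v set set \<Rightarrow> real" where
  "wt D = (\<Prod>S\<in>D. if card S = 1 then real (card (carrier G)) / real (card (carrier H))
                   else if card S = 2 then real (card (carrier H)) else 1)"

lemma card_G_pos: "card (carrier G) > 0"
  using finG G.one_closed by (auto simp: card_gt_0_iff)

lemma card_H_pos: "card (carrier H) > 0"
  using finH H.one_closed by (auto simp: card_gt_0_iff)

lemma wt_pos: "wt D > 0"
  unfolding wt_def using card_G_pos card_H_pos by (intro prod_pos) auto

lemma wt_Un: "finite A \<Longrightarrow> finite B \<Longrightarrow> A \<inter> B = {} \<Longrightarrow> wt (A \<union> B) = wt A * wt B"
  unfolding wt_def by (rule prod.union_disjoint)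

lemma finite_col:
  assumes "asc K" shows "finite (col r K)"
proof -
  have "finite (edges K)" "finite (triangles K)" using asc_finite[OF assms] by auto
  then have "finite ((edges K \<rightarrow>\<^sub>E carrier G) \<times> (triangles K \<rightarrow>\<^sub>E carrier H))"
    using finG finH by (intro finite_cartesian_product finite_PiE) auto
  moreover have "col r K \<subseteq> (edges K \<rightarrow>\<^sub>E carrier G) \<times> (triangles K \<rightarrow>\<^sub>E carrier H)"
    by (auto simp: col_def PiE_def flat_def flat_at_def)
  ultimately show ?thesis by (rule finite_subset[rotated])
qed

lemma rst_flat:
  assumes "asc K" "flat r K g h"
  shows "flat r K (restrict g (edges K)) (restrict h (triangles K))"
  using assms(2) flat_cong[OF assms(1), of g h "restrict g (edges K)" "restrict h (triangles K)"]
  by (simp add: agree_def)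

lemma rst_col:
  assumes "asc L" "L \<subseteq> K" "c \<in> col r K"
  shows "rst L c \<in> col r L"
proof -
  obtain g h where c: "c = (g, h)" by fastforce
  have "flat r L (restrict g (edges L)) (restrict h (triangles L))"
    using assms c by (intro rst_flat) (auto simp: col_def intro: flat_subset)
  then show ?thesis by (simp add: c rst_def col_def)
qed

lemma rst_self: "c \<in> col r K \<Longrightarrow> rst K c = c"
  by (auto simp: rst_def col_def extensional_restrict)

text \<open>The extensions over \<open>K\<close> are partitioned by their restriction to
  \<open>M\<close>.\<close>

lemma exts_tower:
  assumes "asc M" "asc K" "L \<subseteq> M" "M \<subseteq> K"
  shows "card (exts r L K c) = (\<Sum>c'\<in>exts r L M c. card (exts r M K c'))"
proof -
  have "exts r L K c = (\<Union>c'\<in>exts r L M c. exts r M K c')"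
  proof (intro equalityI subsetI)
    fix c' assume "c' \<in> exts r L K c"
    then have "c' \<in> exts r M K (rst M c')" "rst M c' \<in> exts r L M c"
      using rst_col[OF assms(1,4)] rst_rst[OF assms(3), of c'] by (auto simp: exts_def)
    then show "c' \<in> (\<Union>c'\<in>exts r L M c. exts r M K c')" by blast
  next
    fix c' assume "c' \<in> (\<Union>c'\<in>exts r L M c. exts r M K c')"
    then show "c' \<in> exts r L K c"
      using rst_rst[OF assms(3), of c'] by (auto simp: exts_def)
  qed
  moreover have "card (\<Union>c'\<in>exts r L M c. exts r M K c') = (\<Sum>c'\<in>exts r L M c. card (exts r M K c'))"
    using finite_col[OF assms(1)] finite_col[OF assms(2)]
    by (intro card_UN_disjoint) (auto simp: exts_def)
  ultimately show ?thesis by simp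
qed

lemma card_col_exts:
  assumes "asc L" "asc K" "L \<subseteq> K" "\<And>c. c \<in> col r L \<Longrightarrow> real (card (exts r L K c)) = w"
  shows "real (card (col r K)) = real (card (col r L)) * w"
proof -
  have "col r K = (\<Union>c\<in>col r L. exts r L K c)"
    using assms(1-3) rst_col by (auto simp: exts_def)
  moreover have "card (\<Union>c\<in>col r L. exts r L K c) = (\<Sum>c\<in>col r L. card (exts r L K c))"
    using finite_col[OF assms(1)] finite_col[OF assms(2)]
    by (intro card_UN_disjoint) (auto simp: exts_def)
  ultimately show ?thesis using assms(4) by simp
qed

end

section \<open>Elementary expansions\<close>

context finite_crossed_module
begin

text \<open>For a free edge of a triangle: in each of the three positions the remaining colours
  force it.\<close>

lemma tri_solve:
  assumes "y \<in> carrier H" "a \<in> carrier G" "b \<in> carrier G"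
  shows "\<exists>!x. x \<in> carrier G \<and> tri_eq y a b x" "\<exists>!x. x \<in> carrier G \<and> tri_eq y x a b"
    "\<exists>!x. x \<in> carrier G \<and> tri_eq y a x b"
proof -
  show "\<exists>!x. x \<in> carrier G \<and> tri_eq y a b x"
    using assms by (auto simp: tri_eq_def)
  show "\<exists>!x. x \<in> carrier G \<and> tri_eq y x a b"
  proof (rule ex1I[of _ "inv\<^bsub>G\<^esub> (bd y) \<otimes>\<^bsub>G\<^esub> (b \<otimes>\<^bsub>G\<^esub> inv\<^bsub>G\<^esub> a)"])
    have "bd y \<otimes>\<^bsub>G\<^esub> (inv\<^bsub>G\<^esub> (bd y) \<otimes>\<^bsub>G\<^esub> (b \<otimes>\<^bsub>G\<^esub> inv\<^bsub>G\<^esub> a)) = b \<otimes>\<^bsub>G\<^esub> inv\<^bsub>G\<^esub> a"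
      using assms by (simp add: G.m_assoc[symmetric])
    then show "inv\<^bsub>G\<^esub> (bd y) \<otimes>\<^bsub>G\<^esub> (b \<otimes>\<^bsub>G\<^esub> inv\<^bsub>G\<^esub> a) \<in> carrier G \<and>
        tri_eq y (inv\<^bsub>G\<^esub> (bd y) \<otimes>\<^bsub>G\<^esub> (b \<otimes>\<^bsub>G\<^esub> inv\<^bsub>G\<^esub> a)) a b"
      using assms by (simp add: tri_eq_def G.m_assoc)
  next
    fix x assume x: "x \<in> carrier G \<and> tri_eq y x a b"
    then have "b \<otimes>\<^bsub>G\<^esub> inv\<^bsub>G\<^esub> a = bd y \<otimes>\<^bsub>G\<^esub> x"
      using assms by (auto simp: tri_eq_def G.m_assoc)
    then show "x = inv\<^bsub>G\<^esub> (bd y) \<otimes>\<^bsub>G\<^esub> (b \<otimes>\<^bsub>G\<^esub> inv\<^bsub>G\<^esub> a)"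
      using assms x by (simp add: G.m_assoc[symmetric])
  qed
  show "\<exists>!x. x \<in> carrier G \<and> tri_eq y a x b"
  proof (rule ex1I[of _ "inv\<^bsub>G\<^esub> (bd y \<otimes>\<^bsub>G\<^esub> a) \<otimes>\<^bsub>G\<^esub> b"])
    have c: "bd y \<otimes>\<^bsub>G\<^esub> a \<in> carrier G" using assms by simp
    show "inv\<^bsub>G\<^esub> (bd y \<otimes>\<^bsub>G\<^esub> a) \<otimes>\<^bsub>G\<^esub> b \<in> carrier G \<and> tri_eq y a (inv\<^bsub>G\<^esub> (bd y \<otimes>\<^bsub>G\<^esub> a) \<otimes>\<^bsub>G\<^esub> b) b"
      using c assms(3) by (simp add: tri_eq_def G.m_assoc[OF c G.inv_closed[OF c] assms(3), symmetric])
  next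
    fix x assume x: "x \<in> carrier G \<and> tri_eq y a x b"
    have c: "bd y \<otimes>\<^bsub>G\<^esub> a \<in> carrier G" using assms by simp
    have "b = (bd y \<otimes>\<^bsub>G\<^esub> a) \<otimes>\<^bsub>G\<^esub> x" using x by (simp add: tri_eq_def)
    then show "x = inv\<^bsub>G\<^esub> (bd y \<otimes>\<^bsub>G\<^esub> a) \<otimes>\<^bsub>G\<^esub> b"
      using c x by (simp add: G.m_assoc[OF G.inv_closed[OF c] c, symmetric])
  qed
qed

lemma H_solve:
  assumes "a \<in> carrier H" "b \<in> carrier H"
  shows "\<exists>!x. x \<in> carrier H \<and> a \<otimes>\<^bsub>H\<^esub> x = b" "\<exists>!x. x \<in> carrier H \<and> x \<otimes>\<^bsub>H\<^esub> a = b"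
proof -
  show "\<exists>!x. x \<in> carrier H \<and> a \<otimes>\<^bsub>H\<^esub> x = b"
  proof (rule ex1I[of _ "inv\<^bsub>H\<^esub> a \<otimes>\<^bsub>H\<^esub> b"])
    fix x assume "x \<in> carrier H \<and> a \<otimes>\<^bsub>H\<^esub> x = b"
    then show "x = inv\<^bsub>H\<^esub> a \<otimes>\<^bsub>H\<^esub> b" using assms by (auto simp: H.m_assoc[symmetric])
  qed (use assms in \<open>simp add: H.m_assoc[symmetric]\<close>)
  show "\<exists>!x. x \<in> carrier H \<and> x \<otimes>\<^bsub>H\<^esub> a = b"
  proof (rule ex1I[of _ "b \<otimes>\<^bsub>H\<^esub> inv\<^bsub>H\<^esub> a"])
    fix x assume "x \<in> carrier H \<and> x \<otimes>\<^bsub>H\<^esub> a = b"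
    then show "x = b \<otimes>\<^bsub>H\<^esub> inv\<^bsub>H\<^esub> a" using assms by (auto simp: H.m_assoc)
  qed (use assms in \<open>simp add: H.m_assoc\<close>)
qed

text \<open>For a free triangle of a tetrahedron, in each of the four positions; the one under the
  action uses that \<open>act g\<close> is invertible.\<close>

lemma tet_solve:
  assumes "a \<in> carrier H" "b \<in> carrier H" "c \<in> carrier H" "g \<in> carrier G"
  shows "\<exists>!x. x \<in> carrier H \<and> tet_eq x g a b c" "\<exists>!x. x \<in> carrier H \<and> tet_eq a g x b c"
    "\<exists>!x. x \<in> carrier H \<and> tet_eq a g b x c" "\<exists>!x. x \<in> carrier H \<and> tet_eq a g b c x"
proof -
  show "\<exists>!x. x \<in> carrier H \<and> tet_eq x g a b c"
    using H_solve(2)[of "act g a" "b \<otimes>\<^bsub>H\<^esub> c"] assms by (simp add: tet_eq_def)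
  show "\<exists>!x. x \<in> carrier H \<and> tet_eq a g b x c"
    using H_solve(2)[of c "a \<otimes>\<^bsub>H\<^esub> act g b"] assms by (simp add: tet_eq_def eq_commute)
  show "\<exists>!x. x \<in> carrier H \<and> tet_eq a g b c x"
    using H_solve(1)[of c "a \<otimes>\<^bsub>H\<^esub> act g b"] assms by (simp add: tet_eq_def eq_commute)
  obtain z where z: "z \<in> carrier H" "a \<otimes>\<^bsub>H\<^esub> z = b \<otimes>\<^bsub>H\<^esub> c"
    and zu: "\<And>z'. z' \<in> carrier H \<Longrightarrow> a \<otimes>\<^bsub>H\<^esub> z' = b \<otimes>\<^bsub>H\<^esub> c \<Longrightarrow> z' = z"
    using H_solve(1)[of a "b \<otimes>\<^bsub>H\<^esub> c"] assms by auto
  have inv: "act g (act (inv\<^bsub>G\<^esub> g) x) = x" "act (inv\<^bsub>G\<^esub> g) (act g x) = x" if "x \<in> carrier H" for x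
    using that assms by (simp_all flip: act_comp add: act_one)
  show "\<exists>!x. x \<in> carrier H \<and> tet_eq a g x b c"
  proof (rule ex1I[of _ "act (inv\<^bsub>G\<^esub> g) z"])
    show "act (inv\<^bsub>G\<^esub> g) z \<in> carrier H \<and> tet_eq a g (act (inv\<^bsub>G\<^esub> g) z) b c"
      using z assms inv by (simp add: tet_eq_def)
    fix x assume "x \<in> carrier H \<and> tet_eq a g x b c"
    then show "x = act (inv\<^bsub>G\<^esub> g) z"
      using zu[of "act g x"] assms inv by (auto simp: tet_eq_def)
  qed
qed

text \<open>Since colourings are extensional, extending over a removed pair means changing
  \<open>g\<close> and \<open>h\<close> at \<open>S\<close> and \<open>T\<close> only, and checking
  flatness there; outside \<open>K\<close> old and new functions are both \<open>undefined\<close>.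
  Extensions can thus be written as function updates.\<close>

lemma exts_pair_iff:
  assumes K: "asc K" and L: "asc L" "L = K - {S, T}" and ST: "S \<in> K" "T \<in> K"
    and c: "(g, h) \<in> col r L"
  shows "(g', h') \<in> exts r L K (g, h) \<longleftrightarrow>
    (\<forall>U. \<not> (U \<in> {S,T} \<and> card U = 2) \<longrightarrow> g' U = g U) \<and>
    (\<forall>U. \<not> (U \<in> {S,T} \<and> card U = 3) \<longrightarrow> h' U = h U) \<and>
    flat_at r g' h' S \<and> flat_at r g' h' T" (is "?l \<longleftrightarrow> ?r")
proof
  assume l: ?l
  then have col: "g' \<in> extensional (edges K)" "h' \<in> extensional (triangles K)" "flat r K g' h'"
    and rg: "restrict g' (edges L) = g" and rh: "restrict h' (triangles L) = h"
    by (auto simp: exts_def col_def rst_def)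
  have "g' U = g U" if "\<not> (U \<in> {S,T} \<and> card U = 2)" for U
    using that col(1) L(2) unfolding rg[symmetric] by (auto simp: extensional_def)
  moreover have "h' U = h U" if "\<not> (U \<in> {S,T} \<and> card U = 3)" for U
    using that col(2) L(2) unfolding rh[symmetric] by (auto simp: extensional_def)
  ultimately show ?r using col(3) ST by (simp add: flat_def)
next
  assume r: ?r
  note rg = r[THEN conjunct1, rule_format] and rh = r[THEN conjunct2, THEN conjunct1, rule_format]
  have ge: "g \<in> extensional (edges L)" "h \<in> extensional (triangles L)" and fl: "flat r L g h"
    using c by (auto simp: col_def)
  have ag: "agree L g h g' h'"
    using r L(2) by (simp add: agree_def)
  have "flat r L g' h'" using flat_cong[OF L(1) ag] fl by simp
  then have "flat r K g' h'" using r L(2) by (auto simp: flat_def)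
  moreover have "g' \<in> extensional (edges K)"
    unfolding extensional_def
  proof (intro CollectI allI impI)
    fix U assume U: "U \<notin> edges K"
    then have "g' U = g U" using ST by (intro rg) auto
    also have "\<dots> = undefined" using U L(2) by (intro extensional_arb[OF ge(1)]) simp
    finally show "g' U = undefined" .
  qed
  moreover have "h' \<in> extensional (triangles K)"
    unfolding extensional_def
  proof (intro CollectI allI impI)
    fix U assume U: "U \<notin> triangles K"
    then have "h' U = h U" using ST by (intro rh) auto
    also have "\<dots> = undefined" using U L(2) by (intro extensional_arb[OF ge(2)]) simp
    finally show "h' U = undefined" .
  qed
  moreover have "restrict g' (edges L) = g"
    by (rule extensionalityI[OF restrict_extensional ge(1)]) (use ag in \<open>simp add: agree_def\<close>)
  moreover have "restrict h' (triangles L) = h"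
    by (rule extensionalityI[OF restrict_extensional ge(2)]) (use ag in \<open>simp add: agree_def\<close>)
  ultimately show ?l by (simp add: exts_def col_def rst_def)
qed

text \<open>The size of the free face \<open>S\<close> decides. Size 1: the new edge is coloured
  freely. Size 2: the triangle is coloured freely and forces the edge. Size 3: the tetrahedron
  forces the triangle, which is then flat. Size 4: no new colour, and the new tetrahedron is flat by
  the pentagon. Beyond that nothing happens.\<close>

lemma elementary_expansion:
  assumes K: "asc K" and L: "asc L" "L = K - {S, T}" and T: "T \<in> K" "T = insert q S" "q \<notin> S" "S \<noteq> {}"
    and inj: "inj_on r T" and c: "c \<in> col r L"
  shows "real (card (exts r L K c)) = wt {S, T}"
proof -
  obtain g h where gh: "c = (g, h)" by fastforce
  note c = c[unfolded gh]
  have SK: "S \<in> K" using asc_mono[OF K T(1), of S] T by auto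
  have finT: "finite T" using asc_simplex[OF K T(1)] by simp
  have cT: "card T = Suc (card S)" using T finT by simp
  have ST: "S \<noteq> T" using T by auto
  note iff = exts_pair_iff[OF K L SK T(1) c]
  have updg: "g' U = g U" if "(g', h') \<in> exts r L K (g, h)" "U \<in> {S,T} \<Longrightarrow> card U \<noteq> 2" for g' h' U
    using that iff by blast
  have updh: "h' U = h U" if "(g', h') \<in> exts r L K (g, h)" "U \<in> {S,T} \<Longrightarrow> card U \<noteq> 3" for g' h' U
    using that iff by blast
  have updf: "flat_at r g' h' S" "flat_at r g' h' T" if "(g', h') \<in> exts r L K (g, h)" for g' h'
    using that iff by blast+
  have face: "V \<in> L" if "V \<subseteq> T" "V \<noteq> {}" "V \<noteq> S" "V \<noteq> T" for V
    using asc_mono[OF K T(1) that(1,2)] that L(2) by auto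
  have face': "V \<in> L" if "V \<subseteq> T" "V \<noteq> {}" "card V \<noteq> card T" "V \<noteq> S" for V
    using face that by auto
  have gG: "g V \<in> carrier G" if "V \<in> L" "card V = 2" for V
    using c that by (auto simp: col_def flat_def flat_at_def)
  have hH: "h V \<in> carrier H" if "V \<in> L" "card V = 3" for V
    using c that by (auto simp: col_def flat_def flat_at_def)
  have flL: "flat_at r g h V" if "V \<in> L" for V
    using c that by (auto simp: col_def flat_def)
  have wtST: "wt {S, T} = (if card S = 1 then real (card (carrier G))
      else if card S = 2 then real (card (carrier H)) else 1)"
    using ST cT card_H_pos T finT by (auto simp: wt_def card_eq_0_iff)
  have "card S > 0" using T finT by (simp add: card_gt_0_iff)
  then consider "card S = 1" | "card S = 2" | "card S = 3" | "card S = 4" | "card S \<ge> 5"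
    by linarith
  then show ?thesis
  proof cases
    case 1
    have form: "g' = g(T := g' T) \<and> h' = h \<and> g' T \<in> carrier G"
      if e: "(g', h') \<in> exts r L K (g, h)" for g' h'
    proof (intro conjI ext)
      show "g' U = (g(T := g' T)) U" for U
        by (cases "U = T") (simp, simp, rule updg[OF e], use 1 in auto)
      show "h' U = h U" for U
        by (rule updh[OF e]) (use 1 cT in auto)
      show "g' T \<in> carrier G"
        using updf(2)[OF e] 1 cT by (simp add: flat_at_edge)
    qed
    have "bij_betw (\<lambda>(g', h'). g' T) (exts r L K (g, h)) (carrier G)"
    proof (rule bij_betwI[where g = "\<lambda>x. (g(T := x), h)"])
      show "(\<lambda>(g', h'). g' T) \<in> exts r L K (g, h) \<rightarrow> carrier G"
        using form by auto
      show "(\<lambda>x. (g(T := x), h)) \<in> carrier G \<rightarrow> exts r L K (g, h)"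
        using 1 cT ST by (simp add: iff flat_at_edge flat_at_other)
      fix c' assume c': "c' \<in> exts r L K (g, h)"
      obtain g' h' where gh': "c' = (g', h')" by fastforce
      show "(\<lambda>x. (g(T := x), h)) ((\<lambda>(g', h'). g' T) c') = c'"
        using form[OF c'[unfolded gh']] gh' by simp
    qed auto
    then show ?thesis using 1 wtST gh by (simp add: bij_betw_same_card)
  next
    case 2
    then have c3: "card T = 3" using cT by simp
    from sorted3[OF this inj] obtain j k l where jkl: "T = {j,k,l}" "r j < r k" "r k < r l" .
    have cs: "card {j,k} = 2" "card {k,l} = 2" "card {j,l} = 2"
      using jkl by (subst card_insert_disjoint, auto)+
    have ne: "{j,k} \<noteq> {k,l}" "{j,k} \<noteq> {j,l}" "{k,l} \<noteq> {j,l}"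
      using jkl by (auto simp: doubleton_eq_iff)
    have Scase: "S = {j,k} \<or> S = {k,l} \<or> S = {j,l}"
    proof -
      have "S = T - {q}" using T by auto
      moreover have "q \<in> {j,k,l}" using T jkl by auto
      ultimately show ?thesis using jkl by auto
    qed
    have ex1: "\<exists>!x. x \<in> carrier G \<and> flat_at r (g(S := x)) (h(T := y)) T" if y: "y \<in> carrier H" for y
    proof -
      have eq: "flat_at r (g(S := x)) (h(T := y)) T \<longleftrightarrow>
         tri_eq y ((g(S := x)) {k,l}) ((g(S := x)) {j,k}) ((g(S := x)) {j,l})" for x
        using flat_at_triangle[where r = r, OF jkl(2,3), of "g(S := x)" "h(T := y)"] y by (simp flip: jkl(1))
      have L2: "g {k,l} \<in> carrier G" if "S \<noteq> {k,l}"
        by (intro gG face') (use that cs c3 jkl(1) in simp_all)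
      have L1: "g {j,k} \<in> carrier G" if "S \<noteq> {j,k}"
        by (intro gG face') (use that cs c3 jkl(1) in simp_all)
      have L3: "g {j,l} \<in> carrier G" if "S \<noteq> {j,l}"
        by (intro gG face') (use that cs c3 jkl(1) in simp_all)
      consider "S = {j,k}" | "S = {k,l}" | "S = {j,l}" using Scase by blast
      then show ?thesis
      proof cases
        case 1
        then show ?thesis unfolding eq
          using tri_solve(3)[OF y L2 L3] ne by auto
      next
        case 2
        then show ?thesis unfolding eq
          using tri_solve(2)[OF y L1 L3] ne by auto
      next
        case 3
        then show ?thesis unfolding eq
          using tri_solve(1)[OF y L2 L1] ne by auto
      qed
    qed
    \<comment> \<open>The colour \<open>y\<close> of the triangle parametrises the extensions;
      \<open>sol y\<close> is the colour it forces on the free edge.\<close>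
    define sol where "sol y = (THE x. x \<in> carrier G \<and> flat_at r (g(S := x)) (h(T := y)) T)" for y
    have sol: "sol y \<in> carrier G \<and> flat_at r (g(S := sol y)) (h(T := y)) T" if "y \<in> carrier H" for y
      unfolding sol_def using theI'[OF ex1[OF that]] .
    have form: "g' = g(S := g' S) \<and> h' = h(T := h' T) \<and> g' S \<in> carrier G \<and> h' T \<in> carrier H \<and> flat_at r g' h' T"
      if "(g', h') \<in> exts r L K (g, h)" for g' h'
    proof (intro conjI ext)
      show "g' U = (g(S := g' S)) U" for U
        by (cases "U = S") (simp, simp, rule updg[OF that], use c3 in auto)
      show "h' U = (h(T := h' T)) U" for U
        by (cases "U = T") (simp, simp, rule updh[OF that], use 2 in auto)
      show "g' S \<in> carrier G"
        using updf(1)[OF that] 2 by (simp add: flat_at_edge)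
      show "h' T \<in> carrier H"
        using updf(2)[OF that] c3 by (simp add: flat_at_def)
    qed (rule updf(2)[OF that])
    have "bij_betw (\<lambda>(g', h'). h' T) (exts r L K (g, h)) (carrier H)"
    proof (rule bij_betwI[where g = "\<lambda>y. (g(S := sol y), h(T := y))"])
      show "(\<lambda>(g', h'). h' T) \<in> exts r L K (g, h) \<rightarrow> carrier H"
        using form by auto
      show "(\<lambda>y. (g(S := sol y), h(T := y))) \<in> carrier H \<rightarrow> exts r L K (g, h)"
        using 2 c3 sol by (simp add: iff flat_at_edge)
    next
      fix c' assume c': "c' \<in> exts r L K (g, h)"
      obtain g' h' where gh': "c' = (g', h')" by fastforce
      note f = form[OF c'[unfolded gh']]
      have "flat_at r (g(S := g' S)) (h(T := h' T)) T" using f by metis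
      then have "sol (h' T) = g' S"
        using ex1[of "h' T"] sol[of "h' T"] f by blast
      then show "(\<lambda>y. (g(S := sol y), h(T := y))) ((\<lambda>(g', h'). h' T) c') = c'"
        using f gh' by simp
    qed auto
    then show ?thesis using 2 wtST gh by (simp add: bij_betw_same_card)
  next
    case 3
    then have c4: "card T = 4" using cT by simp
    from sorted4[OF this inj] obtain j k l m
      where jklm: "T = {j,k,l,m}" "r j < r k" "r k < r l" "r l < r m" .
    note lt = jklm(2-4)
    have lt': "r j < r k" "r j < r l" "r j < r m" "r k < r l" "r k < r m" "r l < r m" using lt by auto
    have cs: "card {j,k} = 2" "card {j,l} = 2" "card {j,m} = 2" "card {k,l} = 2" "card {k,m} = 2"
        "card {l,m} = 2" "card {j,k,l} = 3" "card {j,k,m} = 3" "card {j,l,m} = 3" "card {k,l,m} = 3"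
      using lt' by (subst card_insert_disjoint, auto)+
    have ne: "{j,k,l} \<noteq> {j,k,m}" "{j,k,l} \<noteq> {j,l,m}" "{j,k,l} \<noteq> {k,l,m}"
        "{j,k,m} \<noteq> {j,l,m}" "{j,k,m} \<noteq> {k,l,m}" "{j,l,m} \<noteq> {k,l,m}"
      using sorted_enumeration_unique[of r "[j,k,l]" "[j,k,m]"] sorted_enumeration_unique[of r "[j,k,l]" "[j,l,m]"]
        sorted_enumeration_unique[of r "[j,k,l]" "[k,l,m]"] sorted_enumeration_unique[of r "[j,k,m]" "[j,l,m]"]
        sorted_enumeration_unique[of r "[j,k,m]" "[k,l,m]"] sorted_enumeration_unique[of r "[j,l,m]" "[k,l,m]"] lt'
      by (auto simp del: insert_iff)
    have Scase: "S = {k,l,m} \<or> S = {j,l,m} \<or> S = {j,k,m} \<or> S = {j,k,l}"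
    proof -
      have "S = T - {q}" using T by auto
      moreover have "q \<in> {j,k,l,m}" using T jklm by auto
      ultimately show ?thesis using jklm by auto
    qed
    have E: "g V \<in> carrier G" if "V \<in> {{j,k},{j,l},{j,m},{k,l},{k,m},{l,m}}" for V
    proof -
      have cV: "card V = 2" using that cs by (elim insertE emptyE) simp_all
      show ?thesis
      proof (intro gG face' cV)
        show "V \<subseteq> T" using that jklm(1) by (elim insertE emptyE) simp_all
        show "V \<noteq> {}" "V \<noteq> S" "card V \<noteq> card T" using cV 3 c4 by auto
      qed
    qed
    have F: "h V \<in> carrier H" if "V \<in> {{j,k,l},{j,k,m},{j,l,m},{k,l,m}}" "V \<noteq> S" for V
    proof -
      have cV: "card V = 3" using that(1) cs by (elim insertE emptyE) simp_all
      show ?thesis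
      proof (intro hH face' cV that)
        show "V \<subseteq> T" using that(1) jklm(1) by (elim insertE emptyE) simp_all
        show "V \<noteq> {}" "card V \<noteq> card T" using cV c4 by auto
      qed
    qed
    have tri: "tri_eq (h {a,b,d}) (g {b,d}) (g {a,b}) (g {a,d})"
      if "{a,b,d} \<in> {{j,k,l},{j,k,m},{j,l,m},{k,l,m}}" "{a,b,d} \<noteq> S" "r a < r b" "r b < r d" for a b d
    proof -
      have cV: "card {a,b,d} = 3" using that(1) cs by (elim insertE emptyE) simp_all
      have "{a,b,d} \<subseteq> T" using that(1) jklm(1) by (elim insertE emptyE) simp_all
      then have "{a,b,d} \<in> L" using that(2) cV c4 by (intro face') simp_all
      then show ?thesis using flL flat_at_triangle[where r = r, OF that(3,4)] by blast
    qed
    have eqT: "flat_at r g (h(S := y)) T \<longleftrightarrow>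
       tet_eq ((h(S := y)) {j,l,m}) (g {l,m}) ((h(S := y)) {j,k,l}) ((h(S := y)) {j,k,m}) ((h(S := y)) {k,l,m})" for y
      using flat_at_tetrahedron[where r = r, OF lt, of g "h(S := y)"] by (simp flip: jklm(1))
    have ex1: "\<exists>!y. y \<in> carrier H \<and> flat_at r g (h(S := y)) T"
      using Scase
    proof (elim disjE)
      assume "S = {k,l,m}"
      then show ?thesis unfolding eqT using tet_solve(4)[of "h {j,l,m}" "h {j,k,l}" "h {j,k,m}" "g {l,m}"] F E ne by auto
    next
      assume "S = {j,l,m}"
      then show ?thesis unfolding eqT using tet_solve(1)[of "h {j,k,l}" "h {j,k,m}" "h {k,l,m}" "g {l,m}"] F E ne by auto
    next
      assume "S = {j,k,m}"
      then show ?thesis unfolding eqT using tet_solve(3)[of "h {j,l,m}" "h {j,k,l}" "h {k,l,m}" "g {l,m}"] F E ne by auto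
    next
      assume "S = {j,k,l}"
      then show ?thesis unfolding eqT using tet_solve(2)[of "h {j,l,m}" "h {j,k,m}" "h {k,l,m}" "g {l,m}"] F E ne by auto
    qed
    then obtain y where y: "y \<in> carrier H" "flat_at r g (h(S := y)) T"
      and yu: "\<And>y'. y' \<in> carrier H \<Longrightarrow> flat_at r g (h(S := y')) T \<Longrightarrow> y' = y" by blast
    \<comment> \<open>\<open>y\<close> was determined by the tetrahedron alone. Flatness of
      \<open>S\<close> itself follows from that of the other three faces.\<close>
    have flS: "flat_at r g (h(S := y)) S"
    proof -
      let ?h = "h(S := y)"
      have hc: "?h V \<in> carrier H" if "V \<in> {{j,k,l},{j,k,m},{j,l,m},{k,l,m}}" for V
        using F[OF that] y by auto
      have tri': "{a,b,d} \<noteq> S \<Longrightarrow> tri_eq (?h {a,b,d}) (g {b,d}) (g {a,b}) (g {a,d})"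
        if "{a,b,d} \<in> {{j,k,l},{j,k,m},{j,l,m},{k,l,m}}" "r a < r b" "r b < r d" for a b d
        using tri that by auto
      note four = tet_fourth_face[of "?h {k,l,m}" "?h {j,l,m}" "?h {j,k,m}" "?h {j,k,l}"
            "g {j,k}" "g {j,l}" "g {j,m}" "g {k,l}" "g {k,m}" "g {l,m}"]
      note four' = four[OF hc hc hc hc E E E E E E y(2)[unfolded eqT]]
      show ?thesis using Scase
      proof (elim disjE)
        assume S: "S = {k,l,m}"
        have "tri_eq (?h {k,l,m}) (g {l,m}) (g {k,l}) (g {k,m})"
          by (rule four'(1); (intro tri')?; use ne lt' S in simp)
        then show ?thesis using flat_at_triangle[where r = r, OF lt'(4,6), of g ?h] y(1) unfolding S by simp
      next
        assume S: "S = {j,l,m}"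
        have "tri_eq (?h {j,l,m}) (g {l,m}) (g {j,l}) (g {j,m})"
          by (rule four'(2); (intro tri')?; use ne lt' S in simp)
        then show ?thesis using flat_at_triangle[where r = r, OF lt'(2,6), of g ?h] y(1) unfolding S by simp
      next
        assume S: "S = {j,k,m}"
        have "tri_eq (?h {j,k,m}) (g {k,m}) (g {j,k}) (g {j,m})"
          by (rule four'(3); (intro tri')?; use ne lt' S in simp)
        then show ?thesis using flat_at_triangle[where r = r, OF lt'(1,5), of g ?h] y(1) unfolding S by simp
      next
        assume S: "S = {j,k,l}"
        have "tri_eq (?h {j,k,l}) (g {k,l}) (g {j,k}) (g {j,l})"
          by (rule four'(4); (intro tri')?; use ne lt' S in simp)
        then show ?thesis using flat_at_triangle[where r = r, OF lt'(1,4), of g ?h] y(1) unfolding S by simp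
      qed
    qed
    have "exts r L K (g, h) = {(g, h(S := y))}"
    proof (intro equalityI subsetI)
      fix c' assume c': "c' \<in> exts r L K (g, h)"
      obtain g' h' where gh': "c' = (g', h')" by fastforce
      note e = c'[unfolded gh']
      have "g' U = g U" for U by (rule updg[OF e]) (use 3 c4 in auto)
      moreover have "h' U = (h(S := h' S)) U" for U 
        by (cases "U = S") (simp, simp, rule updh[OF e], use c4 in auto)
      ultimately have i: "g' = g" "h' = h(S := h' S)" "flat_at r g' h' S" "flat_at r g' h' T"
        using updf[OF e] by blast+
      have "h' S \<in> carrier H" using i(3) 3 by (auto simp: flat_at_def)
      moreover have "flat_at r g (h(S := h' S)) T" using i by metis
      ultimately have "h' S = y" by (rule yu)
      then show "c' \<in> {(g, h(S := y))}" using i gh' by simp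
    next
      fix c' assume "c' \<in> {(g, h(S := y))}"
      then show "c' \<in> exts r L K (g, h)" using y flS 3 c4 by (simp add: iff)
    qed
    then show ?thesis using 3 wtST gh by simp
  next
    case 4
    then have c5: "card T = 5" using cT by simp
    from sorted5[OF this inj] obtain a b d e f
      where abc: "T = {a,b,d,e,f}" "r a < r b" "r b < r d" "r d < r e" "r e < r f" .
    note lt = abc(2-5)
    have lt': "r a < r b" "r a < r d" "r a < r e" "r a < r f" "r b < r d" "r b < r e" "r b < r f"
       "r d < r e" "r d < r f" "r e < r f" using lt by auto
    have dist: "a \<noteq> b" "a \<noteq> d" "a \<noteq> e" "a \<noteq> f" "b \<noteq> d" "b \<noteq> e" "b \<noteq> f" "d \<noteq> e" "d \<noteq> f" "e \<noteq> f"
      using lt' by auto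
    have hC: "h {x,y,z} \<in> carrier H" if "{x,y,z} \<subseteq> T" "r x < r y" "r y < r z" for x y z
    proof -
      have "card {x,y,z} = 3" using that by (subst card_insert_disjoint, auto)+
      moreover from this have "{x,y,z} \<noteq> S" using 4 by (intro notI) simp
      ultimately show ?thesis using that c5 by (intro hH face') simp_all
    qed
    have gC: "g {x,y} \<in> carrier G" if "{x,y} \<subseteq> T" "r x < r y" for x y
    proof -
      have "card {x,y} = 2" using that by (subst card_insert_disjoint, auto)+
      moreover from this have "{x,y} \<noteq> S" using 4 by (intro notI) simp
      ultimately show ?thesis using that c5 by (intro gG face') simp_all
    qed
    have tri: "tri_eq (h {d,e,f}) (g {e,f}) (g {d,e}) (g {d,f})"
    proof -
      have "card {d,e,f} = 3" using lt' by (subst card_insert_disjoint, auto)+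
      moreover from this have "{d,e,f} \<noteq> S" using 4 by (intro notI) simp
      ultimately have "{d,e,f} \<in> L" using abc(1) c5 by (intro face') simp_all
      then show ?thesis using flL flat_at_triangle[where r = r, OF lt'(8,10)] by blast
    qed
    have tet: "tet_eq (h {x,z,w}) (g {z,w}) (h {x,y,z}) (h {x,y,w}) (h {y,z,w})"
      if "{x,y,z,w} \<noteq> S" "{x,y,z,w} \<subseteq> T" "r x < r y" "r y < r z" "r z < r w" for x y z w
    proof -
      have "card {x,y,z,w} = 4" using that(3-5) by (subst card_insert_disjoint, auto)+
      then have "{x,y,z,w} \<in> L" using that c5 by (intro face') simp_all
      then show ?thesis using flL flat_at_tetrahedron[where r = r, OF that(3-5)] by blast
    qed
    have Tq: "S = T - {q}" using T by auto
    have minus: "T - {a} = {b,d,e,f}" "T - {b} = {a,d,e,f}" "T - {d} = {a,b,e,f}"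
        "T - {e} = {a,b,d,f}" "T - {f} = {a,b,d,e}"
      unfolding abc(1) using dist by (simp_all add: insert_Diff_if)
    have qS: "T - {x} \<noteq> S" if "x \<in> T" "x \<noteq> q" for x
      using that Tq by blast
    obtain p1 p2 p3 p4 p5 where pent:
      "tet_eq (h {a,e,f}) (g {e,f}) (h {a,d,e}) (h {a,d,f}) (h {d,e,f}) \<longleftrightarrow> p1 = p2"
      "tet_eq (h {a,d,f}) (g {d,f}) (h {a,b,d}) (h {a,b,f}) (h {b,d,f}) \<longleftrightarrow> p2 = p3"
      "tet_eq (h {b,e,f}) (g {e,f}) (h {b,d,e}) (h {b,d,f}) (h {d,e,f}) \<longleftrightarrow> p3 = p4"
      "tet_eq (h {a,e,f}) (g {e,f}) (h {a,b,e}) (h {a,b,f}) (h {b,e,f}) \<longleftrightarrow> p4 = p5"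
      "tet_eq (h {a,d,e}) (g {d,e}) (h {a,b,d}) (h {a,b,e}) (h {b,d,e}) \<longleftrightarrow> p5 = (p1 :: 'h)"
      by (rule pentagon[of "h {a,b,d}" "h {a,b,e}" "h {a,b,f}" "h {a,d,e}" "h {a,d,f}" "h {a,e,f}"
           "h {b,d,e}" "h {b,d,f}" "h {b,e,f}" "h {d,e,f}" "g {d,e}" "g {d,f}" "g {e,f}"])
         (use abc(1) lt' tri in \<open>simp_all add: hC gC\<close>)
    have adef: "q \<noteq> b \<Longrightarrow> p1 = p2" using tet[of a d e f] pent(1) lt' abc(1) qS[of b, unfolded minus] by simp
    have abdf: "q \<noteq> e \<Longrightarrow> p2 = p3" using tet[of a b d f] pent(2) lt' abc(1) qS[of e, unfolded minus] by simp
    have bdef: "q \<noteq> a \<Longrightarrow> p3 = p4" using tet[of b d e f] pent(3) lt' abc(1) qS[of a, unfolded minus] by simp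
    have abef: "q \<noteq> d \<Longrightarrow> p4 = p5" using tet[of a b e f] pent(4) lt' abc(1) qS[of d, unfolded minus] by simp
    have abde: "q \<noteq> f \<Longrightarrow> p5 = p1" using tet[of a b d e] pent(5) lt' abc(1) qS[of f, unfolded minus] by simp
    have qT: "q \<in> {a,b,d,e,f}" using T abc by auto
    have flS: "flat_at r g h S"
    proof -
      \<comment> \<open>Only the equality of the tetrahedron opposite to \<open>q\<close> is
        unknown, and it follows from the other four around the cycle.\<close>
      have all: "p1 = p2" "p2 = p3" "p3 = p4" "p4 = p5" "p5 = p1"
        using adef abdf bdef abef abde dist by metis+
      show ?thesis
        unfolding Tq using qT
        by (elim insertE emptyE) (use all pent lt' in \<open>simp_all add: minus flat_at_tetrahedron\<close>)
    qed
    have "exts r L K (g, h) = {(g, h)}"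
    proof (intro equalityI subsetI)
      fix c' assume c': "c' \<in> exts r L K (g, h)"
      obtain g' h' where gh': "c' = (g', h')" by fastforce
      note e = c'[unfolded gh']
      have "g' U = g U" "h' U = h U" for U 
        by (rule updg[OF e] updh[OF e], use 4 c5 in auto)+
      then have "g' = g" "h' = h" by blast+
      then show "c' \<in> {(g, h)}" using gh' by simp
    qed (use flS 4 c5 in \<open>simp add: iff flat_at_other\<close>)
    then show ?thesis using 4 wtST gh by simp
  next
    case 5
    have "exts r L K (g, h) = {(g, h)}"
    proof (intro equalityI subsetI)
      fix c' assume c': "c' \<in> exts r L K (g, h)"
      obtain g' h' where gh': "c' = (g', h')" by fastforce
      note e = c'[unfolded gh']
      have "g' U = g U" "h' U = h U" for U 
        by (rule updg[OF e] updh[OF e], use 5 cT in auto)+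
      then have "g' = g" "h' = h" by blast+
      then show "c' \<in> {(g, h)}" using gh' by simp
    qed (use 5 cT in \<open>simp add: iff flat_at_other\<close>)
    then show ?thesis using 5 wtST gh by simp
  qed
qed

end

section \<open>Collapsible pairs and extension of colourings\<close>

text \<open>An acyclic matching on the simplices of \<open>K - L\<close>: \<open>S\<close> is paired with \<open>S\<close> with a vertex added or
  removed, and that vertex depends only on the part of \<open>S\<close> inside \<open>W\<close>.\<close>

definition toggles :: "'v set set \<Rightarrow> 'v set set \<Rightarrow> 'v set \<Rightarrow> ('v set \<Rightarrow> 'v) \<Rightarrow> bool" where
  "toggles L K W q \<longleftrightarrow> (\<forall>S\<in>K - L. q (S \<inter> W) \<notin> W \<and> insert (q (S \<inter> W)) S \<in> K \<and> S - {q (S \<inter> W)} \<in> K - L)"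

text \<open>The projections need not be injective, so a simplex may contain several copies of a
  vertex. This is larger than a triangulated product with a simplex, but requires no order on the
  vertices.\<close>

definition bl :: "'v set set \<Rightarrow> nat set set \<Rightarrow> ('v \<times> nat) set set" where
  "bl K Q = {S. finite S \<and> S \<noteq> {} \<and> fst ` S \<in> K \<and> snd ` S \<in> Q}"

abbreviation faces :: "nat set \<Rightarrow> nat set set" where "faces J \<equiv> Pow J - {{}}"
abbreviation pfaces :: "nat set \<Rightarrow> nat set set" where "pfaces J \<equiv> Pow J - {{}, J}"

lemma asc_I:
  assumes "finite K" "\<And>S. S \<in> K \<Longrightarrow> finite S" "\<And>S. S \<in> K \<Longrightarrow> S \<noteq> {}"
    "\<And>S T. S \<in> K \<Longrightarrow> T \<subseteq> S \<Longrightarrow> T \<noteq> {} \<Longrightarrow> T \<in> K"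
  shows "asc K"
  unfolding asc_def using assms by blast

lemma asc_Un: "asc A \<Longrightarrow> asc B \<Longrightarrow> asc (A \<union> B)"
  by (rule asc_I) (auto dest: asc_finite asc_simplex intro: asc_mono)

lemma asc_Int: "asc A \<Longrightarrow> asc B \<Longrightarrow> asc (A \<inter> B)"
  by (rule asc_I) (auto dest: asc_finite asc_simplex intro: asc_mono)

lemma asc_faces: "finite J \<Longrightarrow> asc (faces J)"
  by (rule asc_I) (auto intro: finite_subset)

lemma asc_pfaces: "finite J \<Longrightarrow> asc (pfaces J)"
  by (rule asc_I) (auto intro: finite_subset)

lemma Union_bl: "\<Union>(bl K Q) \<subseteq> \<Union>K \<times> \<Union>Q"
proof
  fix p assume "p \<in> \<Union>(bl K Q)"
  then obtain S where "p \<in> S" "fst ` S \<in> K" "snd ` S \<in> Q" unfolding bl_def by blast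
  then have "fst p \<in> \<Union>K" "snd p \<in> \<Union>Q" by blast+
  then show "p \<in> \<Union>K \<times> \<Union>Q" by (simp add: mem_Times_iff)
qed

lemma asc_bl:
  assumes "asc K" "asc Q"
  shows "asc (bl K Q)"
proof (rule asc_I)
  have "bl K Q \<subseteq> Pow (\<Union>K \<times> \<Union>Q)"
    using Union_bl by blast
  then show "finite (bl K Q)"
    using finite_vertices[OF assms(1)] finite_vertices[OF assms(2)]
    by (meson finite_Pow_iff finite_SigmaI finite_subset)
next
  fix S T assume "S \<in> bl K Q" "T \<subseteq> S" "T \<noteq> {}"
  moreover from this have "fst ` T \<in> K" "snd ` T \<in> Q"
    unfolding bl_def using asc_mono[OF assms(1), of "fst ` S" "fst ` T"] asc_mono[OF assms(2), of "snd ` S" "snd ` T"]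
    by auto
  ultimately show "T \<in> bl K Q" by (auto simp: bl_def intro: finite_subset)
qed (auto simp: bl_def)

lemma bl_mono: "K \<subseteq> K' \<Longrightarrow> Q \<subseteq> Q' \<Longrightarrow> bl K Q \<subseteq> bl K' Q'"
  by (auto simp: bl_def)

text \<open>Every new index set contains \<open>i\<close>, so some vertex \<open>(v, i)\<close> lies
  in the simplex. Toggling \<open>(v, j)\<close> above the same \<open>v\<close> leaves the first
  projection alone and changes the second at most by \<open>j\<close>. As \<open>i\<close> differs
  from \<open>j\<close>, the choice of \<open>v\<close> is unaffected by the toggle.\<close>

lemma cone_toggles:
  assumes "asc K" "asc L" "asc Q1" "asc Q2" "i \<noteq> j"
    and Q: "\<And>I. I \<in> Q2 - Q1 \<Longrightarrow> i \<in> I \<and> insert j I \<in> Q2 \<and> I - {j} \<notin> Q1"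
  shows "toggles (bl K Q1 \<union> bl L Q2) (bl K Q2) (UNIV \<times> {i}) (\<lambda>B. (fst (SOME p. p \<in> B), j))"
  unfolding toggles_def
proof
  fix S assume S: "S \<in> bl K Q2 - (bl K Q1 \<union> bl L Q2)"
  define v where "v = fst (SOME p. p \<in> S \<inter> (UNIV \<times> {i}))"
  have f: "finite S" "fst ` S \<in> K" "fst ` S \<notin> L" "snd ` S \<in> Q2 - Q1" "S \<noteq> {}"
    using S by (auto simp: bl_def)
  have "i \<in> snd ` S" using Q[OF f(4)] by simp
  then have "\<exists>p. p \<in> S \<inter> (UNIV \<times> {i})" by force
  then have "(SOME p. p \<in> S \<inter> (UNIV \<times> {i})) \<in> S \<inter> (UNIV \<times> {i})" by (rule someI_ex)
  then have vi: "(v, i) \<in> S" unfolding v_def by (metis IntE SigmaE2 prod.collapse singletonD)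
  have ins: "insert (v, j) S \<in> bl K Q2"
  proof -
    have "fst ` insert (v, j) S = fst ` S" using vi by force
    then show ?thesis using f Q[OF f(4)] by (simp add: bl_def)
  qed
  have del: "S - {(v, j)} \<in> bl K Q2 - (bl K Q1 \<union> bl L Q2)"
  proof -
    have vi': "(v, i) \<in> S - {(v, j)}" using vi \<open>i \<noteq> j\<close> by auto
    have 1: "fst ` (S - {(v, j)}) = fst ` S"
    proof (intro equalityI subsetI)
      fix x assume "x \<in> fst ` S"
      then obtain p where p: "p \<in> S" "x = fst p" by blast
      show "x \<in> fst ` (S - {(v, j)})"
      proof (cases "p = (v, j)")
        case True
        then show ?thesis using p vi' by (intro image_eqI[of _ _ "(v, i)"]) auto
      qed (use p in auto)
    qed auto
    have "snd ` S \<subseteq> insert j (snd ` (S - {(v, j)}))"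
    proof
      fix x assume "x \<in> snd ` S"
      then obtain p where p: "p \<in> S" "x = snd p" by blast
      then show "x \<in> insert j (snd ` (S - {(v, j)}))" by (cases "p = (v, j)") auto
    qed
    moreover have "snd ` (S - {(v, j)}) \<subseteq> snd ` S" by blast
    \<comment> \<open>Other vertices may also lie over \<open>j\<close>, so removing
      \<open>(v, j)\<close> need not remove \<open>j\<close> from the projection; both outcomes
      occur.\<close>
    ultimately have "snd ` (S - {(v, j)}) = snd ` S \<or> snd ` (S - {(v, j)}) = snd ` S - {j}"
      by blast
    then have 2: "snd ` (S - {(v, j)}) \<in> Q2 - Q1"
    proof
      assume a: "snd ` (S - {(v, j)}) = snd ` S - {j}"
      have "i \<in> snd ` S - {j}" using vi \<open>i \<noteq> j\<close> by force
      then have "snd ` S - {j} \<in> Q2"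
        by (intro asc_mono[OF assms(4) DiffD1[OF f(4)] Diff_subset]) (metis empty_iff)
      then show ?thesis using Q[OF f(4)] a by simp
    qed (use f in auto)
    show ?thesis using 1 2 f vi' unfolding bl_def by force
  qed
  show "(fst (SOME p. p \<in> S \<inter> UNIV \<times> {i}), j) \<notin> UNIV \<times> {i} \<and>
      insert (fst (SOME p. p \<in> S \<inter> UNIV \<times> {i}), j) S \<in> bl K Q2 \<and>
      S - {(fst (SOME p. p \<in> S \<inter> UNIV \<times> {i}), j)} \<in> bl K Q2 - (bl K Q1 \<union> bl L Q2)"
    using ins del \<open>i \<noteq> j\<close> unfolding v_def by simp
qed

context finite_crossed_module
begin

lemma exts_self: "c \<in> col r K \<Longrightarrow> exts r K K c = {c}"
  using rst_self by (auto simp: exts_def)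

text \<open>Matched pairs are removed one at a time, starting from a pair whose lower simplex has
  only its partner above it. Each removal is an elementary expansion read backwards, and the counts
  multiply along the tower.\<close>

theorem toggle_exts:
  assumes "asc K" "asc L" "L \<subseteq> K" "inj_on r (\<Union>K)" "toggles L K W q" "c \<in> col r L"
  shows "real (card (exts r L K c)) = wt (K - L)"
  using assms
proof (induction "card (K - L)" arbitrary: K rule: less_induct)
  case less
  note K = \<open>asc K\<close> and L = \<open>asc L\<close>
  have tog: "q (S \<inter> W) \<notin> W" "insert (q (S \<inter> W)) S \<in> K" "S - {q (S \<inter> W)} \<in> K - L"
    if "S \<in> K - L" for S
    using less.prems(5) that by (auto simp: toggles_def)
  show ?case
  proof (cases "K = L")
    case True
    then show ?thesis using exts_self[OF less.prems(6)] by (simp add: wt_def)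
  next
    case False
    \<comment> \<open>One representative of each matched pair: the simplex without its toggled
      vertex.\<close>
    define D where "D = {S \<in> K - L. q (S \<inter> W) \<notin> S}"
    define B where "B = card (\<Union>K)"
    \<comment> \<open>The lexicographic order by \<open>card (S \<inter> W)\<close> and then
      \<open>card S\<close> in a single number; \<open>Suc B\<close> is large enough as a base
      because no simplex has more than \<open>B\<close> vertices.\<close>
    define m where "m S = card (S \<inter> W) * Suc B + card S" for S
    have finK: "finite K" and finU: "finite (\<Union>K)" using K asc_finite finite_vertices by auto
    have low: "U - {q (U \<inter> W)} \<in> D" "(U - {q (U \<inter> W)}) \<inter> W = U \<inter> W" if "U \<in> K - L" for U
    proof -
      show *: "(U - {q (U \<inter> W)}) \<inter> W = U \<inter> W" using tog(1)[OF that] by auto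
      show "U - {q (U \<inter> W)} \<in> D" unfolding D_def using tog(3)[OF that] * by auto
    qed
    have "D \<noteq> {}" using False less.prems(3) low by blast
    moreover have "finite D" unfolding D_def using finK by auto
    ultimately have "Max (m ` D) \<in> m ` D" by simp
    then obtain S where S: "S \<in> D" and mS: "m S = Max (m ` D)" by auto
    have max: "m U \<le> m S" if "U \<in> D" for U
      using that \<open>finite D\<close> mS by simp
    define p where "p = q (S \<inter> W)"
    define T where "T = insert p S"
    have SK: "S \<in> K" "S \<notin> L" "p \<notin> S" using S by (auto simp: D_def p_def)
    have pW: "p \<notin> W" using tog(1)[of S] SK p_def by auto
    have TK: "T \<in> K" using tog(2)[of S] SK T_def p_def by auto
    have TW: "T \<inter> W = S \<inter> W" using pW by (auto simp: T_def)
    have Sfin: "finite S" "S \<noteq> {}" using asc_simplex[OF K SK(1)] by auto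
    have TL: "T \<notin> L" using asc_mono[OF L, of T S] SK Sfin by (auto simp: T_def)
    have cardle: "card U \<le> B" if "U \<in> K" for U
      unfolding B_def using that finU by (intro card_mono) auto
    \<comment> \<open>A further simplex above \<open>S\<close> would have a lower partner that is
      larger in this order: either it has more vertices in \<open>W\<close>, or the same ones in
      \<open>W\<close> and more in total.\<close>
    have top: "U \<in> {S, T}" if U: "U \<in> K" and SU: "S \<subseteq> U" for U
    proof (rule ccontr)
      assume nU: "U \<notin> {S, T}"
      have "U \<notin> L" using asc_mono[OF L _ SU] SK Sfin by auto
      then have UKL: "U \<in> K - L" using U by simp
      let ?U = "U - {q (U \<inter> W)}"
      have fU: "finite U" using asc_simplex[OF K U] by simp
      have le: "m ?U \<le> m S" using max low(1)[OF UKL] by simp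
      show False
      proof (cases "U \<inter> W = S \<inter> W")
        case True
        then have "?U = U - {p}" by (simp add: p_def)
        moreover have "S \<subset> U - {p}" using SU SK nU by (auto simp: T_def)
        ultimately have "card S < card ?U" using fU by (simp add: psubset_card_mono)
        then show False using le low(2)[OF UKL] True by (simp add: m_def)
      next
        case False
        then have "S \<inter> W \<subset> U \<inter> W" using SU by auto
        then have "card (S \<inter> W) < card (U \<inter> W)" using fU by (simp add: psubset_card_mono)
        then have "Suc (card (S \<inter> W)) * Suc B \<le> card (U \<inter> W) * Suc B"
          by (intro mult_le_mono1) simp
        then have "m S < card (U \<inter> W) * Suc B"
          using cardle[OF SK(1)] by (simp add: m_def)
        then show False using le low(2)[OF UKL] by (simp add: m_def)
      qed
    qed
    define K' where "K' = K - {S, T}"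
    have K'1: "asc K'"
    proof (rule asc_I)
      fix U V assume U: "U \<in> K'" "V \<subseteq> U" "V \<noteq> {}"
      then have "V \<in> K" using asc_mono[OF K] by (auto simp: K'_def)
      moreover have "V \<notin> {S, T}"
      proof
        assume "V \<in> {S, T}"
        then have "S \<subseteq> U" using U by (auto simp: T_def)
        then show False using top[of U] U by (auto simp: K'_def)
      qed
      ultimately show "V \<in> K'" by (simp add: K'_def)
    qed (use asc_simplex[OF K] finK in \<open>auto simp: K'_def\<close>)
    have LK': "L \<subseteq> K'" using less.prems(3) SK TL by (auto simp: K'_def)
    have split: "K - L = (K' - L) \<union> {S, T}" "(K' - L) \<inter> {S, T} = {}"
      using SK TK TL by (auto simp: K'_def)
    \<comment> \<open>Toggling does not change the part in \<open>W\<close>, hence not the toggled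
      vertex, so the partner of a remaining simplex is neither \<open>S\<close> nor
      \<open>T\<close>.\<close>
    have tog': "toggles L K' W q"
      unfolding toggles_def
    proof
      fix U assume "U \<in> K' - L"
      then have U: "U \<in> K - L" "U \<noteq> S" "U \<noteq> T" by (auto simp: K'_def)
      let ?q = "q (U \<inter> W)"
      note t = tog[OF U(1)]
      have p': "?q = p" if "U \<inter> W = S \<inter> W" using that p_def by simp
      have "insert ?q U \<notin> {S, T}"
      proof
        assume a: "insert ?q U \<in> {S, T}"
        have "insert ?q U \<inter> W = U \<inter> W" using t(1) by blast
        then have "U \<inter> W = S \<inter> W" using a TW by (elim insertE emptyE) simp_all
        then have q: "?q = p" by (rule p')
        then have "insert p U = T" using a SK(3) by blast
        then show False using U(2,3) SK(3) unfolding T_def by (metis Diff_insert_absorb insert_absorb)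
      qed
      moreover have "U - {?q} \<notin> {S, T}"
      proof
        assume a: "U - {?q} \<in> {S, T}"
        have "(U - {?q}) \<inter> W = U \<inter> W" using t(1) by blast
        then have "U \<inter> W = S \<inter> W" using a TW by (elim insertE emptyE) simp_all
        then have q: "?q = p" by (rule p')
        then have "U - {p} = S" using a T_def by blast
        then show False using U(2,3) unfolding T_def by blast
      qed
      ultimately show "?q \<notin> W \<and> insert ?q U \<in> K' \<and> U - {?q} \<in> K' - L"
        using t by (auto simp: K'_def)
    qed
    have "card (K' - L) < card (K - L)"
    proof (rule psubset_card_mono)
      show "finite (K - L)" using finK by simp
      show "K' - L \<subset> K - L" using split SK by blast
    qed
    moreover have inj': "inj_on r (\<Union>K')"
      using less.prems(4) by (rule inj_on_subset) (auto simp: K'_def)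
    ultimately have IH: "real (card (exts r L K' c)) = wt (K' - L)"
      using less.hyps[OF _ K'1 L LK' _ tog' less.prems(6)] by simp
    have "inj_on r T" using less.prems(4) by (rule inj_on_subset) (use TK in auto)
    then have el: "real (card (exts r K' K c')) = wt {S, T}" if "c' \<in> col r K'" for c'
      using elementary_expansion[OF K K'1 K'_def TK T_def SK(3) Sfin(2) _ that] by simp
    have "real (card (exts r L K c)) = (\<Sum>c'\<in>exts r L K' c. real (card (exts r K' K c')))"
      using exts_tower[OF K'1 K LK', of r c] by (simp add: K'_def)
    also have "\<dots> = (\<Sum>c'\<in>exts r L K' c. wt {S, T})"
    proof (rule sum.cong)
      show "real (card (exts r K' K c')) = wt {S, T}" if "c' \<in> exts r L K' c" for c'
        using that by (intro el) (simp add: exts_def)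
    qed simp
    also have "\<dots> = wt (K' - L) * wt {S, T}" using IH by simp
    also have "\<dots> = wt (K - L)"
      unfolding split(1) using split(2) asc_finite[OF K'1] by (intro wt_Un[symmetric]) auto
    finally show ?thesis .
  qed
qed

section \<open>Existence of extensions, gluing and excision\<close>

definition extends :: "('v \<Rightarrow> nat) \<Rightarrow> 'v set set \<Rightarrow> 'v set set \<Rightarrow> bool" where
  "extends r L K \<longleftrightarrow> (\<forall>g h. flat r L g h \<longrightarrow> (\<exists>g' h'. flat r K g' h' \<and> agree L g h g' h'))"

lemma extends_iff_exts:
  assumes "asc L" "asc K" "L \<subseteq> K"
  shows "extends r L K \<longleftrightarrow> (\<forall>c\<in>col r L. exts r L K c \<noteq> {})"
proof safe
  fix g h assume e: "extends r L K" and c: "(g, h) \<in> col r L" "exts r L K (g, h) = {}"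
  then obtain g' h' where gh: "flat r K g' h'" "agree L g h g' h'"
    unfolding extends_def col_def by blast
  let ?c = "rst K (g', h')"
  have "?c \<in> col r K"
    using rst_flat[OF assms(2) gh(1)] by (simp add: col_def rst_def)
  moreover have "rst L ?c = rst L (g, h)"
    unfolding rst_rst[OF assms(3)] using gh(2) by (auto simp: rst_def agree_def fun_eq_iff)
  moreover have "rst L (g, h) = (g, h)" using rst_self[OF c(1)] .
  ultimately have "?c \<in> exts r L K (g, h)" unfolding exts_def by simp
  then show False using c(2) by simp
next
  assume e: "\<forall>c\<in>col r L. exts r L K c \<noteq> {}"
  show "extends r L K"
    unfolding extends_def
  proof (intro allI impI)
    fix g h assume "flat r L g h"
    then have "rst L (g, h) \<in> col r L"
      using rst_flat[OF assms(1)] by (simp add: col_def rst_def)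
    then obtain c' where c': "c' \<in> col r K" "rst L c' = rst L (g, h)"
      using e by (auto simp: exts_def)
    obtain g' h' where gh: "c' = (g', h')" by fastforce
    have "flat r K g' h'" using c' gh by (simp add: col_def)
    moreover have "agree L g h g' h'"
    proof -
      have "restrict g' (edges L) = restrict g (edges L)" "restrict h' (triangles L) = restrict h (triangles L)"
        using c'(2) gh by (auto simp: rst_def)
      then have eq: "restrict g' (edges L) S = restrict g (edges L) S"
          "restrict h' (triangles L) S = restrict h (triangles L) S" for S by auto
      show ?thesis
        unfolding agree_def
      proof (intro ballI conjI impI)
        show "g S = g' S" if "S \<in> L" "card S = 2" for S using eq(1)[of S] that by simp
        show "h S = h' S" if "S \<in> L" "card S = 3" for S using eq(2)[of S] that by simp
      qed
    qed
    ultimately show "\<exists>g' h'. flat r K g' h' \<and> agree L g h g' h'" by blast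
  qed
qed

lemma toggle_extends:
  assumes "asc K" "asc L" "L \<subseteq> K" "inj_on r (\<Union>K)" "toggles L K W q"
  shows "extends r L K"
proof -
  have "exts r L K c \<noteq> {}" if "c \<in> col r L" for c
    using toggle_exts[OF assms that] wt_pos[of "K - L"] by (intro notI) simp
  then show ?thesis using assms by (simp add: extends_iff_exts)
qed

lemma extends_trans:
  assumes "extends r L M" "extends r M K" "L \<subseteq> M"
  shows "extends r L K"
  unfolding extends_def
proof (intro allI impI)
  fix g h assume "flat r L g h"
  then obtain g' h' where 1: "flat r M g' h'" "agree L g h g' h'"
    using assms(1) unfolding extends_def by blast
  then obtain g'' h'' where "flat r K g'' h''" "agree M g' h' g'' h''"
    using assms(2) unfolding extends_def by blast
  with 1 assms(3) show "\<exists>g' h'. flat r K g' h' \<and> agree L g h g' h'"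
    by (intro exI[of _ g''] exI[of _ h'']) (auto simp: agree_def subset_iff)
qed

lemma extends_restrict: "extends r L K \<Longrightarrow> K' \<subseteq> K \<Longrightarrow> extends r L K'"
  unfolding extends_def by (meson flat_subset)

text \<open>The extension over \<open>K\<close> and the given colouring on \<open>P\<close> overlap
  only inside \<open>L\<close>, where they agree, so they glue. Every simplex of the union lies in
  \<open>K\<close> or in \<open>P\<close>, and flatness is checked there.\<close>

lemma extends_push:
  assumes "asc K" "asc P" "extends r L K" "K \<inter> P \<subseteq> L" "L \<subseteq> K"
  shows "extends r (L \<union> P) (K \<union> P)"
  unfolding extends_def
proof (intro allI impI)
  fix g h assume fl: "flat r (L \<union> P) g h"
  then have "flat r L g h" by (rule flat_subset) auto
  then obtain g' h' where 1: "flat r K g' h'" "agree L g h g' h'"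
    using assms(3) unfolding extends_def by blast
  define g'' where "g'' S = (if S \<in> K then g' S else g S)" for S
  define h'' where "h'' S = (if S \<in> K then h' S else h S)" for S
  have "agree K g' h' g'' h''" by (auto simp: agree_def g''_def h''_def)
  then have "flat r K g'' h''" using flat_cong[OF assms(1)] 1(1) by blast
  moreover have P: "agree P g h g'' h''"
    using 1(2) assms(4) by (auto simp: agree_def g''_def h''_def)
  then have "flat r P g'' h''"
    using flat_cong[OF assms(2)] flat_subset[OF fl, of P] by blast
  ultimately have "flat r (K \<union> P) g'' h''" by (auto simp: flat_def)
  moreover have "agree (L \<union> P) g h g'' h''"
    using P 1(2) assms(5) by (auto simp: agree_def g''_def h''_def)
  ultimately show "\<exists>g' h'. flat r (K \<union> P) g' h' \<and> agree (L \<union> P) g h g' h'" by blast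
qed

text \<open>Excision: to extend from \<open>A\<close> to the union is to extend over
  \<open>F\<close> what is already given on the overlap. Restriction to \<open>F\<close> is the
  bijection.\<close>

lemma exts_push:
  assumes "asc A" "asc F" "x \<in> col r A"
  shows "card (exts r A (A \<union> F) x) = card (exts r (A \<inter> F) F (rst (A \<inter> F) x))"
proof (rule bij_betw_same_card[of "rst F"])
  have sub: "A \<inter> F \<subseteq> A" "A \<inter> F \<subseteq> F" by auto
  show "bij_betw (rst F) (exts r A (A \<union> F) x) (exts r (A \<inter> F) F (rst (A \<inter> F) x))"
    unfolding bij_betw_def
  proof (intro conjI equalityI)
    show "inj_on (rst F) (exts r A (A \<union> F) x)"
    proof (rule inj_onI)
      fix y z assume y: "y \<in> exts r A (A \<union> F) x" and z: "z \<in> exts r A (A \<union> F) x"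
        and eq: "rst F y = rst F z"
      obtain gy hy gz hz where gh: "y = (gy, hy)" "z = (gz, hz)" by fastforce
      have A: "restrict gy (edges A) = restrict gz (edges A)" "restrict hy (triangles A) = restrict hz (triangles A)"
        using y z by (auto simp: exts_def gh rst_def)
      have F: "restrict gy (edges F) = restrict gz (edges F)" "restrict hy (triangles F) = restrict hz (triangles F)"
        using eq by (auto simp: gh rst_def)
      have "gy = gz"
      proof (rule extensionalityI[of _ "edges (A \<union> F)"])
        fix S assume "S \<in> edges (A \<union> F)"
        then show "gy S = gz S"
          using fun_cong[OF A(1), of S] fun_cong[OF F(1), of S] by auto
      qed (use y z in \<open>auto simp: exts_def gh col_def\<close>)
      moreover have "hy = hz"
      proof (rule extensionalityI[of _ "triangles (A \<union> F)"])
        fix S assume "S \<in> triangles (A \<union> F)"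
        then show "hy S = hz S"
          using fun_cong[OF A(2), of S] fun_cong[OF F(2), of S] by auto
      qed (use y z in \<open>auto simp: exts_def gh col_def\<close>)
      ultimately show "y = z" by (simp add: gh)
    qed
    show "rst F ` exts r A (A \<union> F) x \<subseteq> exts r (A \<inter> F) F (rst (A \<inter> F) x)"
    proof
      fix z assume "z \<in> rst F ` exts r A (A \<union> F) x"
      then obtain y where y: "y \<in> col r (A \<union> F)" "rst A y = x" "z = rst F y"
        by (auto simp: exts_def)
      have "z \<in> col r F" using rst_col[OF assms(2) _ y(1)] y(3) by simp
      moreover have "rst (A \<inter> F) z = rst (A \<inter> F) x"
        using rst_rst[OF sub(1), of y] rst_rst[OF sub(2), of y] y by simp
      ultimately show "z \<in> exts r (A \<inter> F) F (rst (A \<inter> F) x)" by (simp add: exts_def)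
    qed
    show "exts r (A \<inter> F) F (rst (A \<inter> F) x) \<subseteq> rst F ` exts r A (A \<union> F) x"
    proof
      fix z assume z: "z \<in> exts r (A \<inter> F) F (rst (A \<inter> F) x)"
      obtain gz hz gx hx where gh: "z = (gz, hz)" "x = (gx, hx)" by fastforce
      have AF: "restrict gz (edges (A \<inter> F)) = restrict gx (edges (A \<inter> F))"
          "restrict hz (triangles (A \<inter> F)) = restrict hx (triangles (A \<inter> F))"
        using z by (auto simp: exts_def gh rst_def)
      define g where "g S = (if S \<in> F then gz S else gx S)" for S
      define h where "h S = (if S \<in> F then hz S else hx S)" for S
      have aF: "agree F gz hz g h" by (auto simp: agree_def g_def h_def)
      have aA: "agree A gx hx g h"
        unfolding agree_def
      proof (intro ballI conjI impI)
        show "gx S = g S" if "S \<in> A" "card S = 2" for S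
          using fun_cong[OF AF(1), of S] that by (auto simp: g_def)
        show "hx S = h S" if "S \<in> A" "card S = 3" for S
          using fun_cong[OF AF(2), of S] that by (auto simp: h_def)
      qed
      have "flat r F g h" using flat_cong[OF assms(2) aF] z by (simp add: exts_def gh col_def)
      moreover have "flat r A g h" using flat_cong[OF assms(1) aA] assms(3) by (simp add: gh col_def)
      ultimately have "flat r (A \<union> F) g h" by (auto simp: flat_def)
      then have y: "rst (A \<union> F) (g, h) \<in> col r (A \<union> F)"
        using rst_flat[OF asc_Un[OF assms(1,2)]] by (simp add: col_def rst_def)
      have "rst A (g, h) = rst A x"
        using aA by (auto simp: rst_def gh agree_def fun_eq_iff)
      then have 1: "rst A (rst (A \<union> F) (g, h)) = x"
        using rst_rst[of A "A \<union> F" "(g, h)"] rst_self[OF assms(3)] by simp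
      have "rst F (g, h) = rst F z"
        using aF by (auto simp: rst_def gh agree_def fun_eq_iff)
      then have 2: "rst F (rst (A \<union> F) (g, h)) = z"
        using rst_rst[of F "A \<union> F" "(g, h)"] rst_self[of z r F] z by (simp add: exts_def)
      show "z \<in> rst F ` exts r A (A \<union> F) x"
        using y 1 2 by (intro image_eqI[of _ _ "rst (A \<union> F) (g, h)"]) (auto simp: exts_def)
    qed
  qed
qed

end

section \<open>Blow-ups and the extension property\<close>

text \<open>Unions, intersections and differences of blow-ups turn into propositional combinations
  of conditions on the two projections, so that inclusions among them can be verified
  pointwise.\<close>

definition blp :: "('v set \<Rightarrow> nat set \<Rightarrow> bool) \<Rightarrow> ('v \<times> nat) set set" where
  "blp P = {S. finite S \<and> S \<noteq> {} \<and> P (fst ` S) (snd ` S)}"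

lemma bl_blp: "bl K Q = blp (\<lambda>\<sigma> I. \<sigma> \<in> K \<and> I \<in> Q)"
  by (simp add: bl_def blp_def)

lemma blp_Un: "blp P \<union> blp Q = blp (\<lambda>\<sigma> I. P \<sigma> I \<or> Q \<sigma> I)"
  by (auto simp: blp_def)

lemma blp_Int: "blp P \<inter> blp Q = blp (\<lambda>\<sigma> I. P \<sigma> I \<and> Q \<sigma> I)"
  by (auto simp: blp_def)

lemma blp_Diff: "blp P - blp Q = blp (\<lambda>\<sigma> I. P \<sigma> I \<and> \<not> Q \<sigma> I)"
  by (auto simp: blp_def)

lemma blp_mono: "(\<And>\<sigma> I. I \<noteq> {} \<Longrightarrow> P \<sigma> I \<Longrightarrow> Q \<sigma> I) \<Longrightarrow> blp P \<subseteq> blp Q"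
  by (simp add: blp_def Collect_mono_iff)

lemma blp_eq: "(\<And>\<sigma> I. I \<noteq> {} \<Longrightarrow> P \<sigma> I \<longleftrightarrow> Q \<sigma> I) \<Longrightarrow> blp P = blp Q"
  by (intro equalityI blp_mono) auto

lemmas blps = bl_blp blp_Un blp_Int blp_Diff

lemma asc_empty: "asc {}"
  by (simp add: asc_def)

lemma bl_empty [simp]: "bl {} Q = {}" "bl K {} = {}"
  by (auto simp: bl_def)

context finite_crossed_module
begin

lemma cone_exts:
  assumes "asc K" "asc L" "L \<subseteq> K" "asc Q1" "asc Q2" "Q1 \<subseteq> Q2" "i \<noteq> j"
    and "\<And>I. I \<in> Q2 - Q1 \<Longrightarrow> i \<in> I \<and> insert j I \<in> Q2 \<and> I - {j} \<notin> Q1"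
    and "inj_on s (\<Union>K \<times> UNIV)"
    and "c \<in> col s (bl K Q1 \<union> bl L Q2)"
  shows "real (card (exts s (bl K Q1 \<union> bl L Q2) (bl K Q2) c)) = wt (bl K Q2 - (bl K Q1 \<union> bl L Q2))"
proof (rule toggle_exts)
  show "toggles (bl K Q1 \<union> bl L Q2) (bl K Q2) (UNIV \<times> {i}) (\<lambda>B. (fst (SOME p. p \<in> B), j))"
    using assms by (intro cone_toggles) auto
  show "inj_on s (\<Union> (bl K Q2))"
    using assms(9) by (rule inj_on_subset) (use Union_bl[of K Q2] in auto)
  show "bl K Q1 \<union> bl L Q2 \<subseteq> bl K Q2"
    using assms by (simp add: bl_mono)
qed (use assms in \<open>auto intro!: asc_bl asc_Un\<close>)

lemma cone_extends:
  assumes "asc K" "asc L" "L \<subseteq> K" "asc Q1" "asc Q2" "Q1 \<subseteq> Q2" "i \<noteq> j"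
    and "\<And>I. I \<in> Q2 - Q1 \<Longrightarrow> i \<in> I \<and> insert j I \<in> Q2 \<and> I - {j} \<notin> Q1"
    and "inj_on s (\<Union>K \<times> UNIV)"
  shows "extends s (bl K Q1 \<union> bl L Q2) (bl K Q2)"
proof (rule toggle_extends)
  show "toggles (bl K Q1 \<union> bl L Q2) (bl K Q2) (UNIV \<times> {i}) (\<lambda>B. (fst (SOME p. p \<in> B), j))"
    using assms by (intro cone_toggles) auto
  show "inj_on s (\<Union> (bl K Q2))"
    using assms(9) by (rule inj_on_subset) (use Union_bl[of K Q2] in auto)
  show "bl K Q1 \<union> bl L Q2 \<subseteq> bl K Q2"
    using assms by (simp add: bl_mono)
qed (use assms in \<open>auto intro!: asc_bl asc_Un\<close>)

lemma extends_push':
  assumes "asc K" "asc P" "extends r L K" "K \<inter> P \<subseteq> L" "L \<subseteq> P" "L \<subseteq> K"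
  shows "extends r P (K \<union> P)"
  using extends_push[OF assms(1-4,6)] assms(5) by (simp add: Un_absorb1)

text \<open>\<open>EP s L K\<close>: restricting flat colourings from \<open>K\<close> to \<open>L\<close> is a trivial fibration. The blow-up
  of \<open>K\<close> over the simplex on \<open>J\<close> plays the role of the product of \<open>K\<close> with that simplex.\<close>

definition EP :: "('v \<times> nat \<Rightarrow> nat) \<Rightarrow> 'v set set \<Rightarrow> 'v set set \<Rightarrow> bool" where
  "EP s L K \<longleftrightarrow> (\<forall>J. finite J \<longrightarrow> J \<noteq> {} \<longrightarrow> extends s (bl K (pfaces J) \<union> bl L (faces J)) (bl K (faces J)))"

text \<open>The missing index simplices are added one at a time, smallest first. A minimal missing
  \<open>J\<close> has all its proper faces in \<open>Q'\<close>, so adding it is the defining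
  instance of \<open>EP\<close>, pushed out.\<close>

lemma EP_extends:
  assumes ep: "EP s L K" and "asc K" "asc L" "L \<subseteq> K" "asc Q" "asc Q'" "Q' \<subseteq> Q"
  shows "extends s (bl K Q' \<union> bl L Q) (bl K Q)"
  using assms(6,7)
proof (induction "card (Q - Q')" arbitrary: Q' rule: less_induct)
  case less
  have finQ: "finite Q" using asc_finite[OF \<open>asc Q\<close>] .
  show ?case
  proof (cases "Q' = Q")
    case True
    then have "bl K Q' \<union> bl L Q = bl K Q" using bl_mono[OF \<open>L \<subseteq> K\<close>, of Q Q] by auto
    then show ?thesis by (auto simp: extends_def agree_def)
  next
    case False
    have "finite (Q - Q')" "Q - Q' \<noteq> {}" using finQ False less.prems(2) by auto
    from finite_has_minimal[OF this] obtain J where J: "J \<in> Q - Q'"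
      and minJ: "\<And>I. I \<in> Q - Q' \<Longrightarrow> I \<subseteq> J \<Longrightarrow> J = I" by auto
    have fJ: "finite J" "J \<noteq> {}" using asc_simplex[OF \<open>asc Q\<close>] J by auto
    have sub: "I \<in> Q" if "I \<subseteq> J" "I \<noteq> {}" for I
      using asc_mono[OF \<open>asc Q\<close> _ that] J by simp
    have psub: "I \<in> Q'" if "I \<subseteq> J" "I \<noteq> {}" "I \<noteq> J" for I
      using sub[OF that(1,2)] minJ[of I] that by auto
    have ascQ'': "asc (insert J Q')"
    proof (rule asc_I)
      fix S T assume "S \<in> insert J Q'" "T \<subseteq> S" "T \<noteq> {}"
      then show "T \<in> insert J Q'"
        using psub asc_mono[OF \<open>asc Q'\<close>] by (cases "S = J"; cases "T = J") auto
    qed (use asc_finite asc_simplex less.prems(1) fJ in auto)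
    have e: "extends s (bl K (pfaces J) \<union> bl L (faces J)) (bl K (faces J))"
      using ep fJ by (auto simp: EP_def)
    have "extends s (bl K Q' \<union> bl L Q) (bl K (faces J) \<union> (bl K Q' \<union> bl L Q))"
    proof (rule extends_push'[OF _ _ e])
      show "bl K (faces J) \<inter> (bl K Q' \<union> bl L Q) \<subseteq> bl K (pfaces J) \<union> bl L (faces J)"
        unfolding blps by (rule blp_mono) (use J in auto)
      show "bl K (pfaces J) \<union> bl L (faces J) \<subseteq> bl K Q' \<union> bl L Q"
        unfolding blps by (rule blp_mono) (use sub psub in auto)
      show "bl K (pfaces J) \<union> bl L (faces J) \<subseteq> bl K (faces J)"
        unfolding blps by (rule blp_mono) (use \<open>L \<subseteq> K\<close> in auto)
    qed (use assms less.prems fJ in \<open>auto intro!: asc_bl asc_Un asc_faces\<close>)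
    then have 1: "extends s (bl K Q' \<union> bl L Q) (bl K (insert J Q') \<union> bl L Q)"
    proof (rule extends_restrict)
      show "bl K (insert J Q') \<union> bl L Q \<subseteq> bl K (faces J) \<union> (bl K Q' \<union> bl L Q)"
        unfolding blps by (rule blp_mono) auto
    qed
    have "card (Q - insert J Q') < card (Q - Q')"
      using finQ J by (intro psubset_card_mono) auto
    then have 2: "extends s (bl K (insert J Q') \<union> bl L Q) (bl K Q)"
      using less.hyps ascQ'' less.prems(2) J by auto
    show ?thesis
      by (rule extends_trans[OF 1 2]) (auto simp: bl_def)
  qed
qed

text \<open>Over \<open>J\<close>, fill first the part above \<open>M\<close>, glued to what is
  prescribed on \<open>K\<close> over the proper faces, and then the rest of
  \<open>K\<close>.\<close>

lemma EP_trans: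
  assumes "EP s L M" "EP s M K" "asc L" "asc M" "asc K" "L \<subseteq> M" "M \<subseteq> K"
  shows "EP s L K"
  unfolding EP_def
proof (intro allI impI)
  fix J :: "nat set" assume J: "finite J" "J \<noteq> {}"
  have e: "extends s (bl M (pfaces J) \<union> bl L (faces J)) (bl M (faces J))"
    using assms(1) J by (auto simp: EP_def)
  have "extends s (bl K (pfaces J) \<union> bl L (faces J)) (bl M (faces J) \<union> (bl K (pfaces J) \<union> bl L (faces J)))"
  proof (rule extends_push'[OF _ _ e])
    show "bl M (faces J) \<inter> (bl K (pfaces J) \<union> bl L (faces J)) \<subseteq> bl M (pfaces J) \<union> bl L (faces J)"
      unfolding blps by (rule blp_mono) auto
    show "bl M (pfaces J) \<union> bl L (faces J) \<subseteq> bl K (pfaces J) \<union> bl L (faces J)"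
      unfolding blps by (rule blp_mono) (use assms in auto)
    show "bl M (pfaces J) \<union> bl L (faces J) \<subseteq> bl M (faces J)"
      unfolding blps by (rule blp_mono) (use assms in auto)
  qed (use assms J in \<open>auto intro!: asc_bl asc_Un asc_faces asc_pfaces\<close>)
  then have 1: "extends s (bl K (pfaces J) \<union> bl L (faces J)) (bl K (pfaces J) \<union> bl M (faces J))"
    by (rule extends_restrict) auto
  have 2: "extends s (bl K (pfaces J) \<union> bl M (faces J)) (bl K (faces J))"
    using assms(2) J by (auto simp: EP_def)
  show "extends s (bl K (pfaces J) \<union> bl L (faces J)) (bl K (faces J))"
    using extends_trans[OF 1 2] bl_mono[OF assms(6), of "faces J" "faces J"] by auto
qed

text \<open>Over the proper faces of \<open>J\<close> a colouring of \<open>W1\<close> extends to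
  \<open>W3\<close>, hence to \<open>W2\<close>. Together with the data on \<open>W0\<close> over
  \<open>J\<close> it extends to \<open>W2\<close> over \<open>J\<close>, and restricting this to
  \<open>W1\<close> finishes. Extensions are thus found in a larger complex and cut down.\<close>

lemma EP_2of6:
  assumes "EP s W0 W2" "EP s W1 W3" and asc: "asc W0" "asc W1" "asc W2" "asc W3"
    and sub: "W0 \<subseteq> W1" "W1 \<subseteq> W2" "W2 \<subseteq> W3"
  shows "EP s W0 W1"
  unfolding EP_def
proof (intro allI impI)
  fix J :: "nat set" assume J: "finite J" "J \<noteq> {}"
  let ?P = "bl W1 (pfaces J) \<union> bl W0 (faces J)"
  have "extends s (bl W3 {} \<union> bl W1 (pfaces J)) (bl W3 (pfaces J))"
    using assms J by (intro EP_extends asc_pfaces asc_empty) auto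
  then have e: "extends s (bl W1 (pfaces J)) (bl W3 (pfaces J))" by simp
  have "extends s ?P (bl W3 (pfaces J) \<union> ?P)"
  proof (rule extends_push'[OF _ _ e])
    show "bl W3 (pfaces J) \<inter> ?P \<subseteq> bl W1 (pfaces J)"
      unfolding blps by (rule blp_mono) (use sub in auto)
    show "bl W1 (pfaces J) \<subseteq> bl W3 (pfaces J)" using sub by (intro bl_mono) auto
  qed (use asc J in \<open>auto intro!: asc_bl asc_Un asc_faces asc_pfaces\<close>)
  then have 1: "extends s ?P (bl W2 (pfaces J) \<union> bl W0 (faces J))"
    by (rule extends_restrict) (use sub in \<open>auto simp: bl_def\<close>)
  have 2: "extends s (bl W2 (pfaces J) \<union> bl W0 (faces J)) (bl W2 (faces J))"
    using assms(1) J by (auto simp: EP_def)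
  have "extends s ?P (bl W2 (faces J))"
    by (rule extends_trans[OF 1 2]) (use sub in \<open>auto simp: bl_def\<close>)
  then show "extends s ?P (bl W1 (faces J))"
    by (rule extends_restrict) (use sub in \<open>auto simp: bl_def\<close>)
qed

text \<open>A colouring prescribed on \<open>B\<close> over \<open>J\<close> is deformed along a new index \<open>x\<close> into one that is
  known to extend to \<open>D\<close>; filling the remaining horn carries the extension back to \<open>J\<close>.\<close>

lemma EP_right_cancel:
  assumes epB: "EP s A B" and epD: "EP s A D" and asc: "asc A" "asc B" "asc D"
    and sub: "A \<subseteq> B" "B \<subseteq> D" and inj: "inj_on s (\<Union>D \<times> UNIV)"
  shows "EP s B D"
  unfolding EP_def
proof (intro allI impI)
  fix J :: "nat set" assume J: "finite J" "J \<noteq> {}"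
  obtain j where j: "j \<in> J" using J by auto
  obtain x where x: "x \<notin> J" using J(1) ex_new_if_finite infinite_UNIV_nat by blast
  have xj: "x \<noteq> j" using x j by auto
  \<comment> \<open>\<open>J'\<close> is the join of \<open>J\<close> with the new index; in
    \<open>J''\<close> the new index has taken the place of \<open>j\<close>.\<close>
  define J' where "J' = insert x J"
  define J'' where "J'' = insert x (J - {j})"
  have fin: "finite J'" "finite J''" and ne: "J' \<noteq> {}" "J'' \<noteq> {}" using J by (auto simp: J'_def J''_def)
  \<comment> \<open>The faces missing some index of \<open>J\<close> other than \<open>j\<close>.
    The condition ignores \<open>j\<close> and \<open>x\<close>, so toggling \<open>j\<close> stays
    inside \<open>Q\<close>.\<close>
  define Q where "Q = {I \<in> faces J'. \<not> J - {j} \<subseteq> I}"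
  have ascQ: "asc Q"
    by (rule asc_I) (auto simp: Q_def intro: finite_subset[OF _ fin(1)] finite_subset[OF _ finite_Pow_iff[THEN iffD2, OF fin(1)]])
  have injA: "inj_on s (\<Union>A \<times> UNIV)"
    using inj by (rule inj_on_subset) (use sub in auto)
  let ?X0 = "bl D (pfaces J) \<union> bl B (faces J)"
  let ?X1 = "bl D Q \<union> ?X0"
  let ?X2 = "bl A (faces J') \<union> ?X1"
  let ?X3 = "bl D (faces J'') \<union> ?X2"
  let ?X4 = "bl B (faces J') \<union> ?X3"
  note ascs = asc_bl asc_Un asc_faces asc_pfaces
  have asc0: "asc ?X0" using asc J by (auto intro!: ascs)
  have asc1: "asc ?X1" using asc0 asc ascQ by (auto intro!: ascs)
  have asc2: "asc ?X2" using asc1 asc fin by (auto intro!: ascs)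
  have asc3: "asc ?X3" using asc2 asc fin by (auto intro!: ascs)
  \<comment> \<open>The deformation begins where \<open>D\<close> is prescribed: the colouring over
    faces of \<open>J\<close> in \<open>Q\<close> is continued to those faces that contain
    \<open>x\<close>.\<close>
  have "extends s (bl D (Q \<inter> faces J) \<union> bl {} Q) (bl D Q)"
  proof (rule cone_extends[of D "{}" _ _ x j])
    fix I assume "I \<in> Q - Q \<inter> faces J"
    then show "x \<in> I \<and> insert j I \<in> Q \<and> I - {j} \<notin> Q \<inter> faces J"
      using j xj by (auto simp: Q_def J'_def)
  qed (use asc ascQ inj J xj in \<open>auto intro!: asc_Int asc_faces asc_empty\<close>)
  then have c1: "extends s (bl D (Q \<inter> faces J)) (bl D Q)" by simp
  have 1: "extends s ?X0 ?X1"
  proof (rule extends_push'[OF _ asc0 c1])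
    show "bl D Q \<inter> ?X0 \<subseteq> bl D (Q \<inter> faces J)"
      unfolding blps by (rule blp_mono) auto
    show "bl D (Q \<inter> faces J) \<subseteq> ?X0"
      unfolding blps by (rule blp_mono) (auto simp: Q_def)
    show "bl D (Q \<inter> faces J) \<subseteq> bl D Q" by (rule bl_mono) auto
  qed (use asc ascQ in \<open>auto intro!: ascs\<close>)
  have "extends s (bl A (Q \<union> faces J) \<union> bl {} (faces J')) (bl A (faces J'))"
  proof (rule cone_extends[of A "{}" _ _ x j])
    fix I assume "I \<in> faces J' - (Q \<union> faces J)"
    then show "x \<in> I \<and> insert j I \<in> faces J' \<and> I - {j} \<notin> Q \<union> faces J"
      using j xj by (auto simp: Q_def J'_def)
  next
    show "Q \<union> faces J \<subseteq> faces J'" by (auto simp: Q_def J'_def)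
  qed (use asc ascQ injA J xj fin in \<open>auto intro!: asc_Un asc_faces asc_empty\<close>)
  then have c2: "extends s (bl A (Q \<union> faces J)) (bl A (faces J'))" by simp
  have 2: "extends s ?X1 ?X2"
  proof (rule extends_push'[OF _ asc1 c2])
    show "bl A (faces J') \<inter> ?X1 \<subseteq> bl A (Q \<union> faces J)"
      unfolding blps by (rule blp_mono) auto
    show "bl A (Q \<union> faces J) \<subseteq> ?X1"
      unfolding blps by (rule blp_mono) (use sub in auto)
    show "bl A (Q \<union> faces J) \<subseteq> bl A (faces J')" by (rule bl_mono) (auto simp: Q_def J'_def)
  qed (use asc fin in \<open>auto intro!: ascs\<close>)
  \<comment> \<open>Every proper face of \<open>J''\<close> lies in \<open>Q\<close> or among the
    proper faces of \<open>J\<close>, and \<open>A\<close> is coloured over all of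
    \<open>J'\<close>, so the hypothesis on \<open>A\<close> and \<open>D\<close> applies to
    \<open>J''\<close>.\<close>
  have c3: "extends s (bl D (pfaces J'') \<union> bl A (faces J'')) (bl D (faces J''))"
    using epD fin ne by (auto simp: EP_def)
  have 3: "extends s ?X2 ?X3"
  proof (rule extends_push'[OF _ asc2 c3])
    show "bl D (faces J'') \<inter> ?X2 \<subseteq> bl D (pfaces J'') \<union> bl A (faces J'')"
      unfolding blps by (rule blp_mono) (use x in \<open>auto simp: Q_def J''_def\<close>)
    have "I \<in> Q \<or> I \<in> pfaces J" if I: "I \<in> pfaces J''" for I
    proof (cases "x \<in> I")
      case True
      then have "\<not> J - {j} \<subseteq> I" using I by (auto simp: J''_def)
      then show ?thesis using I by (auto simp: Q_def J''_def J'_def)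
    next
      case False
      then show ?thesis using I j by (auto simp: J''_def)
    qed
    moreover have "I \<in> faces J'" if "I \<in> faces J''" for I using that by (auto simp: J''_def J'_def)
    ultimately show "bl D (pfaces J'') \<union> bl A (faces J'') \<subseteq> ?X2"
      unfolding blps by (intro blp_mono) blast
    show "bl D (pfaces J'') \<union> bl A (faces J'') \<subseteq> bl D (faces J'')"
      unfolding blps by (rule blp_mono) (use sub in auto)
  qed (use asc fin in \<open>auto intro!: ascs\<close>)
  \<comment> \<open>The proper faces of \<open>J'\<close> are covered by \<open>Q\<close>, the faces
    of \<open>J\<close> and those of \<open>J''\<close>, so \<open>B\<close> can now be filled over
    \<open>J'\<close>.\<close>
  have c4: "extends s (bl B (pfaces J') \<union> bl A (faces J')) (bl B (faces J'))"
    using epB fin ne by (auto simp: EP_def)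
  have 4: "extends s ?X3 ?X4"
  proof (rule extends_push'[OF _ asc3 c4])
    show "bl B (faces J') \<inter> ?X3 \<subseteq> bl B (pfaces J') \<union> bl A (faces J')"
      unfolding blps by (rule blp_mono) (use x xj j in \<open>auto simp: Q_def J''_def J'_def\<close>)
    have "I \<in> Q \<or> I \<in> faces J \<or> I \<in> faces J''" if I: "I \<in> pfaces J'" for I
    proof (cases "J - {j} \<subseteq> I")
      case True
      then have "x \<notin> I \<or> j \<notin> I" using I by (auto simp: J'_def)
      then show ?thesis using I by (auto simp: J''_def J'_def)
    next
      case False
      then show ?thesis using I by (auto simp: Q_def)
    qed
    then show "bl B (pfaces J') \<union> bl A (faces J') \<subseteq> ?X3"
      unfolding blps using sub by (intro blp_mono) blast
    show "bl B (pfaces J') \<union> bl A (faces J') \<subseteq> bl B (faces J')"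
      unfolding blps by (rule blp_mono) (use sub in auto)
  qed (use asc fin in \<open>auto intro!: ascs\<close>)
  \<comment> \<open>A horn of \<open>J'\<close>: its faces that do not contain \<open>J\<close>.
    There \<open>D\<close> is now coloured; toggling \<open>x\<close> fills the horn, and the
    filling contains the wanted face \<open>J\<close>.\<close>
  define R where "R = {I \<in> faces J'. \<not> J \<subseteq> I}"
  have ascR: "asc R"
    by (rule asc_I) (auto simp: R_def intro: finite_subset[OF _ fin(1)] finite_subset[OF _ finite_Pow_iff[THEN iffD2, OF fin(1)]])
  have 5: "extends s (bl D R \<union> bl B (faces J')) (bl D (faces J'))"
  proof (rule cone_extends[of D B _ _ j x])
    fix I assume "I \<in> faces J' - R"
    then show "j \<in> I \<and> insert x I \<in> faces J' \<and> I - {x} \<notin> R"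
      using j x by (auto simp: R_def J'_def)
  next
    show "R \<subseteq> faces J'" by (auto simp: R_def)
  qed (use asc ascR inj sub xj fin in \<open>auto intro!: asc_faces\<close>)
  have "I \<in> Q \<or> I \<in> faces J''" if I: "I \<in> R" for I
    using I by (cases "J - {j} \<subseteq> I") (auto simp: R_def Q_def J''_def J'_def)
  then have R4: "bl D R \<union> bl B (faces J') \<subseteq> ?X4"
    unfolding blps by (intro blp_mono) blast
  have 6: "extends s ?X0 ?X4"
    by (rule extends_trans[OF extends_trans[OF extends_trans[OF 1 2] 3] 4]) auto
  have 7: "extends s ?X0 (bl D R \<union> bl B (faces J'))"
    using 6 R4 by (rule extends_restrict)
  have "?X0 \<subseteq> bl D R \<union> bl B (faces J')"
    unfolding blps by (rule blp_mono) (auto simp: R_def J'_def)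
  then have "extends s ?X0 (bl D (faces J'))"
    by (rule extends_trans[OF 7 5])
  then show "extends s ?X0 (bl D (faces J))"
    by (rule extends_restrict) (auto simp: bl_def J'_def)
qed

text \<open>Descending induction on \<open>card J\<close>: over four or more indices every new simplex has at least
  four vertices and carries no colour, and filling a horn relates \<open>J\<close> to \<open>insert x J\<close>.\<close>

theorem EP_exts:
  assumes ep: "EP s L K" and asc: "asc L" "asc K" and sub: "L \<subseteq> K" and inj: "inj_on s (\<Union>K \<times> UNIV)"
    and "finite J" "J \<noteq> {}" "card J \<le> 4"
    and "c \<in> col s (bl K (pfaces J) \<union> bl L (faces J))"
  shows "real (card (exts s (bl K (pfaces J) \<union> bl L (faces J)) (bl K (faces J)) c))
       = wt (bl K (faces J) - (bl K (pfaces J) \<union> bl L (faces J)))"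
  using assms(6-)
proof (induction "4 - card J" arbitrary: J c rule: less_induct)
  case less
  let ?F = "bl K (faces J)" and ?N = "bl K (pfaces J) \<union> bl L (faces J)"
  note J = \<open>finite J\<close> \<open>J \<noteq> {}\<close>
  note ascs = asc_bl asc_Un asc_faces asc_pfaces
  have ascF: "asc ?F" and ascN: "asc ?N" using asc J by (auto intro!: ascs)
  have NF: "?N \<subseteq> ?F" unfolding blps by (rule blp_mono) (use sub in auto)
  have "extends s ?N ?F" using ep J by (auto simp: EP_def)
  then have "exts s ?N ?F c \<noteq> {}"
    using extends_iff_exts[OF ascN ascF NF] less.prems(4) by blast
  then obtain d where d: "d \<in> exts s ?N ?F c" by blast
  show ?case
  proof (cases "card J = 4")
    case True
    have big: "card S \<ge> 4" if "S \<in> ?F - ?N" for S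
    proof -
      have "snd ` S = J" "finite S" using that by (auto simp: bl_def)
      then show ?thesis using True card_image_le[of S snd] by simp
    qed
    have "wt (?F - ?N) = 1"
      unfolding wt_def
    proof (rule prod.neutral, rule ballI)
      fix S assume "S \<in> ?F - ?N"
      from big[OF this] show "(if card S = 1 then real (card (carrier G)) / real (card (carrier H))
          else if card S = 2 then real (card (carrier H)) else 1) = 1" by auto
    qed
    moreover have "exts s ?N ?F c = {c}"
    proof -
      have e: "edges ?F = edges ?N"
      proof (intro equalityI subsetI)
        fix S assume S: "S \<in> edges ?F"
        then show "S \<in> edges ?N" using big[of S] by (cases "S \<in> ?N") auto
      qed (use NF in blast)
      have t: "triangles ?F = triangles ?N"
      proof (intro equalityI subsetI)
        fix S assume S: "S \<in> triangles ?F"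
        then show "S \<in> triangles ?N" using big[of S] by (cases "S \<in> ?N") auto
      qed (use NF in blast)
      have "y = c" if "y \<in> exts s ?N ?F c" for y
      proof -
        have "rst ?F y = rst ?N y" unfolding rst_def e t ..
        then show ?thesis using that rst_self[of y s ?F] unfolding exts_def by simp
      qed
      then show ?thesis using d by blast
    qed
    ultimately show ?thesis by simp
  next
    case False
    obtain x where x: "x \<notin> J" using J(1) ex_new_if_finite infinite_UNIV_nat by blast
    obtain j where j: "j \<in> J" using J by auto
    have xj: "x \<noteq> j" using x j by auto
    define J' where "J' = insert x J"
    have J': "finite J'" "J' \<noteq> {}" "card J' \<le> 4" "4 - card J' < 4 - card J"
      using J x False less.prems(3) by (auto simp: J'_def)
    define R where "R = {I \<in> faces J'. \<not> J \<subseteq> I}"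
    have ascR: "asc R"
      by (rule asc_I) (auto simp: R_def intro: finite_subset[OF _ J'(1)] finite_subset[OF _ finite_Pow_iff[THEN iffD2, OF J'(1)]])
    let ?A = "bl K R \<union> bl L (faces J')" and ?K' = "bl K (faces J')"
      and ?M = "bl K (pfaces J') \<union> bl L (faces J')"
    have ascA: "asc ?A" and ascK': "asc ?K'" and ascM: "asc ?M"
      using asc ascR J' by (auto intro!: ascs)
    have AM: "?A \<union> ?F = ?M"
      unfolding blps
    proof (rule blp_eq)
      fix \<sigma> I
      have "I \<in> R \<or> I \<in> faces J \<longleftrightarrow> I \<in> pfaces J'"
        using x j by (auto simp: R_def J'_def)
      moreover have "I \<in> faces J \<Longrightarrow> I \<in> faces J'" by (auto simp: J'_def)
      ultimately show "((\<sigma> \<in> K \<and> I \<in> R \<or> \<sigma> \<in> L \<and> I \<in> faces J') \<or> \<sigma> \<in> K \<and> I \<in> faces J) \<longleftrightarrow>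
          (\<sigma> \<in> K \<and> I \<in> pfaces J' \<or> \<sigma> \<in> L \<and> I \<in> faces J')" by blast
    qed
    have AN: "?A \<inter> ?F = ?N"
      unfolding blps by (rule blp_eq) (use sub in \<open>auto simp: R_def J'_def\<close>)
    have AM': "?A \<subseteq> ?M" using AM by auto
    have MK': "?M \<subseteq> ?K'" unfolding blps by (rule blp_mono) (use sub in auto)
    have FK': "?F \<subseteq> ?K'" by (rule bl_mono) (auto simp: J'_def)
    have "extends s (bl K (faces J) \<union> bl {} (faces J')) (bl K (faces J'))"
    proof (rule cone_extends[of K "{}" _ _ x j])
      fix I assume "I \<in> faces J' - faces J"
      then show "x \<in> I \<and> insert j I \<in> faces J' \<and> I - {j} \<notin> faces J"
        using j xj by (auto simp: J'_def)
    qed (use asc inj xj J J' in \<open>auto intro!: asc_faces asc_empty simp: J'_def\<close>)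
    then have "extends s ?F ?K'" by simp
    then obtain t where t: "t \<in> exts s ?F ?K' d"
      using extends_iff_exts[OF ascF ascK' FK'] d by (auto simp: exts_def)
    \<comment> \<open>The restriction to the horn of an extension that continues \<open>c\<close>.
      Starting from \<open>c\<close> alone, a colouring of the horn compatible with it must first be
      found, and the extension property provides it.\<close>
    define y where "y = rst ?A t"
    have tK: "t \<in> col s ?K'" using t by (simp add: exts_def)
    have yA: "y \<in> col s ?A"
      unfolding y_def using AM' MK' by (intro rst_col[OF ascA _ tK]) blast
    have "rst ?N y = rst ?N t"
      unfolding y_def AN[symmetric] by (rule rst_rst) blast
    also have "\<dots> = rst ?N (rst ?F t)"
      using NF by (rule rst_rst[symmetric])
    also have "\<dots> = c" using t d by (simp add: exts_def)
    finally have yN: "rst ?N y = c" .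
    have horn: "real (card (exts s ?A ?K' y)) = wt (?K' - ?A)"
    proof (rule cone_exts[of K L _ _ j x])
      fix I assume "I \<in> faces J' - R"
      then show "j \<in> I \<and> insert x I \<in> faces J' \<and> I - {x} \<notin> R"
        using j x by (auto simp: R_def J'_def)
    next
      show "R \<subseteq> faces J'" by (auto simp: R_def)
    qed (use asc ascR inj sub xj J' yA in \<open>auto intro!: asc_faces\<close>)
    \<comment> \<open>The fillings of the horn are counted twice: directly, and by first filling the
      face over \<open>J\<close> and then the interior, where the induction hypothesis gives the
      number. Their quotient is the number for the face, which by excision is the one
      wanted.\<close>
    have "real (card (exts s ?A ?K' y)) = (\<Sum>z\<in>exts s ?A ?M y. real (card (exts s ?M ?K' z)))"
      using exts_tower[OF ascM ascK' AM' MK', of s y] by simp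
    also have "\<dots> = (\<Sum>z\<in>exts s ?A ?M y. wt (?K' - ?M))"
    proof (rule sum.cong)
      fix z assume "z \<in> exts s ?A ?M y"
      then have "z \<in> col s ?M" by (simp add: exts_def)
      then show "real (card (exts s ?M ?K' z)) = wt (?K' - ?M)"
        using less.hyps[OF J'(4) J'(1-3)] by simp
    qed simp
    finally have "wt (?K' - ?A) = real (card (exts s ?A ?M y)) * wt (?K' - ?M)"
      using horn by simp
    moreover have "wt (?K' - ?A) = wt (?M - ?A) * wt (?K' - ?M)"
    proof -
      have "?K' - ?A = (?M - ?A) \<union> (?K' - ?M)" using AM' MK' by blast
      moreover have "(?M - ?A) \<inter> (?K' - ?M) = {}" by blast
      ultimately show ?thesis
        using wt_Un[of "?M - ?A" "?K' - ?M"] asc_finite[OF ascM] asc_finite[OF ascK']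
        by (metis finite_Diff)
    qed
    ultimately have "real (card (exts s ?A ?M y)) = wt (?M - ?A)"
      using wt_pos[of "?K' - ?M"] by simp
    moreover have "?M - ?A = ?F - ?N" using AM AN by blast
    moreover have "card (exts s ?A ?M y) = card (exts s ?N ?F c)"
      using exts_push[OF ascA ascF yA] unfolding AM AN yN .
    ultimately show ?thesis by simp
  qed
qed

section \<open>The normalised count and transport of flatness\<close>

definition Zc :: "('v \<Rightarrow> nat) \<Rightarrow> 'v set set \<Rightarrow> real" where
  "Zc r K = real (card (col r K)) / wt K"

lemma Zc_exts:
  assumes "asc L" "asc K" "L \<subseteq> K" "\<And>c. c \<in> col r L \<Longrightarrow> real (card (exts r L K c)) = wt (K - L)"
  shows "Zc r K = Zc r L"
proof -
  have "K = L \<union> (K - L)" using assms(3) by auto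
  then have "wt K = wt L * wt (K - L)"
    using wt_Un[of L "K - L"] asc_finite[OF assms(1)] asc_finite[OF assms(2)] by auto
  then show ?thesis
    using card_col_exts[OF assms] wt_pos[of "K - L"] by (simp add: Zc_def)
qed

lemma flat_at_image:
  assumes "inj_on f U"
  shows "flat_at r g h (f ` U) \<longleftrightarrow> flat_at (\<lambda>v. r (f v)) (\<lambda>S. g (f ` S)) (\<lambda>S. h (f ` S)) U"
proof -
  have c: "card (f ` U) = card U" using assms by (rule card_image)
  have 3: "(\<exists>j' k' l'. U = {j',k',l'} \<and> f j' = j \<and> f k' = k \<and> f l' = l)"
    if eq: "f ` U = {j,k,l}" for j k l
  proof -
    have "j \<in> f ` U" "k \<in> f ` U" "l \<in> f ` U" using eq by auto
    then obtain j' k' l' where p: "j' \<in> U" "k' \<in> U" "l' \<in> U" "j = f j'" "k = f k'" "l = f l'" by blast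
    then have "f ` U = f ` {j',k',l'}" using eq by simp
    then have "U = {j',k',l'}" using inj_on_image_eq_iff[OF assms, of U "{j',k',l'}"] p by simp
    then show ?thesis using p by blast
  qed
  have 4: "(\<exists>j' k' l' m'. U = {j',k',l',m'} \<and> f j' = j \<and> f k' = k \<and> f l' = l \<and> f m' = m)"
    if eq: "f ` U = {j,k,l,m}" for j k l m
  proof -
    have "j \<in> f ` U" "k \<in> f ` U" "l \<in> f ` U" "m \<in> f ` U" using eq by auto
    then obtain j' k' l' m' where p: "j' \<in> U" "k' \<in> U" "l' \<in> U" "m' \<in> U" "j = f j'" "k = f k'" "l = f l'" "m = f m'"
      by blast
    then have "f ` U = f ` {j',k',l',m'}" using eq by simp
    then have "U = {j',k',l',m'}" using inj_on_image_eq_iff[OF assms, of U "{j',k',l',m'}"] p by simp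
    then show ?thesis using p by blast
  qed
  show ?thesis
  proof
    assume a: "flat_at r g h (f ` U)"
    show "flat_at (\<lambda>v. r (f v)) (\<lambda>S. g (f ` S)) (\<lambda>S. h (f ` S)) U"
      unfolding flat_at_def
    proof (intro conjI allI impI)
      fix j k l assume "U = {j,k,l}" "r (f j) < r (f k)" "r (f k) < r (f l)"
      then show "tri_eq (h (f ` {j,k,l})) (g (f ` {k,l})) (g (f ` {j,k})) (g (f ` {j,l}))"
        using a by (simp add: flat_at_triangle)
    next
      fix j k l m assume "U = {j,k,l,m}" "r (f j) < r (f k)" "r (f k) < r (f l)" "r (f l) < r (f m)"
      then show "tet_eq (h (f ` {j,l,m})) (g (f ` {l,m})) (h (f ` {j,k,l})) (h (f ` {j,k,m})) (h (f ` {k,l,m}))"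
        using a by (simp add: flat_at_tetrahedron)
    qed (use a c in \<open>simp_all add: flat_at_def\<close>)
  next
    assume a: "flat_at (\<lambda>v. r (f v)) (\<lambda>S. g (f ` S)) (\<lambda>S. h (f ` S)) U"
    show "flat_at r g h (f ` U)"
      unfolding flat_at_def
    proof (intro conjI allI impI)
      fix j k l assume e: "f ` U = {j,k,l}" and lt: "r j < r k" "r k < r l"
      from 3[OF e] obtain j' k' l' where p: "U = {j',k',l'}" "f j' = j" "f k' = k" "f l' = l" by blast
      then show "tri_eq (h {j,k,l}) (g {k,l}) (g {j,k}) (g {j,l})"
        using a lt flat_at_triangle[of "\<lambda>v. r (f v)" j' k' l' "\<lambda>S. g (f ` S)" "\<lambda>S. h (f ` S)"] by simp
    next
      fix j k l m assume e: "f ` U = {j,k,l,m}" and lt: "r j < r k" "r k < r l" "r l < r m"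
      from 4[OF e] obtain j' k' l' m' where p: "U = {j',k',l',m'}" "f j' = j" "f k' = k" "f l' = l" "f m' = m" by blast
      then show "tet_eq (h {j,l,m}) (g {l,m}) (h {j,k,l}) (h {j,k,m}) (h {k,l,m})"
        using a lt flat_at_tetrahedron[of "\<lambda>v. r (f v)" j' k' l' m' "\<lambda>S. g (f ` S)" "\<lambda>S. h (f ` S)"] by simp
    qed (use a c in \<open>simp_all add: flat_at_def\<close>)
  qed
qed

end

section \<open>Isomorphisms, vertex orders and nerves\<close>

lemma asc_image:
  assumes "asc K"
  shows "asc ((`) f ` K)"
proof (rule asc_I)
  fix S T assume "S \<in> (`) f ` K" "T \<subseteq> S" "T \<noteq> {}"
  then obtain U where U: "U \<in> K" "S = f ` U" by blast
  then obtain V where V: "V \<subseteq> U" "T = f ` V" using \<open>T \<subseteq> S\<close> by (metis subset_image_iff)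
  then have "V \<in> K" using asc_mono[OF assms U(1) V(1)] \<open>T \<noteq> {}\<close> by auto
  then show "T \<in> (`) f ` K" using V by blast
qed (use assms asc_finite asc_simplex in auto)

lemma bl_singleton: "asc K \<Longrightarrow> bl K {{i}} = (`) (\<lambda>v. (v, i)) ` K"
proof (intro equalityI subsetI)
  fix S assume S: "S \<in> bl K {{i}}"
  then have "snd ` S = {i}" "fst ` S \<in> K" by (auto simp: bl_def)
  moreover from this have "S = (\<lambda>v. (v, i)) ` (fst ` S)" by (force simp: image_iff)
  ultimately show "S \<in> (`) (\<lambda>v. (v, i)) ` K" by blast
next
  fix S assume a: "asc K" and S: "S \<in> (`) (\<lambda>v. (v, i)) ` K"
  then obtain U where U: "U \<in> K" "S = (\<lambda>v. (v, i)) ` U" by blast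
  then have "finite U" "U \<noteq> {}" using asc_simplex[OF a] by auto
  then show "S \<in> bl K {{i}}" using U by (auto simp: bl_def image_image)
qed

context finite_crossed_module
begin

lemma card_col_image:
  assumes "asc K" "inj_on f (\<Union>K)"
  shows "card (col r ((`) f ` K)) = card (col (\<lambda>v. r (f v)) K)"
proof -
  let ?K' = "(`) f ` K"
  let ?r = "\<lambda>v. r (f v)"
  have injU: "inj_on f U" if "U \<in> K" for U
    using assms(2) by (rule inj_on_subset) (use that in auto)
  have cardI: "card (f ` U) = card U" if "U \<in> K" for U
    using injU[OF that] by (rule card_image)
  have inje: "inj_on ((`) f) K"
    by (rule inj_onI) (metis assms(2) inj_on_image_eq_iff Union_upper)
  have invi: "inv_into K ((`) f) (f ` U) = U" if "U \<in> K" for U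
    using inv_into_f_f[OF inje that] .
  define \<Phi> where "\<Phi> = (\<lambda>(g :: _ set \<Rightarrow> 'g, h :: _ set \<Rightarrow> 'h). rst K (\<lambda>S. g (f ` S), \<lambda>S. h (f ` S)))"
  define \<Psi> where "\<Psi> = (\<lambda>(g :: _ set \<Rightarrow> 'g, h :: _ set \<Rightarrow> 'h).
      rst ?K' (\<lambda>S. g (inv_into K ((`) f) S), \<lambda>S. h (inv_into K ((`) f) S)))"
  have "bij_betw \<Phi> (col r ?K') (col ?r K)"
  proof (rule bij_betwI[where g = \<Psi>])
    show "\<Phi> \<in> col r ?K' \<rightarrow> col ?r K"
    proof
      fix c assume c: "c \<in> col r ?K'"
      obtain g h where gh: "c = (g, h)" by fastforce
      have "flat r ?K' g h" using c gh by (simp add: col_def)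
      then have "flat ?r K (\<lambda>S. g (f ` S)) (\<lambda>S. h (f ` S))"
        by (auto simp: flat_def flat_at_image[OF injU])
      from rst_flat[OF assms(1) this] show "\<Phi> c \<in> col ?r K"
        by (simp add: \<Phi>_def gh rst_def col_def)
    qed
    show "\<Psi> \<in> col ?r K \<rightarrow> col r ?K'"
    proof
      fix c assume c: "c \<in> col ?r K"
      obtain g h where gh: "c = (g, h)" by fastforce
      let ?g = "\<lambda>S. g (inv_into K ((`) f) S)" and ?h = "\<lambda>S. h (inv_into K ((`) f) S)"
      have "flat ?r K g h" using c gh by (simp add: col_def)
      moreover have "agree K g h (\<lambda>S. ?g (f ` S)) (\<lambda>S. ?h (f ` S))"
        by (simp add: agree_def invi)
      ultimately have "flat ?r K (\<lambda>S. ?g (f ` S)) (\<lambda>S. ?h (f ` S))"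
        using flat_cong[OF assms(1)] by blast
      then have "flat r ?K' ?g ?h"
        unfolding flat_def by (auto simp: flat_at_image[OF injU])
      from rst_flat[OF asc_image[OF assms(1)] this] show "\<Psi> c \<in> col r ?K'"
        by (simp add: \<Psi>_def gh rst_def col_def)
    qed
  next
    fix c assume c: "c \<in> col r ?K'"
    obtain g h where gh: "c = (g, h)" by fastforce
    have "\<Psi> (\<Phi> c) = rst ?K' (g, h)"
      by (auto simp: \<Psi>_def \<Phi>_def gh rst_def fun_eq_iff invi cardI)
    then show "\<Psi> (\<Phi> c) = c" using rst_self[OF c] gh by simp
  next
    fix d assume d: "d \<in> col ?r K"
    obtain g h where gh: "d = (g, h)" by fastforce
    have "\<Phi> (\<Psi> d) = rst K (g, h)"
      by (auto simp: \<Psi>_def \<Phi>_def gh rst_def fun_eq_iff invi cardI)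
    then show "\<Phi> (\<Psi> d) = d" using rst_self[OF d] gh by simp
  qed
  then show ?thesis by (rule bij_betw_same_card)
qed

lemma wt_image:
  assumes "inj_on f (\<Union>K)"
  shows "wt ((`) f ` K) = wt K"
proof -
  have "inj_on ((`) f) K"
    by (rule inj_onI) (metis assms inj_on_image_eq_iff Union_upper)
  moreover have "card (f ` U) = card U" if "U \<in> K" for U
    by (rule card_image[OF inj_on_subset[OF assms]]) (use that in auto)
  ultimately show ?thesis
    unfolding wt_def by (subst prod.reindex) (auto intro!: prod.cong)
qed

lemma Zc_image:
  assumes "asc K" "inj_on f (\<Union>K)"
  shows "Zc r ((`) f ` K) = Zc (\<lambda>v. r (f v)) K"
  by (simp add: Zc_def card_col_image[OF assms] wt_image[OF assms(2)])

lemma Zc_bl_singleton: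
  assumes "asc K"
  shows "Zc s (bl K {{i}}) = Zc (\<lambda>v. s (v, i)) K"
  using Zc_image[OF assms, of "\<lambda>v. (v, i)" s] bl_singleton[OF assms] by (simp add: inj_on_def)

text \<open>The case of a single index: it has no proper faces, and the blow-up over it is a copy of
  the complex.\<close>

lemma EP_Zc:
  assumes "EP s L K" "asc L" "asc K" "L \<subseteq> K" "inj_on s (\<Union>K \<times> UNIV)"
  shows "Zc (\<lambda>v. s (v, 0)) K = Zc (\<lambda>v. s (v, 0)) L"
proof -
  have f: "faces {0} = {{0}}" "pfaces {0} = {}" by auto
  have a: "asc (bl L {{0}})" "asc (bl K {{0}})"
    using assms asc_faces[of "{0}"] by (auto simp: f intro!: asc_bl)
  have "real (card (exts s (bl L {{0}}) (bl K {{0}}) c)) = wt (bl K {{0}} - bl L {{0}})"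
    if "c \<in> col s (bl L {{0}})" for c
    using EP_exts[OF assms(1,2,3,4,5), of "{0}" c] that by (simp add: f)
  then have "Zc s (bl K {{0}}) = Zc s (bl L {{0}})"
    using Zc_exts[OF a bl_mono[OF assms(4) order_refl]] by blast
  then show ?thesis
    by (simp add: Zc_bl_singleton assms)
qed

lemma Zc_order_mono:
  assumes "\<And>v w. r v < r w \<longleftrightarrow> r' v < r' w"
  shows "Zc r K = Zc r' K"
  unfolding Zc_def col_def flat_def flat_at_def assms ..

text \<open>A ranking of the blow-up over two indices restricts to \<open>r\<close> on one copy of
  \<open>K\<close> and to \<open>r'\<close> on the other, and the blow-up collapses to either
  copy.\<close>

lemma Zc_order:
  assumes "asc K" "inj_on r (\<Union>K)" "inj_on r' (\<Union>K)"
  shows "Zc r K = Zc r' K"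
proof -
  \<comment> \<open>Even ranks on copy 0 and odd ones on copy 1 keep the two copies apart.\<close>
  define s where "s = (\<lambda>(v, i::nat). if i = 0 then 2 * r v else 2 * r' v + 1)"
  let ?D = "bl K (faces {0,1})"
  have "faces {i} = {{i}}" for i by auto
  then have fin: "asc (faces {0,1})" "asc {{0::nat}}" "asc {{1::nat}}"
    using asc_faces[of "{0,1}"] asc_faces[of "{0}"] asc_faces[of "{1}"] by simp_all
  then have a: "asc ?D" "asc (bl K {{0}})" "asc (bl K {{1}})"
    using assms(1) by (simp_all add: asc_bl)
  have "inj_on s (\<Union>K \<times> {0,1})"
  proof (rule inj_onI)
    fix p p' assume p: "p \<in> \<Union>K \<times> {0,1}" "p' \<in> \<Union>K \<times> {0,1}" "s p = s p'"
    obtain v i v' i' where vi: "p = (v,i)" "p' = (v',i')" by fastforce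
    have e: "(if i = 0 then 2 * r v else 2 * r' v + 1) = (if i' = 0 then 2 * r v' else 2 * r' v' + 1)"
      using p(3) by (simp add: s_def vi)
    then have "i = 0 \<longleftrightarrow> i' = 0" by (auto split: if_splits) presburger+
    then have "i = i'" "i = 0 \<Longrightarrow> r v = r v'" "i \<noteq> 0 \<Longrightarrow> r' v = r' v'"
      using p vi e by (auto split: if_splits)
    moreover have "v \<in> \<Union>K" "v' \<in> \<Union>K" using p vi by auto
    ultimately show "p = p'" using assms(2,3) vi unfolding inj_on_def by metis
  qed
  moreover have "\<Union>?D \<subseteq> \<Union>K \<times> {0,1}" using Union_bl[of K "faces {0,1}"] by auto
  ultimately have inj: "inj_on s (\<Union>?D)" by (rule inj_on_subset)
  have Zi: "Zc s ?D = Zc s (bl K {{i}})" if "i \<in> {0,1}" for i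
  proof -
    have ai: "asc {{i}}" "asc (bl K {{i}})" using that fin a by auto
    have Di: "bl K {{i}} \<subseteq> ?D" using that by (intro bl_mono) auto
    have t: "toggles (bl K {{i}} \<union> bl {} (faces {0,1})) ?D (UNIV \<times> {1 - i}) (\<lambda>B. (fst (SOME p. p \<in> B), i))"
    proof (rule cone_toggles)
      fix I assume "I \<in> faces {0,1} - {{i}}"
      then show "1 - i \<in> I \<and> insert i I \<in> faces {0,1} \<and> I - {i} \<notin> {{i}}"
        using that by auto
    qed (use assms fin ai that in \<open>auto simp: asc_empty\<close>)
    show ?thesis
    proof (rule Zc_exts)
      fix c assume "c \<in> col s (bl K {{i}})"
      then show "real (card (exts s (bl K {{i}}) ?D c)) = wt (?D - bl K {{i}})"
        using t by (intro toggle_exts[OF a(1) ai(2) Di inj]) simp_all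
    qed (use a ai Di in auto)
  qed
  have "Zc r K = Zc (\<lambda>v. s (v, 0)) K"
    by (rule Zc_order_mono) (simp add: s_def)
  also have "\<dots> = Zc (\<lambda>v. s (v, 1)) K"
    using Zi[of 0] Zi[of 1] by (simp add: Zc_bl_singleton[OF assms(1)])
  also have "\<dots> = Zc r' K"
    by (rule Zc_order_mono) (simp add: s_def)
  finally show ?thesis .
qed

end

text \<open>The sets themselves are the vertices, so the nerves of overlapping families fit together
  inside the nerve of their union.\<close>

definition nerve :: "'x set set \<Rightarrow> 'x set set set" where
  "nerve F = {\<sigma>. \<sigma> \<subseteq> F \<and> finite \<sigma> \<and> \<sigma> \<noteq> {} \<and> \<Inter>\<sigma> \<noteq> {}}"

lemma asc_nerve:
  assumes "finite F" shows "asc (nerve F)"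
proof (rule asc_I)
  show "finite (nerve F)" unfolding nerve_def using assms by simp
  fix S T assume "S \<in> nerve F" "T \<subseteq> S" "T \<noteq> {}"
  moreover from this have "\<Inter>S \<subseteq> \<Inter>T" by blast
  ultimately show "T \<in> nerve F" unfolding nerve_def by (blast intro: finite_subset)
qed (auto simp: nerve_def)

lemma nerve_mono: "F \<subseteq> F' \<Longrightarrow> nerve F \<subseteq> nerve F'"
  by (auto simp: nerve_def)

context finite_crossed_module
begin

text \<open>The new simplices are collapsed by toggling the chosen member \<open>t\<close> of \<open>F\<close>, in a copy over which
  some member of \<open>F'\<close> already lies.\<close>

lemma nerve_EP:
  fixes F F' :: "'x set set"
  assumes fin: "finite F" "finite F'"
    and dom: "\<And>\<beta>. \<beta> \<subseteq> F' - F \<Longrightarrow> \<beta> \<noteq> {} \<Longrightarrow> \<exists>t\<in>F. \<forall>\<alpha>\<subseteq>F. \<Inter>(\<alpha> \<union> \<beta>) \<noteq> {} \<longrightarrow> \<Inter>(insert t (\<alpha> \<union> \<beta>)) \<noteq> {}"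
    and inj: "inj_on s ((F \<union> F') \<times> UNIV)"
  shows "EP s (nerve F) (nerve (F \<union> F'))"
  unfolding EP_def
proof (intro allI impI)
  fix J :: "nat set" assume J: "finite J" "J \<noteq> {}"
  let ?L = "nerve F" and ?K = "nerve (F \<union> F')"
  define t where "t \<beta> = (SOME t. t \<in> F \<and> (\<forall>\<alpha>\<subseteq>F. \<Inter>(\<alpha> \<union> \<beta>) \<noteq> {} \<longrightarrow> \<Inter>(insert t (\<alpha> \<union> \<beta>)) \<noteq> {}))" for \<beta>
  have t: "t \<beta> \<in> F" "\<And>\<alpha>. \<alpha> \<subseteq> F \<Longrightarrow> \<Inter>(\<alpha> \<union> \<beta>) \<noteq> {} \<Longrightarrow> \<Inter>(insert (t \<beta>) (\<alpha> \<union> \<beta>)) \<noteq> {}"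
    if "\<beta> \<subseteq> F' - F" "\<beta> \<noteq> {}" for \<beta>
    using someI_ex[of "\<lambda>t. t \<in> F \<and> (\<forall>\<alpha>\<subseteq>F. \<Inter>(\<alpha> \<union> \<beta>) \<noteq> {} \<longrightarrow> \<Inter>(insert t (\<alpha> \<union> \<beta>)) \<noteq> {})"] dom[OF that]
    unfolding t_def[symmetric] by blast+
  define W where "W = (F' - F) \<times> (UNIV :: nat set)"
  define q where "q B = (t (fst ` B), snd (SOME p. p \<in> B))" for B :: "('x set \<times> nat) set"
  have asc: "asc ?L" "asc ?K" using fin by (auto intro!: asc_nerve)
  note ascs = asc_bl asc_Un asc_faces asc_pfaces
  let ?N = "bl ?K (pfaces J) \<union> bl ?L (faces J)"
  show "extends s ?N (bl ?K (faces J))"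
  proof (rule toggle_extends)
    show "toggles ?N (bl ?K (faces J)) W q"
      unfolding toggles_def
    proof
      fix S assume S: "S \<in> bl ?K (faces J) - ?N"
      have f: "finite S" "fst ` S \<in> ?K" "fst ` S \<notin> ?L" "snd ` S = J"
        using S by (auto simp: bl_def)
      let ?B = "S \<inter> W"
      let ?\<beta> = "fst ` ?B"
      have fS: "fst ` S \<subseteq> F \<union> F'" "\<Inter>(fst ` S) \<noteq> {}" "fst ` S \<noteq> {}" using f(2) unfolding nerve_def by blast+
      have \<beta>: "?\<beta> \<subseteq> F' - F" by (auto simp: W_def)
      have nW: "fst p \<in> F" if "p \<in> S" "p \<notin> W" for p
      proof -
        have "fst p \<in> F \<union> F'" using fS(1) that(1) by blast
        then show ?thesis using that(2) by (auto simp: W_def mem_Times_iff)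
      qed
      have \<beta>0: "?\<beta> \<noteq> {}"
      proof
        assume "?\<beta> = {}"
        then have "fst ` S \<subseteq> F" using nW by blast
        then have "fst ` S \<in> ?L" unfolding nerve_def using f(1) fS by blast
        then show False using f by simp
      qed
      have "\<exists>p. p \<in> ?B" using \<beta>0 by blast
      then have "(SOME p. p \<in> ?B) \<in> ?B" by (rule someI_ex)
      then obtain w where w: "(w, snd (q ?B)) \<in> ?B" unfolding q_def by (metis prod.collapse snd_conv)
      have fq: "fst (q ?B) = t ?\<beta>" by (simp add: q_def)
      have "fst (q ?B) \<in> F" using t(1)[OF \<beta> \<beta>0] fq by simp
      then have qW: "q ?B \<notin> W" unfolding W_def by (metis DiffD2 mem_Times_iff)
      have split: "fst ` S = fst ` (S - W) \<union> ?\<beta>" by blast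
      have "fst ` (S - W) \<subseteq> F" using nW by blast
      from t(2)[OF \<beta> \<beta>0 this] have "\<Inter>(insert (t ?\<beta>) (fst ` S)) \<noteq> {}"
        using fS(2) unfolding split by blast
      then have "fst ` insert (q ?B) S \<in> ?K"
        unfolding nerve_def using f(1) fS t(1)[OF \<beta> \<beta>0] by (simp add: fq)
      moreover have "snd (q ?B) \<in> snd ` S" by (rule image_eqI[OF _ IntD1[OF w]]) simp
      then have "snd ` insert (q ?B) S = J" using f(4) by (simp add: insert_absorb)
      ultimately have ins: "insert (q ?B) S \<in> bl ?K (faces J)" using f J by (simp add: bl_def)
      have BS: "?B \<subseteq> S - {q ?B}" using qW by blast
      have sn: "snd ` (S - {q ?B}) = J"
      proof -
        have "snd (q ?B) \<in> snd ` (S - {q ?B})" by (rule image_eqI[OF _ subsetD[OF BS w]]) simp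
        then have "snd ` S \<subseteq> snd ` (S - {q ?B})" by blast
        then show ?thesis using f(4) by blast
      qed
      have ne: "S - {q ?B} \<noteq> {}" using w BS by blast
      have "fst ` (S - {q ?B}) \<in> ?K"
        by (rule asc_mono[OF asc(2) f(2)]) (use ne in auto)
      moreover have "fst ` (S - {q ?B}) \<notin> ?L"
      proof
        assume "fst ` (S - {q ?B}) \<in> ?L"
        then have "fst ` (S - {q ?B}) \<subseteq> F" unfolding nerve_def by blast
        then have "?\<beta> \<subseteq> F" using BS by blast
        then show False using \<beta> \<beta>0 by blast
      qed
      ultimately have "S - {q ?B} \<in> bl ?K (faces J) - ?N"
        using sn ne f(1) J by (auto simp: bl_def)
      with qW ins show "q ?B \<notin> W \<and> insert (q ?B) S \<in> bl ?K (faces J) \<and> S - {q ?B} \<in> bl ?K (faces J) - ?N"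
        by blast
    qed
    show "?N \<subseteq> bl ?K (faces J)"
      unfolding blps by (rule blp_mono) (use nerve_mono[of F "F \<union> F'"] in auto)
    have "\<Union>(bl ?K (faces J)) \<subseteq> (F \<union> F') \<times> UNIV"
      using Union_bl[of ?K "faces J"] unfolding nerve_def by blast
    then show "inj_on s (\<Union>(bl ?K (faces J)))" by (rule inj_on_subset[OF inj])
  qed (use asc J in \<open>auto intro!: ascs\<close>)
qed

end

section \<open>Superlevel sets\<close>

text \<open>The inserted 0 restricts to nonnegative levels and supplies the maximum when
  \<open>\<sigma> = V\<close>. The outer \<open>max 0\<close> makes the value vanish when no level
  has \<sigma> as its superlevel set.\<close>

definition gap :: "'v set \<Rightarrow> ('v \<Rightarrow> real) \<Rightarrow> 'v set \<Rightarrow> real" where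
  "gap V f \<sigma> = max 0 (Min (f ` \<sigma>) - Max (insert 0 (f ` (V - \<sigma>))))"

lemma gap_nonneg: "0 \<le> gap V f \<sigma>"
  by (simp add: gap_def)

lemma gap_pos_iff:
  assumes "finite V" "\<sigma> \<subseteq> V" "\<sigma> \<noteq> {}"
  shows "0 < gap V f \<sigma> \<longleftrightarrow> (\<forall>v\<in>\<sigma>. 0 < f v \<and> (\<forall>w\<in>V - \<sigma>. f w < f v))"
proof -
  have fs: "finite \<sigma>" using assms finite_subset by auto
  have "0 < gap V f \<sigma> \<longleftrightarrow> Max (insert 0 (f ` (V - \<sigma>))) < Min (f ` \<sigma>)"
    by (auto simp: gap_def)
  also have "\<dots> \<longleftrightarrow> (\<forall>v\<in>\<sigma>. Max (insert 0 (f ` (V - \<sigma>))) < f v)"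
    using fs assms by (subst Min_gr_iff) auto
  also have "\<dots> \<longleftrightarrow> (\<forall>v\<in>\<sigma>. 0 < f v \<and> (\<forall>w\<in>V - \<sigma>. f w < f v))"
    using assms by (subst Max_less_iff) auto
  finally show ?thesis .
qed

text \<open>\<open>gap V f \<sigma>\<close> is the length of the set of levels whose superlevel set is \<open>\<sigma>\<close>.\<close>

lemma layer_cake:
  assumes "finite V" "v \<in> V" "\<And>w. w \<in> V \<Longrightarrow> 0 \<le> f w"
  shows "f v = (\<Sum>\<sigma> | \<sigma> \<subseteq> V \<and> v \<in> \<sigma>. gap V f \<sigma>)"
proof -
  let ?I = "{\<sigma>. \<sigma> \<subseteq> V \<and> v \<in> \<sigma>}"
  define A where "A \<sigma> = {Max (insert 0 (f ` (V - \<sigma>)))..<Min (f ` \<sigma>)}" for \<sigma>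
  have memA: "t \<in> A \<sigma> \<longleftrightarrow> 0 \<le> t \<and> \<sigma> = {w \<in> V. t < f w}" if "\<sigma> \<in> ?I" for \<sigma> t
  proof -
    have fs: "finite \<sigma>" "\<sigma> \<noteq> {}" using that assms finite_subset by auto
    have "t \<in> A \<sigma> \<longleftrightarrow> 0 \<le> t \<and> (\<forall>w\<in>V - \<sigma>. f w \<le> t) \<and> (\<forall>w\<in>\<sigma>. t < f w)"
      using fs assms(1) unfolding A_def atLeastLessThan_iff
      by (subst Max_le_iff, simp, simp, subst Min_gr_iff) auto
    also have "\<dots> \<longleftrightarrow> 0 \<le> t \<and> \<sigma> = {w \<in> V. t < f w}"
    proof -
      have "\<sigma> = {w \<in> V. t < f w}" if a: "\<forall>w\<in>V - \<sigma>. f w \<le> t" "\<forall>w\<in>\<sigma>. t < f w"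
      proof (intro equalityI subsetI)
        show "w \<in> \<sigma>" if "w \<in> {w \<in> V. t < f w}" for w using that a(1) by (force simp: not_le[symmetric])
        show "w \<in> {w \<in> V. t < f w}" if "w \<in> \<sigma>" for w using that a(2) \<open>\<sigma> \<in> ?I\<close> by auto
      qed
      then show ?thesis by (metis (no_types, lifting) DiffE mem_Collect_eq not_le)
    qed
    finally show ?thesis .
  qed
  have fI: "finite ?I" using assms(1) by simp
  \<comment> \<open>Each level \<open>t\<close> in this interval has exactly one superlevel set, and
    that set contains \<open>v\<close>; so the intervals \<open>A \<sigma>\<close> form a partition
    and their lengths add up.\<close>
  have "{0..<f v} = (\<Union>\<sigma>\<in>?I. A \<sigma>)"
  proof (intro equalityI subsetI)
    fix t assume t: "t \<in> {0..<f v}"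
    have "{w \<in> V. t < f w} \<in> ?I" using t assms by auto
    then show "t \<in> (\<Union>\<sigma>\<in>?I. A \<sigma>)" using t memA[of "{w \<in> V. t < f w}" t] by (intro UN_I) auto
  next
    fix t assume "t \<in> (\<Union>\<sigma>\<in>?I. A \<sigma>)"
    then obtain \<sigma> where s: "\<sigma> \<in> ?I" "t \<in> A \<sigma>" by blast
    then have "0 \<le> t" "\<sigma> = {w \<in> V. t < f w}" using memA by auto
    then show "t \<in> {0..<f v}" using s by auto
  qed
  moreover have "measure lborel (\<Union>\<sigma>\<in>?I. A \<sigma>) = (\<Sum>\<sigma>\<in>?I. measure lborel (A \<sigma>))"
  proof (rule measure_finite_Union[OF fI])
    show "disjoint_family_on A ?I"
      unfolding disjoint_family_on_def
    proof (intro ballI impI equals0I)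
      fix \<sigma> \<tau> t assume st: "\<sigma> \<in> ?I" "\<tau> \<in> ?I" "\<sigma> \<noteq> \<tau>" and t: "t \<in> A \<sigma> \<inter> A \<tau>"
      have "\<sigma> = {w \<in> V. t < f w}" using memA[OF st(1), of t] t by simp
      moreover have "\<tau> = {w \<in> V. t < f w}" using memA[OF st(2), of t] t by simp
      ultimately show False using st(3) by simp
    qed
    show "emeasure lborel (A \<sigma>) \<noteq> \<infinity>" for \<sigma>
      unfolding A_def by (cases "Max (insert 0 (f ` (V - \<sigma>))) \<le> Min (f ` \<sigma>)") auto
  qed (auto simp: A_def)
  moreover have "measure lborel (A \<sigma>) = gap V f \<sigma>" for \<sigma>
    unfolding A_def gap_def by (cases "Max (insert 0 (f ` (V - \<sigma>))) \<le> Min (f ` \<sigma>)") auto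
  moreover have "measure lborel {0..<f v} = f v" using assms by simp
  ultimately show ?thesis by simp
qed

lemma chain_top:
  assumes "finite C" "C \<noteq> {}" "\<And>\<sigma> \<tau>. \<sigma> \<in> C \<Longrightarrow> \<tau> \<in> C \<Longrightarrow> \<sigma> \<subseteq> \<tau> \<or> \<tau> \<subseteq> \<sigma>"
  shows "\<Union>C \<in> C" "\<Inter>C \<in> C"
proof -
  obtain \<tau> where t: "\<tau> \<in> C" "\<And>\<sigma>. \<sigma> \<in> C \<Longrightarrow> \<tau> \<subseteq> \<sigma> \<Longrightarrow> \<tau> = \<sigma>"
    using finite_has_maximal[OF assms(1,2)] by auto
  then have "\<Union>C = \<tau>" using assms(3) by blast
  then show "\<Union>C \<in> C" using t by simp
  obtain \<tau> where t: "\<tau> \<in> C" "\<And>\<sigma>. \<sigma> \<in> C \<Longrightarrow> \<sigma> \<subseteq> \<tau> \<Longrightarrow> \<tau> = \<sigma>"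
    using finite_has_minimal[OF assms(1,2)] by auto
  then have "\<Inter>C = \<tau>" using assms(3) by blast
  then show "\<Inter>C \<in> C" using t by simp
qed

text \<open>The converse of \<open>layer_cake\<close>: a positive combination of indicators of a
  chain has the members of the chain as its superlevel sets, with the coefficients as lengths. It
  produces the point with prescribed coordinates in the subdivision.\<close>

lemma gap_chain:
  assumes V: "finite V" and C: "\<And>\<sigma>. \<sigma> \<in> C \<Longrightarrow> \<sigma> \<subseteq> V \<and> \<sigma> \<noteq> {}"
    and chain: "\<And>\<sigma> \<tau>. \<sigma> \<in> C \<Longrightarrow> \<tau> \<in> C \<Longrightarrow> \<sigma> \<subseteq> \<tau> \<or> \<tau> \<subseteq> \<sigma>"
    and c: "\<And>\<sigma>. \<sigma> \<in> C \<Longrightarrow> 0 < (c \<sigma> :: real)"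
    and a: "\<And>v. v \<in> V \<Longrightarrow> a v = (\<Sum>\<tau> | \<tau> \<in> C \<and> v \<in> \<tau>. c \<tau>)"
    and s: "\<sigma> \<subseteq> V" "\<sigma> \<noteq> {}"
  shows "gap V a \<sigma> = (if \<sigma> \<in> C then c \<sigma> else 0)"
proof -
  have "C \<subseteq> Pow V" using C by blast
  then have finC: "finite C" using V finite_subset finite_Pow_iff by metis
  have fs: "finite \<sigma>" using s V finite_subset by blast
  have mono: "sum c A \<le> sum c B" if "A \<subseteq> B" "B \<subseteq> C" for A B
  proof (rule sum_mono2)
    show "finite B" using that(2) finC finite_subset by blast
    show "0 \<le> c x" if "x \<in> B - A" for x using c[of x] that \<open>B \<subseteq> C\<close> by fastforce
  qed (rule that(1))
  \<comment> \<open>The members not containing \<sigma> have a largest one, and it misses some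
    \<open>v\<close> in \<sigma>. At this \<open>v\<close> only members containing all of \<sigma>
    contribute.\<close>
  have new: "\<exists>v\<in>\<sigma>. \<forall>\<tau>\<in>C. v \<in> \<tau> \<longrightarrow> \<sigma> \<subseteq> \<tau>" if "\<sigma> \<noteq> {}" "\<And>\<tau>. \<tau> \<in> C \<Longrightarrow> \<sigma> \<subseteq> \<tau> \<or> \<tau> \<subseteq> \<sigma> \<or> \<sigma> \<inter> \<tau> \<noteq> \<sigma>" for \<sigma>
  proof (cases "{\<tau> \<in> C. \<not> \<sigma> \<subseteq> \<tau>} = {}")
    case True
    then show ?thesis using that by blast
  next
    case False
    have "\<Union>{\<tau> \<in> C. \<not> \<sigma> \<subseteq> \<tau>} \<in> {\<tau> \<in> C. \<not> \<sigma> \<subseteq> \<tau>}"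
    proof (rule chain_top(1)[OF _ False])
      show "finite {\<tau> \<in> C. \<not> \<sigma> \<subseteq> \<tau>}" using finC by simp
    qed (use chain in blast)
    then show ?thesis by blast
  qed
  show ?thesis
  proof (cases "\<sigma> \<in> C")
    case True
    define A where "A = (\<Sum>\<tau> | \<tau> \<in> C \<and> \<sigma> \<subseteq> \<tau>. c \<tau>)"
    obtain v where v: "v \<in> \<sigma>" "\<And>\<tau>. \<tau> \<in> C \<Longrightarrow> v \<in> \<tau> \<Longrightarrow> \<sigma> \<subseteq> \<tau>" using new[OF s(2)] by blast
    have "{\<tau>. \<tau> \<in> C \<and> v \<in> \<tau>} = {\<tau>. \<tau> \<in> C \<and> \<sigma> \<subseteq> \<tau>}" using v by blast
    then have "a v = A" using a[of v] v(1) s(1) unfolding A_def by auto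
    moreover have "A \<le> a w" if "w \<in> \<sigma>" for w
    proof -
      have "w \<in> V" using that s by auto
      then show ?thesis unfolding A_def using that a[of w] mono[of "{\<tau>. \<tau> \<in> C \<and> \<sigma> \<subseteq> \<tau>}" "{\<tau>. \<tau> \<in> C \<and> w \<in> \<tau>}"]
        by auto
    qed
    ultimately have lo: "Min (a ` \<sigma>) = A"
      using fs v(1) by (intro Min_eqI) auto
    have A': "A = c \<sigma> + (\<Sum>\<tau> | \<tau> \<in> C \<and> \<sigma> \<subset> \<tau>. c \<tau>)"
    proof -
      have "{\<tau>. \<tau> \<in> C \<and> \<sigma> \<subseteq> \<tau>} = insert \<sigma> {\<tau>. \<tau> \<in> C \<and> \<sigma> \<subset> \<tau>}" using True by auto
      then show ?thesis unfolding A_def using finC by simp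
    qed
    have B0: "0 \<le> (\<Sum>\<tau> | \<tau> \<in> C \<and> \<sigma> \<subset> \<tau>. c \<tau>)"
      by (rule sum_nonneg) (use c in \<open>auto intro: less_imp_le\<close>)
    have le: "a w \<le> (\<Sum>\<tau> | \<tau> \<in> C \<and> \<sigma> \<subset> \<tau>. c \<tau>)" if "w \<in> V - \<sigma>" for w
    proof -
      have "{\<tau>. \<tau> \<in> C \<and> w \<in> \<tau>} \<subseteq> {\<tau>. \<tau> \<in> C \<and> \<sigma> \<subset> \<tau>}"
        using chain[OF True] that by blast
      from mono[OF this] show ?thesis using that a[of w] by auto
    qed
    \<comment> \<open>A vertex outside \<sigma> of the smallest strict superset of \<sigma> in
      \<open>C\<close> lies in exactly the strict supersets and attains the maximum; if there is no
      such superset, the inserted 0 does.\<close>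
    have hi: "Max (insert 0 (a ` (V - \<sigma>))) = (\<Sum>\<tau> | \<tau> \<in> C \<and> \<sigma> \<subset> \<tau>. c \<tau>)"
    proof (rule Max_eqI)
      show "(\<Sum>\<tau> | \<tau> \<in> C \<and> \<sigma> \<subset> \<tau>. c \<tau>) \<in> insert 0 (a ` (V - \<sigma>))"
      proof (cases "{\<tau> \<in> C. \<sigma> \<subset> \<tau>} = {}")
        case True
        then show ?thesis by (metis (lifting) insertI1 sum.empty)
      next
        case False
        have "\<Inter>{\<tau> \<in> C. \<sigma> \<subset> \<tau>} \<in> {\<tau> \<in> C. \<sigma> \<subset> \<tau>}"
        proof (rule chain_top(2)[OF _ False])
          show "finite {\<tau> \<in> C. \<sigma> \<subset> \<tau>}" using finC by simp
        qed (use chain in blast)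
        then obtain \<rho> where r: "\<rho> \<in> C" "\<sigma> \<subset> \<rho>" "\<And>\<tau>. \<tau> \<in> C \<Longrightarrow> \<sigma> \<subset> \<tau> \<Longrightarrow> \<rho> \<subseteq> \<tau>"
          by (metis (mono_tags, lifting) Inter_lower mem_Collect_eq)
        then obtain w where w: "w \<notin> \<sigma>" "w \<in> \<rho>" by blast
        then have w2: "w \<in> \<tau>" if "\<tau> \<in> C" "\<sigma> \<subset> \<tau>" for \<tau> using r(3)[OF that] by blast
        have wV: "w \<in> V - \<sigma>" using w r(1) C[OF r(1)] by blast
        have "{\<tau>. \<tau> \<in> C \<and> \<sigma> \<subset> \<tau>} = {\<tau>. \<tau> \<in> C \<and> w \<in> \<tau>}"
          using w(1) w2 chain[OF \<open>\<sigma> \<in> C\<close>] by blast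
        then have "(\<Sum>\<tau> | \<tau> \<in> C \<and> \<sigma> \<subset> \<tau>. c \<tau>) = a w" using a[of w] wV by simp
        then show ?thesis using wV by blast
      qed
    qed (use V B0 le in auto)
    show ?thesis
      unfolding gap_def lo hi A' using True c[OF True] by simp
  next
    case False
    have "\<not> 0 < gap V a \<sigma>"
    proof
      assume "0 < gap V a \<sigma>"
      then have g: "\<And>v. v \<in> \<sigma> \<Longrightarrow> 0 < a v" "\<And>v w. v \<in> \<sigma> \<Longrightarrow> w \<in> V - \<sigma> \<Longrightarrow> a w < a v"
        using gap_pos_iff[OF V s] by auto
      have "C \<noteq> {}" using g(1) a s by fastforce
      then have top: "\<Union>C \<in> C" using chain_top(1)[OF finC _ chain] by simp
      have "v \<in> \<Union>C" if "v \<in> \<sigma>" for v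
      proof (rule ccontr)
        assume "v \<notin> \<Union>C"
        then have "{\<tau>. \<tau> \<in> C \<and> v \<in> \<tau>} = {}" by blast
        moreover have "v \<in> V" using that s(1) by blast
        ultimately have "a v = 0" using a[of v] by (metis (no_types, lifting) sum.empty)
        then show False using g(1)[OF that] by simp
      qed
      then have ne: "{\<tau> \<in> C. \<sigma> \<subseteq> \<tau>} \<noteq> {}" using top by blast
      have "\<Inter>{\<tau> \<in> C. \<sigma> \<subseteq> \<tau>} \<in> {\<tau> \<in> C. \<sigma> \<subseteq> \<tau>}"
      proof (rule chain_top(2)[OF _ ne])
        show "finite {\<tau> \<in> C. \<sigma> \<subseteq> \<tau>}" using finC by simp
      qed (use chain in blast)
      then obtain \<tau> where t: "\<tau> \<in> C" "\<sigma> \<subseteq> \<tau>" "\<And>\<rho>. \<rho> \<in> C \<Longrightarrow> \<sigma> \<subseteq> \<rho> \<Longrightarrow> \<tau> \<subseteq> \<rho>"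
        by (metis (mono_tags, lifting) Inter_lower mem_Collect_eq)
      \<comment> \<open>Every member containing the vertex \<open>v\<close> chosen next contains
        \<sigma>, hence \<tau>, hence \<open>w\<close>. So \<open>a v \<le> a w\<close> although
        \<open>w\<close> is outside \<sigma>, against the positive gap.\<close>
      obtain w where w: "w \<in> \<tau>" "w \<notin> \<sigma>" using t(1,2) False by (metis subsetI subset_antisym)
      obtain v where v: "v \<in> \<sigma>" "\<And>\<rho>. \<rho> \<in> C \<Longrightarrow> v \<in> \<rho> \<Longrightarrow> \<sigma> \<subseteq> \<rho>" using new[OF s(2)] by blast
      have wV: "w \<in> V" "v \<in> V" using C t w v s by auto
      have "{\<rho>. \<rho> \<in> C \<and> v \<in> \<rho>} \<subseteq> {\<rho>. \<rho> \<in> C \<and> w \<in> \<rho>}" using v t w by blast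
      from mono[OF this] have "a v \<le> a w" using a[OF wV(1)] a[OF wV(2)] by auto
      then show False using g(2)[OF v(1)] w wV by fastforce
    qed
    then show ?thesis using False gap_nonneg[of V a \<sigma>] by simp
  qed
qed

lemma continuous_on_Min_image:
  assumes "finite I" "I \<noteq> {}" "\<And>i. i \<in> I \<Longrightarrow> continuous_on X (g i)"
  shows "continuous_on X (\<lambda>x. Min ((\<lambda>i. g i x) ` I) :: real)"
  using assms
proof (induction I rule: finite_ne_induct)
  case (insert i I)
  then have "Min ((\<lambda>i. g i x) ` insert i I) = min (g i x) (Min ((\<lambda>i. g i x) ` I))" for x
    by simp
  then show ?case using insert by (auto intro!: continuous_on_min)
qed auto

lemma continuous_on_Max_image:
  assumes "finite I" "\<And>i. i \<in> I \<Longrightarrow> continuous_on X (g i)"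
  shows "continuous_on X (\<lambda>x. Max (insert 0 ((\<lambda>i. g i x) ` I)) :: real)"
  using assms
proof (induction I rule: finite_induct)
  case (insert i I)
  have "insert 0 ((\<lambda>i. g i x) ` insert i I) = insert (g i x) (insert 0 ((\<lambda>i. g i x) ` I))" for x
    by auto
  then have "Max (insert 0 ((\<lambda>i. g i x) ` insert i I)) = max (g i x) (Max (insert 0 ((\<lambda>i. g i x) ` I)))" for x
    using insert.hyps(1) Max_insert[of "insert 0 ((\<lambda>i. g i x) ` I)" "g i x"] by simp
  then show ?case using insert by (auto intro!: continuous_on_max)
qed auto

lemma continuous_on_gap:
  assumes "finite V" "\<sigma> \<subseteq> V" "\<sigma> \<noteq> {}" "\<And>v. v \<in> V \<Longrightarrow> continuous_on X (b v)"
  shows "continuous_on X (\<lambda>x. gap V (\<lambda>v. b v x) \<sigma>)"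
  unfolding gap_def
  by (intro continuous_on_max continuous_on_diff continuous_on_const continuous_on_Min_image
        continuous_on_Max_image) (use assms finite_subset in auto)

section \<open>Barycentric subdivision\<close>

text \<open>A triangulated space, with each vertex represented by its open star and \<open>b\<close> giving barycentric
  coordinates; the complex itself is the nerve of the set of stars. This encoding lets all the
  subdivisions of all the triangulations of \<open>X\<close> share one vertex type.\<close>

locale tri =
  fixes X :: "'x::topological_space set" and V :: "'x set set" and b :: "'x set \<Rightarrow> 'x \<Rightarrow> real"
  assumes fin: "finite V" and ne: "{} \<notin> V"
    and vtx: "\<And>v. v \<in> V \<Longrightarrow> v = {x \<in> X. 0 < b v x}"
    and nonneg: "\<And>v x. v \<in> V \<Longrightarrow> x \<in> X \<Longrightarrow> 0 \<le> b v x"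
    and sum1: "\<And>x. x \<in> X \<Longrightarrow> (\<Sum>v\<in>V. b v x) = 1"
    and realize: "\<And>u. (\<And>v. v \<in> V \<Longrightarrow> 0 \<le> u v) \<Longrightarrow> sum u V = 1 \<Longrightarrow> {v \<in> V. 0 < u v} \<in> nerve V
        \<Longrightarrow> \<exists>x\<in>X. \<forall>v\<in>V. b v x = u v"
    and cont: "\<And>v. v \<in> V \<Longrightarrow> continuous_on X (b v)"
begin

lemma mem_vtx: "v \<in> V \<Longrightarrow> x \<in> v \<longleftrightarrow> x \<in> X \<and> 0 < b v x"
  using vtx by blast

section \<open>Supports, maximal coordinates and barycentres\<close>

lemma nerve_iff: "\<sigma> \<in> nerve V \<longleftrightarrow> \<sigma> \<subseteq> V \<and> \<sigma> \<noteq> {} \<and> (\<exists>x\<in>X. \<forall>v\<in>\<sigma>. 0 < b v x)"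
proof
  assume s: "\<sigma> \<in> nerve V"
  then obtain x where x: "\<sigma> \<subseteq> V" "\<sigma> \<noteq> {}" "\<And>v. v \<in> \<sigma> \<Longrightarrow> x \<in> v" by (auto simp: nerve_def)
  then show "\<sigma> \<subseteq> V \<and> \<sigma> \<noteq> {} \<and> (\<exists>x\<in>X. \<forall>v\<in>\<sigma>. 0 < b v x)" using mem_vtx by blast
next
  assume "\<sigma> \<subseteq> V \<and> \<sigma> \<noteq> {} \<and> (\<exists>x\<in>X. \<forall>v\<in>\<sigma>. 0 < b v x)"
  then obtain x where x: "\<sigma> \<subseteq> V" "\<sigma> \<noteq> {}" "x \<in> X" "\<And>v. v \<in> \<sigma> \<Longrightarrow> 0 < b v x" by blast
  then have "x \<in> \<Inter>\<sigma>" using mem_vtx by blast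
  then show "\<sigma> \<in> nerve V" using x fin finite_subset unfolding nerve_def by blast
qed

lemma nerveD: "\<sigma> \<in> nerve V \<Longrightarrow> finite \<sigma> \<and> \<sigma> \<subseteq> V \<and> \<sigma> \<noteq> {}"
  by (auto simp: nerve_def)

lemma vertex_in_nerve: "v \<in> V \<Longrightarrow> {v} \<in> nerve V"
  using ne by (auto simp: nerve_def)

lemma supp_in_nerve:
  assumes "x \<in> X" shows "{v \<in> V. 0 < b v x} \<in> nerve V"
proof -
  have "{v \<in> V. 0 < b v x} \<noteq> {}"
  proof
    assume "{v \<in> V. 0 < b v x} = {}"
    then have "b v x = 0" if "v \<in> V" for v using nonneg[OF that assms] that by fastforce
    then show False using sum1[OF assms] by simp
  qed
  then show ?thesis using assms by (auto simp: nerve_iff)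
qed

lemma max_pos:
  assumes "x \<in> X" "v \<in> V" "\<And>w. w \<in> V \<Longrightarrow> b w x \<le> b v x"
  shows "0 < b v x"
  using supp_in_nerve[OF assms(1)] assms nerveD by fastforce

lemma barycentre:
  assumes "\<sigma> \<in> nerve V"
  obtains y where "y \<in> X" "\<And>v. v \<in> V \<Longrightarrow> b v y = (if v \<in> \<sigma> then 1 / card \<sigma> else 0)"
proof -
  have s: "finite \<sigma>" "\<sigma> \<subseteq> V" "\<sigma> \<noteq> {}" using nerveD[OF assms] by auto
  let ?u = "\<lambda>v. if v \<in> \<sigma> then 1 / card \<sigma> else (0::real)"
  have "sum ?u V = (\<Sum>v\<in>\<sigma>. 1 / card \<sigma>)"
    using s fin by (subst sum.inter_restrict[symmetric]) (auto simp: Int_absorb1)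
  then have "sum ?u V = 1" using s by simp
  moreover have "{v \<in> V. 0 < ?u v} = \<sigma>" using s by (auto simp: card_gt_0_iff)
  ultimately have "\<exists>x\<in>X. \<forall>v\<in>V. b v x = ?u v"
    using assms by (intro realize) auto
  then show thesis using that by blast
qed

text \<open>\<open>st \<sigma>\<close> is the open star, in the barycentric subdivision, of the barycentre of \<open>\<sigma>\<close>.\<close>

definition st :: "'x set set \<Rightarrow> 'x set" where
  "st \<sigma> = {x \<in> X. \<forall>v\<in>\<sigma>. 0 < b v x \<and> (\<forall>w\<in>V - \<sigma>. b w x < b v x)}"

text \<open>The closed star of \<open>v\<close> in the barycentric subdivision. These cells mediate
  between the stars of a triangulation and those of its subdivision.\<close>

definition top_cell :: "'x set \<Rightarrow> 'x set" where
  "top_cell v = {x \<in> X. \<forall>w\<in>V. b w x \<le> b v x}"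

definition sdV :: "'x set set" where
  "sdV = st ` nerve V"

definition carrier_of :: "'x set \<Rightarrow> 'x set set" where
  "carrier_of = inv_into (nerve V) st"

text \<open>At the barycentre of \<sigma> the gap is \<open>1 / card \<sigma>\<close>; the factor
  normalises this to coordinate 1.\<close>

definition sdb :: "'x set \<Rightarrow> 'x \<Rightarrow> real" where
  "sdb s x = card (carrier_of s) * gap V (\<lambda>v. b v x) (carrier_of s)"

lemma st_comparable:
  assumes "x \<in> st \<sigma>" "x \<in> st \<tau>" "\<sigma> \<subseteq> V" "\<tau> \<subseteq> V"
  shows "\<sigma> \<subseteq> \<tau> \<or> \<tau> \<subseteq> \<sigma>"
proof (rule ccontr)
  assume "\<not> (\<sigma> \<subseteq> \<tau> \<or> \<tau> \<subseteq> \<sigma>)"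
  then obtain v w where "v \<in> \<sigma>" "v \<notin> \<tau>" "w \<in> \<tau>" "w \<notin> \<sigma>" by blast
  then have "b w x < b v x" "b v x < b w x" using assms by (auto simp: st_def)
  then show False by simp
qed

lemma barycentre_st:
  assumes "\<sigma> \<in> nerve V" "y \<in> X" "\<And>v. v \<in> V \<Longrightarrow> b v y = (if v \<in> \<sigma> then 1 / card \<sigma> else 0)"
  shows "y \<in> st \<sigma>"
  using nerveD[OF assms(1)] assms(2,3) by (auto simp: st_def card_gt_0_iff subset_iff)

text \<open>The barycentre of \<sigma> determines \<sigma>: if it lies in \<open>st \<tau>\<close>,
  positivity gives one inclusion, and equality of all its nonzero coordinates excludes a strict drop
  outside \<tau>.\<close>

lemma st_inj: "inj_on st (nerve V)"
proof (rule inj_onI)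
  have sub: "\<tau> = \<sigma>" if s: "\<sigma> \<in> nerve V" and t: "\<tau> \<in> nerve V" and e: "st \<sigma> = st \<tau>" for \<sigma> \<tau>
  proof -
    obtain y where y: "y \<in> X" "\<And>v. v \<in> V \<Longrightarrow> b v y = (if v \<in> \<sigma> then 1 / card \<sigma> else 0)"
      using barycentre[OF s] by blast
    have yt: "y \<in> st \<tau>" using barycentre_st[OF s y] e by simp
    have tV: "\<tau> \<subseteq> V" "\<tau> \<noteq> {}" "\<sigma> \<subseteq> V" using nerveD t s by auto
    have 1: "\<tau> \<subseteq> \<sigma>"
    proof
      fix v assume "v \<in> \<tau>"
      then have "0 < b v y" "v \<in> V" using yt tV by (auto simp: st_def)
      then show "v \<in> \<sigma>" using y(2)[of v] by (auto split: if_splits)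
    qed
    have "\<sigma> \<subseteq> \<tau>"
    proof
      fix w assume w: "w \<in> \<sigma>"
      show "w \<in> \<tau>"
      proof (rule ccontr)
        assume "w \<notin> \<tau>"
        obtain v where v: "v \<in> \<tau>" using tV by blast
        then have "b w y < b v y" using yt w \<open>w \<notin> \<tau>\<close> tV by (auto simp: st_def)
        moreover have "b w y = b v y" 
        proof -
          have "v \<in> V" "w \<in> V" "v \<in> \<sigma>" using 1 v w tV by blast+
          then show ?thesis using y(2)[of v] y(2)[of w] w by simp
        qed
        ultimately show False by simp
      qed
    qed
    with 1 show ?thesis by blast
  qed
  show "\<sigma> = \<tau>" if "\<sigma> \<in> nerve V" "\<tau> \<in> nerve V" "st \<sigma> = st \<tau>" for \<sigma> \<tau>
    using sub[OF that] by simp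
qed

lemma carrier_of_st: "\<sigma> \<in> nerve V \<Longrightarrow> carrier_of (st \<sigma>) = \<sigma>"
  unfolding carrier_of_def by (rule inv_into_f_f[OF st_inj])

lemma sum_sdV: "(\<Sum>s\<in>sdV. h s) = (\<Sum>\<sigma>\<in>nerve V. h (st \<sigma>))"
  unfolding sdV_def using st_inj by (rule sum.reindex_cong) auto

lemma gap_pos_st:
  assumes "\<sigma> \<in> nerve V" "x \<in> X"
  shows "0 < gap V (\<lambda>v. b v x) \<sigma> \<longleftrightarrow> x \<in> st \<sigma>"
  using gap_pos_iff[OF fin, of \<sigma> "\<lambda>v. b v x"] nerveD[OF assms(1)] assms(2) by (simp add: st_def)

text \<open>A superlevel set with positive gap consists of vertices with positive coordinate at
  \<open>x\<close>, so it is a simplex; the other subsets in \<open>layer_cake\<close> contribute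
  0.\<close>

lemma coordinate_layers:
  assumes "x \<in> X" "v \<in> V"
  shows "b v x = (\<Sum>\<sigma> | \<sigma> \<in> nerve V \<and> v \<in> \<sigma>. gap V (\<lambda>v. b v x) \<sigma>)"
proof -
  have "b v x = (\<Sum>\<sigma> | \<sigma> \<subseteq> V \<and> v \<in> \<sigma>. gap V (\<lambda>v. b v x) \<sigma>)"
    using layer_cake[OF fin assms(2), of "\<lambda>v. b v x"] nonneg assms by simp
  also have "\<dots> = (\<Sum>\<sigma> | \<sigma> \<in> nerve V \<and> v \<in> \<sigma>. gap V (\<lambda>v. b v x) \<sigma>)"
  proof (rule sum.mono_neutral_right)
    show "finite {\<sigma>. \<sigma> \<subseteq> V \<and> v \<in> \<sigma>}" using fin by simp
    show "{\<sigma>. \<sigma> \<in> nerve V \<and> v \<in> \<sigma>} \<subseteq> {\<sigma>. \<sigma> \<subseteq> V \<and> v \<in> \<sigma>}" using nerveD by blast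
    show "\<forall>\<sigma>\<in>{\<sigma>. \<sigma> \<subseteq> V \<and> v \<in> \<sigma>} - {\<sigma>. \<sigma> \<in> nerve V \<and> v \<in> \<sigma>}. gap V (\<lambda>v. b v x) \<sigma> = 0"
    proof
      fix \<sigma> assume "\<sigma> \<in> {\<sigma>. \<sigma> \<subseteq> V \<and> v \<in> \<sigma>} - {\<sigma>. \<sigma> \<in> nerve V \<and> v \<in> \<sigma>}"
      then have s: "\<sigma> \<subseteq> V" "\<sigma> \<noteq> {}" "\<sigma> \<notin> nerve V" by auto
      have "\<not> 0 < gap V (\<lambda>v. b v x) \<sigma>"
      proof
        assume "0 < gap V (\<lambda>v. b v x) \<sigma>"
        then have "\<forall>v\<in>\<sigma>. 0 < b v x" using gap_pos_iff[OF fin s(1,2), of "\<lambda>v. b v x"] by simp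
        then have "\<sigma> \<in> nerve V" using s assms(1) by (auto simp: nerve_iff)
        then show False using s(3) by simp
      qed
      then show "gap V (\<lambda>v. b v x) \<sigma> = 0" using gap_nonneg[of V "\<lambda>v. b v x" \<sigma>] by simp
    qed
  qed
  finally show ?thesis .
qed

text \<open>Insert the layers and exchange the sums: an affine function takes at each new vertex the
  mean of its old values. For the constant 1 this says that the new coordinates sum to 1; for an
  embedding it feeds the mesh estimate.\<close>

lemma affine_sd:
  fixes F :: "'x set \<Rightarrow> 'c::real_vector"
  assumes "x \<in> X"
  shows "(\<Sum>v\<in>V. b v x *\<^sub>R F v) =
    (\<Sum>s\<in>sdV. sdb s x *\<^sub>R ((1 / card (carrier_of s)) *\<^sub>R (\<Sum>v\<in>carrier_of s. F v)))"
proof -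
  let ?g = "gap V (\<lambda>v. b v x)"
  have "(\<Sum>v\<in>V. b v x *\<^sub>R F v) = (\<Sum>v\<in>V. \<Sum>\<sigma> | \<sigma> \<in> nerve V \<and> v \<in> \<sigma>. ?g \<sigma> *\<^sub>R F v)"
  proof (rule sum.cong)
    fix v assume "v \<in> V"
    show "b v x *\<^sub>R F v = (\<Sum>\<sigma> | \<sigma> \<in> nerve V \<and> v \<in> \<sigma>. ?g \<sigma> *\<^sub>R F v)"
      by (subst coordinate_layers[OF assms \<open>v \<in> V\<close>]) (simp add: scaleR_left.sum)
  qed simp
  also have "\<dots> = (\<Sum>\<sigma>\<in>nerve V. \<Sum>v | v \<in> V \<and> v \<in> \<sigma>. ?g \<sigma> *\<^sub>R F v)"
    using fin asc_finite[OF asc_nerve[OF fin]] by (rule sum.swap_restrict)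
  also have "\<dots> = (\<Sum>\<sigma>\<in>nerve V. sdb (st \<sigma>) x *\<^sub>R ((1 / card \<sigma>) *\<^sub>R (\<Sum>v\<in>\<sigma>. F v)))"
  proof (rule sum.cong)
    fix \<sigma> assume s: "\<sigma> \<in> nerve V"
    then have "{v. v \<in> V \<and> v \<in> \<sigma>} = \<sigma>" "card \<sigma> \<noteq> 0" using nerveD[OF s] by auto
    then show "(\<Sum>v | v \<in> V \<and> v \<in> \<sigma>. ?g \<sigma> *\<^sub>R F v) = sdb (st \<sigma>) x *\<^sub>R ((1 / card \<sigma>) *\<^sub>R (\<Sum>v\<in>\<sigma>. F v))"
      by (simp add: sdb_def carrier_of_st[OF s] scaleR_right.sum)
  qed simp
  also have "\<dots> = (\<Sum>s\<in>sdV. sdb s x *\<^sub>R ((1 / card (carrier_of s)) *\<^sub>R (\<Sum>v\<in>carrier_of s. F v)))"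
    by (simp add: sum_sdV carrier_of_st)
  finally show ?thesis .
qed

text \<open>At a common point of the stars all the simplices involved are superlevel sets of the
  same coordinates, so they form a flag.\<close>

lemma nerve_sdV:
  assumes "\<Gamma> \<in> nerve sdV"
  obtains C where "\<Gamma> = st ` C" "C \<subseteq> nerve V" "C \<noteq> {}" "finite C"
    "\<And>\<sigma> \<tau>. \<sigma> \<in> C \<Longrightarrow> \<tau> \<in> C \<Longrightarrow> \<sigma> \<subseteq> \<tau> \<or> \<tau> \<subseteq> \<sigma>"
proof -
  have G: "\<Gamma> \<subseteq> st ` nerve V" "\<Gamma> \<noteq> {}" "finite \<Gamma>" "\<Inter>\<Gamma> \<noteq> {}" using assms by (auto simp: nerve_def sdV_def)
  then obtain C where C: "C \<subseteq> nerve V" "\<Gamma> = st ` C" by (metis subset_imageE)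
  obtain x where "x \<in> \<Inter>\<Gamma>" using G(4) by blast
  then have x: "x \<in> st \<sigma>" if "\<sigma> \<in> C" for \<sigma> using C(2) that by blast
  have "finite C" using C(1) asc_finite[OF asc_nerve[OF fin]] finite_subset by blast
  moreover have "\<sigma> \<subseteq> \<tau> \<or> \<tau> \<subseteq> \<sigma>" if "\<sigma> \<in> C" "\<tau> \<in> C" for \<sigma> \<tau>
    using that C(1) nerveD by (intro st_comparable[OF x x]) auto
  ultimately show thesis using that[of C] C G by blast
qed

text \<open>The substance is the realisation of prescribed coordinates. Their support is a flag, and
  \<open>gap_chain\<close> recovers them from the point built by spreading each weight over the
  vertices of its simplex.\<close>

lemma tri_sd: "tri X sdV sdb"
proof
  have finN: "finite (nerve V)" using asc_finite[OF asc_nerve[OF fin]] .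
  show "finite sdV" unfolding sdV_def using finN by simp
  show "{} \<notin> sdV"
  proof
    assume "{} \<in> sdV"
    then obtain \<sigma> where s: "\<sigma> \<in> nerve V" "st \<sigma> = {}" by (auto simp: sdV_def)
    then show False using barycentre[OF s(1)] barycentre_st[OF s(1)] by (metis empty_iff)
  qed
  show "s = {x \<in> X. 0 < sdb s x}" if "s \<in> sdV" for s
  proof -
    obtain \<sigma> where s: "\<sigma> \<in> nerve V" "s = st \<sigma>" using \<open>s \<in> sdV\<close> by (auto simp: sdV_def)
    have "0 < card \<sigma>" using nerveD[OF s(1)] by (simp add: card_gt_0_iff)
    then have "0 < sdb s x \<longleftrightarrow> x \<in> st \<sigma>" if "x \<in> X" for x
      using gap_pos_st[OF s(1) that] by (simp add: sdb_def s carrier_of_st zero_less_mult_iff)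
    moreover have "st \<sigma> \<subseteq> X" by (auto simp: st_def)
    ultimately show ?thesis unfolding s(2) by blast
  qed
  show "0 \<le> sdb s x" for s x by (simp add: sdb_def gap_nonneg)
  show "(\<Sum>s\<in>sdV. sdb s x) = 1" if "x \<in> X" for x
  proof -
    have "(\<Sum>v\<in>V. b v x *\<^sub>R (1::real)) = (\<Sum>s\<in>sdV. sdb s x *\<^sub>R ((1 / card (carrier_of s)) *\<^sub>R (\<Sum>v\<in>carrier_of s. 1)))"
      by (rule affine_sd[OF that])
    also have "\<dots> = (\<Sum>s\<in>sdV. sdb s x)"
    proof (rule sum.cong)
      fix s assume "s \<in> sdV"
      then obtain \<sigma> where s: "\<sigma> \<in> nerve V" "s = st \<sigma>" by (auto simp: sdV_def)
      then show "sdb s x *\<^sub>R ((1 / card (carrier_of s)) *\<^sub>R (\<Sum>v\<in>carrier_of s. 1)) = sdb s x"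
        using nerveD[OF s(1)] by (simp add: carrier_of_st)
    qed simp
    finally show ?thesis using sum1[OF that] by simp
  qed
  show "continuous_on X (sdb s)" if "s \<in> sdV" for s
  proof -
    obtain \<sigma> where s: "\<sigma> \<in> nerve V" "s = st \<sigma>" using \<open>s \<in> sdV\<close> by (auto simp: sdV_def)
    have "continuous_on X (\<lambda>x. gap V (\<lambda>v. b v x) \<sigma>)"
      using nerveD[OF s(1)] fin cont by (intro continuous_on_gap) auto
    then show ?thesis unfolding sdb_def s carrier_of_st[OF s(1)] by (intro continuous_intros)
  qed
  fix u :: "'x set \<Rightarrow> real"
  assume u0: "\<And>v. v \<in> sdV \<Longrightarrow> 0 \<le> u v" and u1: "sum u sdV = 1" and un: "{v \<in> sdV. 0 < u v} \<in> nerve sdV"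
  obtain C where C: "{v \<in> sdV. 0 < u v} = st ` C" "C \<subseteq> nerve V" "C \<noteq> {}" "finite C"
    and chain: "\<And>\<sigma> \<tau>. \<sigma> \<in> C \<Longrightarrow> \<tau> \<in> C \<Longrightarrow> \<sigma> \<subseteq> \<tau> \<or> \<tau> \<subseteq> \<sigma>"
    using nerve_sdV[OF un] by blast
  have uC: "0 < u (st \<sigma>) \<longleftrightarrow> \<sigma> \<in> C" if "\<sigma> \<in> nerve V" for \<sigma>
  proof -
    have "st \<sigma> \<in> sdV" using that by (simp add: sdV_def)
    then have "0 < u (st \<sigma>) \<longleftrightarrow> st \<sigma> \<in> st ` C" using C(1) by blast
    also have "\<dots> \<longleftrightarrow> \<sigma> \<in> C" using inj_on_image_mem_iff[OF st_inj that C(2)] .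
    finally show ?thesis .
  qed
  have u00: "u (st \<sigma>) = 0" if "\<sigma> \<in> nerve V" "\<sigma> \<notin> C" for \<sigma>
    using uC[OF that(1)] that u0[of "st \<sigma>"] by (force simp: sdV_def)
  \<comment> \<open>The weight at the barycentre of \<sigma> is divided evenly among the vertices of
    \<sigma>; \<open>a\<close> gives the resulting coordinates in the original
    triangulation.\<close>
  define c where "c \<sigma> = u (st \<sigma>) / card \<sigma>" for \<sigma>
  define a where "a v = (\<Sum>\<tau> | \<tau> \<in> C \<and> v \<in> \<tau>. c \<tau>)" for v
  have cs: "0 < card \<sigma>" "\<sigma> \<subseteq> V" "\<sigma> \<noteq> {}" if "\<sigma> \<in> C" for \<sigma>
    using nerveD[of \<sigma>] C(2) that by (auto simp: card_gt_0_iff)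
  have cpos: "0 < c \<sigma>" if "\<sigma> \<in> C" for \<sigma>
    unfolding c_def using cs[OF that] uC[of \<sigma>] that C(2) by auto
  have "\<exists>x\<in>X. \<forall>v\<in>V. b v x = a v"
  proof (rule realize)
    show "0 \<le> a v" for v unfolding a_def by (rule sum_nonneg) (use cpos in \<open>auto intro: less_imp_le\<close>)
    have "sum a V = (\<Sum>\<tau>\<in>C. \<Sum>v | v \<in> V \<and> v \<in> \<tau>. c \<tau>)"
      unfolding a_def using fin C(4) by (rule sum.swap_restrict)
    also have "\<dots> = (\<Sum>\<tau>\<in>C. u (st \<tau>))"
    proof (rule sum.cong)
      fix \<tau> assume t: "\<tau> \<in> C"
      then have "{v. v \<in> V \<and> v \<in> \<tau>} = \<tau>" using cs by auto
      then show "(\<Sum>v | v \<in> V \<and> v \<in> \<tau>. c \<tau>) = u (st \<tau>)" using cs[OF t] by (simp add: c_def)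
    qed simp
    also have "\<dots> = (\<Sum>\<tau>\<in>nerve V. u (st \<tau>))"
      using C(2) finN u00 by (intro sum.mono_neutral_left) auto
    also have "\<dots> = 1" using u1 by (simp add: sum_sdV)
    finally show "sum a V = 1" .
    have top: "\<Union>C \<in> C" using chain_top(1)[OF C(4,3) chain] .
    \<comment> \<open>The support of \<open>a\<close> is the largest member of the flag, hence a
      simplex, so the original triangulation realises \<open>a\<close>.\<close>
    have "{v \<in> V. 0 < a v} = \<Union>C"
    proof (intro equalityI subsetI)
      fix v assume "v \<in> {v \<in> V. 0 < a v}"
      then have "a v \<noteq> 0" by simp
      then have "{\<tau>. \<tau> \<in> C \<and> v \<in> \<tau>} \<noteq> {}" unfolding a_def by (metis sum.empty)
      then show "v \<in> \<Union>C" by blast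
    next
      fix v assume v: "v \<in> \<Union>C"
      then have "0 < a v" unfolding a_def using C(4) cpos by (intro sum_pos) auto
      then show "v \<in> {v \<in> V. 0 < a v}" using v cs by blast
    qed
    then show "{v \<in> V. 0 < a v} \<in> nerve V" using top C(2) by auto
  qed
  then obtain x where x: "x \<in> X" "\<And>v. v \<in> V \<Longrightarrow> b v x = a v" by blast
  have "sdb s x = u s" if "s \<in> sdV" for s
  proof -
    obtain \<sigma> where s: "\<sigma> \<in> nerve V" "s = st \<sigma>" using \<open>s \<in> sdV\<close> by (auto simp: sdV_def)
    have sV: "\<sigma> \<subseteq> V" "\<sigma> \<noteq> {}" "0 < card \<sigma>" using nerveD[OF s(1)] by (auto simp: card_gt_0_iff)
    have "gap V (\<lambda>v. b v x) \<sigma> = (if \<sigma> \<in> C then c \<sigma> else 0)"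
      by (rule gap_chain[OF fin _ chain cpos]) (use cs sV x in \<open>auto simp: a_def\<close>)
    then show ?thesis using u00[OF s(1)] sV by (auto simp: sdb_def s carrier_of_st c_def)
  qed
  then show "\<exists>x\<in>X. \<forall>v\<in>sdV. sdb v x = u v" using x(1) by blast
qed

text \<open>A flag has at most one member of each cardinality, so one bound on the dimension serves
  all iterated subdivisions.\<close>

lemma card_nerve_sd:
  assumes "\<And>\<sigma>. \<sigma> \<in> nerve V \<Longrightarrow> card \<sigma> \<le> N" "\<Gamma> \<in> nerve sdV"
  shows "card \<Gamma> \<le> N"
proof -
  obtain C where C: "\<Gamma> = st ` C" "C \<subseteq> nerve V" "finite C"
    and chain: "\<And>\<sigma> \<tau>. \<sigma> \<in> C \<Longrightarrow> \<tau> \<in> C \<Longrightarrow> \<sigma> \<subseteq> \<tau> \<or> \<tau> \<subseteq> \<sigma>"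
    using nerve_sdV[OF assms(2)] by blast
  have "inj_on card C"
  proof (rule inj_onI)
    fix \<sigma> \<tau> assume a: "\<sigma> \<in> C" "\<tau> \<in> C" "card \<sigma> = card \<tau>"
    then have "finite \<sigma>" "finite \<tau>" using C(2) nerveD by auto
    then show "\<sigma> = \<tau>" using chain[OF a(1,2)] a(3) card_subset_eq by metis
  qed
  then have "card C = card (card ` C)" by (simp add: card_image)
  also have "\<dots> \<le> card {1..N}"
  proof (rule card_mono)
    show "card ` C \<subseteq> {1..N}"
      using C(2) assms(1) nerveD by (force simp: Suc_le_eq card_gt_0_iff)
  qed simp
  finally have "card C \<le> N" by simp
  then show ?thesis using C card_image_le le_trans by blast
qed

text \<open>In the difference of \<open>F v\<close> and the mean over \<tau> the term of
  \<open>v\<close> itself cancels, whence the factor \<open>1 - 1 / card \<tau>\<close>. The mean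
  over a face of \<tau> is a convex combination of such vertices and obeys the same bound.\<close>

lemma mesh_sd:
  fixes F :: "'x set \<Rightarrow> 'c::real_normed_vector"
  assumes N: "\<And>\<sigma>. \<sigma> \<in> nerve V \<Longrightarrow> card \<sigma> \<le> N" and m: "0 \<le> m"
    and osc: "\<And>u v. u \<in> V \<Longrightarrow> v \<in> V \<Longrightarrow> u \<inter> v \<noteq> {} \<Longrightarrow> norm (F u - F v) \<le> m"
    and st: "s \<in> sdV" "t \<in> sdV" "s \<inter> t \<noteq> {}"
  defines "F' \<equiv> \<lambda>s. (1 / card (carrier_of s)) *\<^sub>R (\<Sum>v\<in>carrier_of s. F v)"
  shows "norm (F' s - F' t) \<le> (1 - 1 / N) * m"
proof -
  have main: "norm (F' (st \<sigma>) - F' (st \<tau>)) \<le> (1 - 1 / N) * m"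
    if s: "\<sigma> \<in> nerve V" and t: "\<tau> \<in> nerve V" and sub: "\<sigma> \<subseteq> \<tau>" for \<sigma> \<tau>
  proof -
    have f: "finite \<sigma>" "finite \<tau>" "\<sigma> \<noteq> {}" "\<tau> \<noteq> {}" using nerveD s t by auto
    have c: "real (card \<sigma>) > 0" "real (card \<tau>) > 0" using f by (auto simp: card_gt_0_iff)
    define A where "A = F' (st \<tau>)"
    have A: "A = (1 / card \<tau>) *\<^sub>R (\<Sum>w\<in>\<tau>. F w)" by (simp add: A_def F'_def carrier_of_st[OF t])
    have adj: "norm (F v - F w) \<le> m" if "v \<in> \<tau>" "w \<in> \<tau>" for v w
      using that t by (intro osc) (auto simp: nerve_def)
    have v: "norm (F v - A) \<le> (1 - 1 / N) * m" if v: "v \<in> \<tau>" for v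
    proof -
      have "F v - A = (1 / card \<tau>) *\<^sub>R (\<Sum>w\<in>\<tau>. F v - F w)"
        using c by (simp add: A sum_subtractf scaleR_diff_right sum_constant_scaleR)
      also have "(\<Sum>w\<in>\<tau>. F v - F w) = (\<Sum>w\<in>\<tau> - {v}. F v - F w)"
        using v f by (simp add: sum.remove)
      finally have "norm (F v - A) = (1 / card \<tau>) * norm (\<Sum>w\<in>\<tau> - {v}. F v - F w)" by simp
      also have "\<dots> \<le> (1 / card \<tau>) * (\<Sum>w\<in>\<tau> - {v}. m)"
        by (intro mult_left_mono sum_norm_le adj) (use v in auto)
      also have "\<dots> = (1 - 1 / card \<tau>) * m"
        using v f c by (simp add: card_Diff_singleton of_nat_diff Suc_le_eq card_gt_0_iff field_simps)
      also have "\<dots> \<le> (1 - 1 / N) * m"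
      proof (intro mult_right_mono m diff_left_mono)
        show "1 / real N \<le> 1 / real (card \<tau>)" using N[OF t] c by (intro divide_left_mono) auto
      qed
      finally show ?thesis .
    qed
    have "F' (st \<sigma>) - A = (1 / card \<sigma>) *\<^sub>R (\<Sum>v\<in>\<sigma>. F v - A)"
      using c by (simp add: F'_def carrier_of_st[OF s] sum_subtractf scaleR_diff_right sum_constant_scaleR)
    then have "norm (F' (st \<sigma>) - A) = (1 / card \<sigma>) * norm (\<Sum>v\<in>\<sigma>. F v - A)" by simp
    also have "\<dots> \<le> (1 / card \<sigma>) * (\<Sum>v\<in>\<sigma>. (1 - 1 / N) * m)"
      by (intro mult_left_mono sum_norm_le v) (use sub in auto)
    also have "\<dots> = (1 - 1 / N) * m" using c by simp
    finally show ?thesis by (simp add: A_def)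
  qed
  obtain \<sigma> \<tau> where s: "\<sigma> \<in> nerve V" "s = st \<sigma>" and t: "\<tau> \<in> nerve V" "t = st \<tau>"
    using st by (auto simp: sdV_def)
  obtain x where "x \<in> st \<sigma>" "x \<in> st \<tau>" using st s t by auto
  then have "\<sigma> \<subseteq> \<tau> \<or> \<tau> \<subseteq> \<sigma>" using st_comparable nerveD s t by blast
  then show ?thesis
    using main[OF s(1) t(1)] main[OF t(1) s(1)] s t by (auto simp: norm_minus_commute)
qed

text \<open>The difference is a convex combination of vectors \<open>F w - F v\<close>, and only
  those \<open>w\<close> whose star contains \<open>x\<close> have a nonzero coefficient.\<close>

lemma vertex_mesh:
  fixes F :: "'x set \<Rightarrow> 'c::real_normed_vector"
  assumes osc: "\<And>u v. u \<in> V \<Longrightarrow> v \<in> V \<Longrightarrow> u \<inter> v \<noteq> {} \<Longrightarrow> norm (F u - F v) \<le> m"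
    and v: "v \<in> V" "x \<in> v"
  shows "norm ((\<Sum>w\<in>V. b w x *\<^sub>R F w) - F v) \<le> m"
proof -
  have x: "x \<in> X" using mem_vtx v by blast
  have "(\<Sum>w\<in>V. b w x *\<^sub>R F w) - F v = (\<Sum>w\<in>V. b w x *\<^sub>R (F w - F v))"
    by (simp add: scaleR_diff_right sum_subtractf sum1[OF x] flip: scaleR_left.sum)
  also have "norm \<dots> \<le> (\<Sum>w\<in>V. b w x * m)"
  proof (rule sum_norm_le)
    fix w assume w: "w \<in> V"
    show "norm (b w x *\<^sub>R (F w - F v)) \<le> b w x * m"
    proof (cases "b w x = 0")
      case False
      then have "x \<in> w" using mem_vtx[OF w, of x] nonneg[OF w x] x by simp
      then have "norm (F w - F v) \<le> m" using osc[OF w v(1)] v(2) by blast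
      then show ?thesis using nonneg[OF w x] by (simp add: mult_left_mono)
    qed simp
  qed
  also have "\<dots> = m" by (simp add: sum1[OF x] flip: sum_distrib_right)
  finally show ?thesis .
qed

end

section \<open>Subdivision and the extension property\<close>

lemma sd_refines:
  assumes "tri X V b" "s \<in> tri.sdV X V b"
  shows "\<exists>v\<in>V. s \<subseteq> v"
proof -
  interpret tri X V b by fact
  obtain \<sigma> where s: "\<sigma> \<in> nerve V" "s = st \<sigma>" using assms(2) by (auto simp: sdV_def)
  obtain v where v: "v \<in> \<sigma>" "v \<in> V" using nerveD[OF s(1)] by blast
  have "st \<sigma> \<subseteq> v" using v mem_vtx[OF v(2)] by (auto simp: st_def)
  then show ?thesis using s v by blast
qed

context finite_crossed_module
begin

text \<open>An old set containing one of the new ones can be added to a family without changing its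
  intersection.\<close>

lemma nerve_EP_refine:
  assumes "finite F" "finite F'" "\<And>s. s \<in> F' \<Longrightarrow> \<exists>t\<in>F. s \<subseteq> t" "inj_on s ((F \<union> F') \<times> UNIV)"
  shows "EP s (nerve F) (nerve (F \<union> F'))"
proof (rule nerve_EP)
  fix \<beta> assume b: "\<beta> \<subseteq> F' - F" "\<beta> \<noteq> {}"
  then obtain w where w: "w \<in> \<beta>" by blast
  then obtain t where t: "t \<in> F" "w \<subseteq> t" using assms(3)[of w] b by blast
  have "\<Inter>(insert t (\<alpha> \<union> \<beta>)) = \<Inter>(\<alpha> \<union> \<beta>)" for \<alpha> using t w by blast
  then show "\<exists>t\<in>F. \<forall>\<alpha>\<subseteq>F. \<Inter>(\<alpha> \<union> \<beta>) \<noteq> {} \<longrightarrow> \<Inter>(insert t (\<alpha> \<union> \<beta>)) \<noteq> {}"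
    using t(1) by metis
qed (use assms in auto)

text \<open>Let \<sigma> collect the vertices whose cells belong to \<beta>. A common point moves
  towards the barycentre of \<sigma> into \<open>st \<sigma>\<close> without leaving the cells and
  stars around it, so \<open>st \<sigma>\<close> dominates. If \<sigma> is not a simplex, the cells
  have no common point and any star will do.\<close>

lemma sd_EP_top:
  assumes tri: "tri X V b" and inj: "inj_on s ((tri.sdV X V b \<union> tri.top_cell X V b ` V) \<times> UNIV)"
  shows "EP s (nerve (tri.sdV X V b)) (nerve (tri.sdV X V b \<union> tri.top_cell X V b ` V))"
proof -
  interpret tri X V b by (rule tri)
  interpret sd: tri X sdV sdb by (rule tri_sd)
  show ?thesis
  proof (rule nerve_EP)
    fix \<beta> assume b: "\<beta> \<subseteq> top_cell ` V - sdV" "\<beta> \<noteq> {}"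
    define \<sigma> where "\<sigma> = {v \<in> V. top_cell v \<in> \<beta>}"
    have \<beta>\<sigma>: "\<beta> = top_cell ` \<sigma>"
    proof (intro equalityI subsetI)
      fix c assume c: "c \<in> \<beta>"
      then obtain v where "v \<in> V" "c = top_cell v" using b(1) by (metis DiffD1 imageE subsetD)
      then show "c \<in> top_cell ` \<sigma>" using c by (auto simp: \<sigma>_def)
    qed (auto simp: \<sigma>_def)
    have "\<sigma> \<noteq> {}" using b(2) \<beta>\<sigma> by (metis image_empty)
    moreover have "\<sigma> \<subseteq> V" by (auto simp: \<sigma>_def)
    ultimately have sV: "\<sigma> \<subseteq> V" "\<sigma> \<noteq> {}" by auto
    have pos: "0 < b v x" "x \<in> X" if "x \<in> \<Inter>\<beta>" "v \<in> \<sigma>" for x v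
    proof -
      have "x \<in> top_cell v" using that \<beta>\<sigma> by blast
      then have x: "x \<in> X" "\<And>w. w \<in> V \<Longrightarrow> b w x \<le> b v x" by (auto simp: top_cell_def)
      show "0 < b v x" using max_pos[OF x(1) _ x(2)] that sV by blast
      show "x \<in> X" by (rule x)
    qed
    show "\<exists>t\<in>sdV. \<forall>\<alpha>\<subseteq>sdV. \<Inter>(\<alpha> \<union> \<beta>) \<noteq> {} \<longrightarrow> \<Inter>(insert t (\<alpha> \<union> \<beta>)) \<noteq> {}"
    proof (cases "\<sigma> \<in> nerve V")
      case False
      have "\<Inter>\<beta> = {}"
      proof (rule equals0I)
        fix x assume x: "x \<in> \<Inter>\<beta>"
        then have "\<sigma> \<in> nerve V" unfolding nerve_iff using sV pos[OF x] by blast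
        then show False using False by simp
      qed
      then have "\<Inter>(\<alpha> \<union> \<beta>) = {}" for \<alpha> by blast
      moreover obtain v where "v \<in> V" using sV by blast
      then have "st {v} \<in> sdV" using vertex_in_nerve by (auto simp: sdV_def)
      ultimately show ?thesis by blast
    next
      case True
      have cs: "0 < card \<sigma>" using nerveD[OF True] by (simp add: card_gt_0_iff)
      have "\<Inter>(insert (st \<sigma>) (\<alpha> \<union> \<beta>)) \<noteq> {}" if a: "\<alpha> \<subseteq> sdV" and ne: "\<Inter>(\<alpha> \<union> \<beta>) \<noteq> {}" for \<alpha>
      proof -
        obtain x where x: "x \<in> \<Inter>\<alpha>" "x \<in> \<Inter>\<beta>" using ne by blast
        have xX: "x \<in> X" using pos(2)[OF x(2)] sV by blast
        have top: "b w x \<le> b v x" if "v \<in> \<sigma>" "w \<in> V" for v w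
          using x(2) that unfolding \<beta>\<sigma> by (auto simp: top_cell_def)
        \<comment> \<open>Halfway from \<open>x\<close> to the barycentre of \<sigma>. The vertices
          of \<sigma>, already maximal at \<open>x\<close>, all gain the same amount and the support
          is unchanged.\<close>
        define u where "u v = b v x / 2 + (if v \<in> \<sigma> then 1 / (2 * real (card \<sigma>)) else 0)" for v
        have u_ge: "b v x / 2 \<le> u v" for v by (simp add: u_def)
        have u_in: "u v = b v x / 2 + 1 / (2 * real (card \<sigma>))" if "v \<in> \<sigma>" for v using that by (simp add: u_def)
        have u_out: "u v = b v x / 2" if "v \<notin> \<sigma>" for v using that by (simp add: u_def)
        have "\<exists>y\<in>X. \<forall>v\<in>V. b v y = u v"
        proof (rule realize)
          show "0 \<le> u v" if "v \<in> V" for v using nonneg[OF that xX] by (simp add: u_def)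
          have "(\<Sum>v\<in>V. if v \<in> \<sigma> then 1 / (2 * real (card \<sigma>)) else 0) = (\<Sum>v\<in>\<sigma>. 1 / (2 * real (card \<sigma>)))"
            using sV fin by (subst sum.inter_restrict[symmetric]) (auto simp: Int_absorb1)
          also have "\<dots> = 1 / 2" using cs by simp
          finally show "sum u V = 1"
            unfolding u_def using sum1[OF xX] by (simp add: sum.distrib flip: sum_divide_distrib)
          have "0 < u v \<longleftrightarrow> 0 < b v x" if "v \<in> V" for v
            using pos(1)[OF x(2), of v] nonneg[OF that xX] cs by (auto simp: u_def intro: add_pos_pos)
          then have "{v \<in> V. 0 < u v} = {v \<in> V. 0 < b v x}" by blast
          then show "{v \<in> V. 0 < u v} \<in> nerve V" using supp_in_nerve[OF xX] by simp
        qed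
        then obtain y where y: "y \<in> X" "\<And>v. v \<in> V \<Longrightarrow> b v y = u v" by blast
        have "y \<in> st \<sigma>"
          unfolding st_def
        proof (intro CollectI conjI ballI y(1))
          fix v assume v: "v \<in> \<sigma>"
          then have vV: "v \<in> V" using sV by blast
          show "0 < b v y" using pos(1)[OF x(2) v] u_ge[of v] y(2)[OF vV] by simp
          fix w assume w: "w \<in> V - \<sigma>"
          have "0 < 1 / (2 * real (card \<sigma>))" using cs by simp
          moreover have "b w x \<le> b v x" "b w y = b w x / 2" using top[OF v, of w] w y(2)[of w] u_out[of w] by auto
          ultimately show "b w y < b v y" using y(2)[OF vV] u_in[OF v] by linarith
        qed
        moreover have "y \<in> top_cell v" if v: "v \<in> \<sigma>" for v
          unfolding top_cell_def
        proof (intro CollectI conjI ballI y(1))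
          fix w assume w: "w \<in> V"
          have vV: "v \<in> V" using sV v by blast
          have "0 < 1 / (2 * real (card \<sigma>))" using cs by simp
          moreover have "u w = b w x / 2 + 1 / (2 * real (card \<sigma>)) \<or> u w = b w x / 2"
            using u_in[of w] u_out[of w] by blast
          ultimately show "b w y \<le> b v y"
            using top[OF v w] y(2)[OF vV] y(2)[OF w] u_in[OF v] by linarith
        qed
        moreover have "y \<in> s" if s: "s \<in> \<alpha>" for s
        proof -
          obtain \<tau> where t: "\<tau> \<in> nerve V" "s = st \<tau>" using s a by (auto simp: sdV_def)
          have xt: "x \<in> st \<tau>" using x(1) s t by blast
          have tV: "\<tau> \<subseteq> V" "\<tau> \<noteq> {}" using nerveD[OF t(1)] by auto
          \<comment> \<open>At \<open>x\<close> the vertices of \<sigma> have maximal coordinates,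
            whereas vertices outside \<tau> lie strictly below those of \<tau>.\<close>
          have sub: "\<sigma> \<subseteq> \<tau>"
          proof (rule ccontr)
            assume "\<not> \<sigma> \<subseteq> \<tau>"
            then obtain v where v: "v \<in> \<sigma>" "v \<notin> \<tau>" by blast
            obtain z where z: "z \<in> \<tau>" using tV by blast
            have "b v x < b z x" using xt v z sV by (auto simp: st_def)
            then show False using top[OF v(1), of z] z tV by auto
          qed
          have "y \<in> st \<tau>"
            unfolding st_def
          proof (intro CollectI conjI ballI y(1))
            fix z assume z: "z \<in> \<tau>"
            then have zV: "z \<in> V" using tV by blast
            have zx: "0 < b z x" using xt z by (auto simp: st_def)
            show "0 < b z y" using zx u_ge[of z] y(2)[OF zV] by simp
            fix w assume w: "w \<in> V - \<tau>"
            have "b w x < b z x" using xt z w by (auto simp: st_def)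
            moreover have "w \<notin> \<sigma>" "w \<in> V" using w sub by auto
            ultimately show "b w y < b z y" using u_out[of w] u_ge[of z] y(2)[OF zV] y(2)[of w] by simp
          qed
          then show ?thesis using t by simp
        qed
        ultimately have "y \<in> \<Inter>(insert (st \<sigma>) (\<alpha> \<union> \<beta>))" unfolding \<beta>\<sigma> by blast
        then show ?thesis by blast
      qed
      moreover have "st \<sigma> \<in> sdV" using True by (simp add: sdV_def)
      ultimately show ?thesis by blast
    qed
  qed (use fin sd.fin inj in auto)
qed

text \<open>Stars with a common point form a flag; let \<rho> be its smallest member. Averaging the
  coordinates over \<rho> moves a common point into the cells of all vertices of \<rho> while it
  stays in the given stars and cells, so each of these cells dominates \<beta>.\<close>

lemma top_EP_sd:
  assumes tri: "tri X V b" and inj: "inj_on s ((tri.top_cell X V b ` V \<union> tri.sdV X V b) \<times> UNIV)"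
  shows "EP s (nerve (tri.top_cell X V b ` V)) (nerve (tri.top_cell X V b ` V \<union> tri.sdV X V b))"
proof -
  interpret tri X V b by (rule tri)
  interpret sd: tri X sdV sdb by (rule tri_sd)
  show ?thesis
  proof (rule nerve_EP)
    fix \<beta> assume b: "\<beta> \<subseteq> sdV - top_cell ` V" "\<beta> \<noteq> {}"
    show "\<exists>t\<in>top_cell ` V. \<forall>\<alpha>\<subseteq>top_cell ` V. \<Inter>(\<alpha> \<union> \<beta>) \<noteq> {} \<longrightarrow> \<Inter>(insert t (\<alpha> \<union> \<beta>)) \<noteq> {}"
    proof (cases "\<Inter>\<beta> = {}")
      case True
      then have e: "\<Inter>(\<alpha> \<union> \<beta>) = {}" for \<alpha> by blast
      obtain s where "s \<in> sdV" using b by blast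
      then obtain \<tau> where "\<tau> \<in> nerve V" by (auto simp: sdV_def)
      then obtain v where v: "v \<in> V" using nerveD by blast
      show ?thesis
      proof (intro bexI[OF _ imageI[OF v]] allI impI)
        fix \<alpha> assume "\<Inter>(\<alpha> \<union> \<beta>) \<noteq> {}"
        then show "\<Inter>(insert (top_cell v) (\<alpha> \<union> \<beta>)) \<noteq> {}" using e by metis
      qed
    next
      case False
      have "\<beta> \<subseteq> sdV" using b(1) by (metis Diff_subset subset_trans)
      moreover from this have "finite \<beta>" using sd.fin by (rule finite_subset)
      ultimately have \<beta>N: "\<beta> \<in> nerve sdV" using b(2) False unfolding nerve_def by simp
      obtain C where C: "\<beta> = st ` C" "C \<subseteq> nerve V" "C \<noteq> {}" "finite C"
        and chain: "\<And>\<sigma> \<tau>. \<sigma> \<in> C \<Longrightarrow> \<tau> \<in> C \<Longrightarrow> \<sigma> \<subseteq> \<tau> \<or> \<tau> \<subseteq> \<sigma>"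
        using nerve_sdV[OF \<beta>N] by blast
      define \<rho> where "\<rho> = \<Inter>C"
      have \<rho>C: "\<rho> \<in> C" unfolding \<rho>_def using chain_top(2)[OF C(4,3) chain] .
      have \<rho>N: "\<rho> \<subseteq> V" "\<rho> \<noteq> {}" "finite \<rho>" using nerveD[of \<rho>] C(2) \<rho>C by auto
      have cs: "0 < real (card \<rho>)" using \<rho>N by (simp add: card_gt_0_iff)
      obtain v where v: "v \<in> \<rho>" using \<rho>N by blast
      have "\<Inter>(insert (top_cell v) (\<alpha> \<union> \<beta>)) \<noteq> {}" if a: "\<alpha> \<subseteq> top_cell ` V" and ne: "\<Inter>(\<alpha> \<union> \<beta>) \<noteq> {}" for \<alpha>
      proof -
        obtain x where x: "x \<in> \<Inter>\<alpha>" "x \<in> \<Inter>\<beta>" using ne by blast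
        have xst: "x \<in> st \<tau>" if "\<tau> \<in> C" for \<tau> using x(2) that C(1) by blast
        have xX: "x \<in> X" using xst[OF \<rho>C] by (simp add: st_def)
        \<comment> \<open>A bound below all coordinates on \<rho> is also strictly below their mean,
          so strict inequalities survive the averaging.\<close>
        define M where "M = (\<Sum>z\<in>\<rho>. b z x) / card \<rho>"
        have M: "c < M" if "\<And>z. z \<in> \<rho> \<Longrightarrow> c < b z x" for c
        proof -
          have "(\<Sum>z\<in>\<rho>. c) < (\<Sum>z\<in>\<rho>. b z x)" using that \<rho>N by (intro sum_strict_mono) auto
          then show ?thesis using cs by (simp add: M_def field_simps)
        qed
        have pos: "0 < b z x" if "z \<in> \<rho>" for z using xst[OF \<rho>C] that by (auto simp: st_def)
        define u where "u z = (if z \<in> \<rho> then M else b z x)" for z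
        have "\<exists>y\<in>X. \<forall>v\<in>V. b v y = u v"
        proof (rule realize)
          show "0 \<le> u z" if "z \<in> V" for z using nonneg[OF that xX] M[OF pos] by (simp add: u_def less_imp_le)
          have "sum u V = sum u \<rho> + sum u (V - \<rho>)"
            using sum.subset_diff[OF \<rho>N(1) fin, of u] by simp
          also have "sum u \<rho> = (\<Sum>z\<in>\<rho>. b z x)" using cs by (simp add: u_def M_def)
          also have "sum u (V - \<rho>) = (\<Sum>z\<in>V - \<rho>. b z x)" by (rule sum.cong) (auto simp: u_def)
          also have "(\<Sum>z\<in>\<rho>. b z x) + (\<Sum>z\<in>V - \<rho>. b z x) = (\<Sum>z\<in>V. b z x)"
            using sum.subset_diff[OF \<rho>N(1) fin, of "\<lambda>z. b z x"] by simp
          finally show "sum u V = 1" using sum1[OF xX] by simp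
          have "0 < u z \<longleftrightarrow> 0 < b z x" for z using pos[of z] M[OF pos] by (simp add: u_def)
          then show "{z \<in> V. 0 < u z} \<in> nerve V" using supp_in_nerve[OF xX] by simp
        qed
        then obtain y where y: "y \<in> X" "\<And>v. v \<in> V \<Longrightarrow> b v y = u v" by blast
        have out: "b w x < b z x" if "z \<in> \<tau>" "w \<in> V - \<tau>" "\<tau> \<in> C" for w z \<tau>
          using xst[OF that(3)] that by (auto simp: st_def)
        have top: "y \<in> top_cell z" if z: "z \<in> \<rho>" for z
          unfolding top_cell_def
        proof (intro CollectI conjI ballI y(1))
          fix w assume w: "w \<in> V"
          have zV: "z \<in> V" using z \<rho>N by blast
          show "b w y \<le> b z y"
          proof (cases "w \<in> \<rho>")
            case True
            then show ?thesis using y(2)[OF w] y(2)[OF zV] z by (simp add: u_def)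
          next
            case False
            have "b w x < M" by (rule M) (use out \<rho>C w False in blast)
            then show ?thesis using y(2)[OF w] y(2)[OF zV] z False by (simp add: u_def)
          qed
        qed
        have "y \<in> st \<tau>" if t: "\<tau> \<in> C" for \<tau>
          unfolding st_def
        proof (intro CollectI conjI ballI y(1))
          have sub: "\<rho> \<subseteq> \<tau>" unfolding \<rho>_def using t by blast
          have tV: "\<tau> \<subseteq> V" using nerveD C(2) t by blast
          fix z assume z: "z \<in> \<tau>"
          have zV: "z \<in> V" using z tV by blast
          have "0 < b z x" using xst[OF t] z by (auto simp: st_def)
          then show "0 < b z y" using y(2)[OF zV] M[OF pos] by (simp add: u_def)
          fix w assume w: "w \<in> V - \<tau>"
          have "w \<notin> \<rho>" using w sub by blast
          moreover have "b w x < M" by (rule M) (use out[OF _ w t] sub in blast)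
          ultimately show "b w y < b z y" using out[OF z w t] y(2)[OF zV] y(2)[of w] w by (simp add: u_def)
        qed
        \<comment> \<open>A cell of \<alpha> through \<open>x\<close> belongs to a vertex of maximal
          coordinate at \<open>x\<close>. Such a vertex lies in \<rho>, since coordinates outside
          \<rho> are strictly smaller.\<close>
        moreover have "y \<in> c" if c: "c \<in> \<alpha>" for c
        proof -
          obtain z where z: "z \<in> V" "c = top_cell z" using c a by blast
          have "x \<in> top_cell z" using x(1) c z by blast
          then have "b v x \<le> b z x" using v \<rho>N by (auto simp: top_cell_def)
          then have "z \<in> \<rho>" using out[OF v _ \<rho>C, of z] z by fastforce
          then show ?thesis using top z by simp
        qed
        ultimately have "y \<in> \<Inter>(insert (top_cell v) (\<alpha> \<union> \<beta>))" using top[OF v] unfolding C(1) by blast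
        then show ?thesis by blast
      qed
      then show ?thesis using v \<rho>N by blast
    qed
  qed (use fin sd.fin inj in auto)
qed

text \<open>The vertices in \<beta> and those of the cells in \<alpha> are all positive at a common
  point, so they span a simplex. Its barycentre lies in the stars and in the cells of all its
  vertices, so any cell of a vertex in \<beta> dominates.\<close>

lemma top_EP_stars:
  assumes tri: "tri X V b" and inj: "inj_on s ((tri.top_cell X V b ` V \<union> V) \<times> UNIV)"
  shows "EP s (nerve (tri.top_cell X V b ` V)) (nerve (tri.top_cell X V b ` V \<union> V))"
proof -
  interpret tri X V b by (rule tri)
  show ?thesis
  proof (rule nerve_EP)
    fix \<beta> assume b: "\<beta> \<subseteq> V - top_cell ` V" "\<beta> \<noteq> {}"
    then obtain v where v: "v \<in> \<beta>" "v \<in> V" by blast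
    have "\<Inter>(insert (top_cell v) (\<alpha> \<union> \<beta>)) \<noteq> {}" if a: "\<alpha> \<subseteq> top_cell ` V" and ne: "\<Inter>(\<alpha> \<union> \<beta>) \<noteq> {}" for \<alpha>
    proof -
      obtain x where x: "x \<in> \<Inter>\<alpha>" "x \<in> \<Inter>\<beta>" using ne by blast
      have xX: "x \<in> X" using mem_vtx[OF v(2)] v(1) x(2) by blast
      define \<sigma> where "\<sigma> = \<beta> \<union> {w \<in> V. top_cell w \<in> \<alpha>}"
      have "\<forall>w\<in>\<sigma>. 0 < b w x"
      proof
        fix w assume "w \<in> \<sigma>"
        then consider "w \<in> \<beta>" | "w \<in> V" "top_cell w \<in> \<alpha>" by (auto simp: \<sigma>_def)
        then show "0 < b w x"
        proof cases
          case 1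
          then show ?thesis using mem_vtx[of w x] b x(2) by blast
        next
          case 2
          then have "x \<in> top_cell w" using x(1) by blast
          then show ?thesis using max_pos[OF xX 2(1)] by (simp add: top_cell_def)
        qed
      qed
      then have sN: "\<sigma> \<in> nerve V" unfolding nerve_iff using b xX v by (auto simp: \<sigma>_def)
      then have cs: "0 < real (card \<sigma>)" using nerveD[OF sN] by (simp add: card_gt_0_iff)
      obtain y where y: "y \<in> X" "\<And>v. v \<in> V \<Longrightarrow> b v y = (if v \<in> \<sigma> then 1 / card \<sigma> else 0)"
        using barycentre[OF sN] by blast
      have sV: "\<sigma> \<subseteq> V" using nerveD[OF sN] by blast
      have top: "y \<in> top_cell w" if "w \<in> \<sigma>" for w
        unfolding top_cell_def
      proof (intro CollectI conjI ballI y(1))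
        fix z assume "z \<in> V"
        then show "b z y \<le> b w y" using y(2)[of z] y(2)[of w] that sV cs by auto
      qed
      have "y \<in> w" if "w \<in> \<sigma>" for w
        using that sV y(2)[of w] y(1) cs mem_vtx[of w y] by auto
      moreover have "v \<in> \<sigma>" using v by (simp add: \<sigma>_def)
      moreover have "\<exists>w\<in>\<sigma>. c = top_cell w" if "c \<in> \<alpha>" for c
        using that a by (auto simp: \<sigma>_def)
      ultimately have "y \<in> \<Inter>(insert (top_cell v) (\<alpha> \<union> \<beta>))"
        using top by (auto simp: \<sigma>_def)
      then show ?thesis by blast
    qed
    then show "\<exists>t\<in>top_cell ` V. \<forall>\<alpha>\<subseteq>top_cell ` V. \<Inter>(\<alpha> \<union> \<beta>) \<noteq> {} \<longrightarrow> \<Inter>(insert t (\<alpha> \<union> \<beta>)) \<noteq> {}"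
      using v by blast
  qed (use fin inj in auto)
qed

text \<open>Domination cannot in general compare \<open>S\<close> and \<open>V\<close> directly: no
  single subdivided star need meet all those that an old star meets. The cells \<open>A\<close>
  compare well with both, and cancellation inside the nerve of all three families removes
  them.\<close>

lemma sd_EP:
  assumes tri: "tri X V b"
  defines "S \<equiv> tri.sdV X V b" and "A \<equiv> tri.top_cell X V b ` V"
  assumes inj: "inj_on s ((V \<union> S \<union> A) \<times> UNIV)"
  shows "EP s (nerve S) (nerve (S \<union> V))"
proof -
  interpret tri X V b by (rule tri)
  interpret sd: tri X sdV sdb by (rule tri_sd)
  have finS: "finite S" "finite A" using sd.fin fin by (auto simp: S_def A_def)
  have inj': "inj_on s (B \<times> UNIV)" if "B \<subseteq> V \<union> S \<union> A" for B
    using inj by (rule inj_on_subset) (use that in auto)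
  let ?D = "A \<union> V \<union> S"
  note ascs = asc_nerve
  have topsub: "\<exists>v\<in>V. c \<subseteq> v" if "c \<in> A" for c
  proof -
    obtain v where v: "v \<in> V" "c = top_cell v" using \<open>c \<in> A\<close> by (auto simp: A_def)
    have "top_cell v \<subseteq> v" using max_pos[OF _ v(1)] mem_vtx[OF v(1)] by (auto simp: top_cell_def)
    then show ?thesis using v by blast
  qed
  have injD: "inj_on s (\<Union>(nerve ?D) \<times> UNIV)"
    by (rule inj_on_subset[OF inj]) (auto simp: nerve_def)
  have 1: "EP s (nerve A) (nerve (A \<union> V))"
    unfolding A_def by (rule top_EP_stars[OF tri]) (rule inj', auto simp: A_def)
  have 2: "EP s (nerve (A \<union> V)) (nerve ?D)"
    using finS fin sd_refines[OF tri] by (intro nerve_EP_refine inj') (auto simp: S_def)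
  have 3: "EP s (nerve A) (nerve ?D)"
    using finS fin by (intro EP_trans[OF 1 2] asc_nerve nerve_mono) auto
  have 4: "EP s (nerve A) (nerve (A \<union> S))"
    unfolding A_def S_def by (rule top_EP_sd[OF tri]) (rule inj', auto simp: A_def S_def)
  have 5: "EP s (nerve (A \<union> S)) (nerve ?D)"
    using finS fin by (intro EP_right_cancel[OF 4 3] asc_nerve nerve_mono injD) auto
  have "EP s (nerve S) (nerve (S \<union> A))"
    unfolding A_def S_def by (rule sd_EP_top[OF tri]) (rule inj', auto simp: A_def S_def)
  then have 6: "EP s (nerve S) (nerve (A \<union> S))" by (simp add: Un_commute)
  have 7: "EP s (nerve S) (nerve ?D)"
    using finS fin by (intro EP_trans[OF 6 5] asc_nerve nerve_mono) auto
  have "EP s (nerve (S \<union> V)) (nerve ((S \<union> V) \<union> A))"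
    using finS fin topsub by (intro nerve_EP_refine inj') auto
  moreover have "(S \<union> V) \<union> A = ?D" by auto
  ultimately have 8: "EP s (nerve (S \<union> V)) (nerve ?D)" by simp
  \<comment> \<open>Two-out-of-six with its last two complexes equal: since both \<open>S\<close>
    and the union of \<open>S\<close> and \<open>V\<close> compare with \<open>?D\<close>, they
    compare with each other.\<close>
  show ?thesis
    using finS fin by (intro EP_2of6[OF 7 8] asc_nerve nerve_mono) auto
qed

end

section \<open>Comparing two triangulations of a space\<close>

lemma star_open:
  assumes "tri X V b" "v \<in> V"
  shows "openin (top_of_set X) v"
proof -
  interpret tri X V b by fact
  have "openin (top_of_set X) (X \<inter> b v -` {0<..})"
    using cont[OF assms(2)] by (intro continuous_openin_preimage_gen) auto
  moreover have "X \<inter> b v -` {0<..} = v" using mem_vtx[OF assms(2)] by auto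
  ultimately show ?thesis by simp
qed

lemma stars_cover:
  assumes "tri X V b" shows "X \<subseteq> \<Union>V"
proof
  interpret tri X V b by fact
  fix x assume x: "x \<in> X"
  obtain v where "v \<in> V" "0 < b v x" using supp_in_nerve[OF x] nerveD by blast
  then show "x \<in> \<Union>V" using mem_vtx x by blast
qed

context finite_crossed_module
begin

text \<open>\<open>E\<close> collects all sets used as vertices on the way, including the auxiliary
  cells, so that one ranking injective on \<open>E\<close> serves every intermediate comparison. The
  affine form of \<open>f\<close> persists with averaged values, and each step shrinks the mesh by
  \<open>1 - 1 / N\<close>.\<close>

lemma iterated_subdivision:
  fixes f :: "'x::topological_space \<Rightarrow> 'c::real_normed_vector" and n :: nat
  assumes tri: "tri X V b"
    and aff: "\<And>x. x \<in> X \<Longrightarrow> f x = (\<Sum>v\<in>V. b v x *\<^sub>R F v)"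
    and N: "\<And>\<sigma>. \<sigma> \<in> nerve V \<Longrightarrow> card \<sigma> \<le> N" "0 < N"
    and m: "0 \<le> m" "\<And>u v. u \<in> V \<Longrightarrow> v \<in> V \<Longrightarrow> u \<inter> v \<noteq> {} \<Longrightarrow> norm (F u - F v) \<le> m"
  shows "\<exists>V' b' F' E. tri X V' b' \<and> (\<forall>x\<in>X. f x = (\<Sum>v\<in>V'. b' v x *\<^sub>R F' v)) \<and>
     (\<forall>\<sigma>\<in>nerve V'. card \<sigma> \<le> N) \<and>
     (\<forall>u\<in>V'. \<forall>v\<in>V'. u \<inter> v \<noteq> {} \<longrightarrow> norm (F' u - F' v) \<le> (1 - 1 / N) ^ n * m) \<and>
     finite E \<and> V \<union> V' \<subseteq> E \<and> (\<forall>v'\<in>V'. \<exists>v\<in>V. v' \<subseteq> v) \<and>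
     (\<forall>s. inj_on s (E \<times> UNIV) \<longrightarrow> EP s (nerve V') (nerve (V' \<union> V)))"
proof (induction n)
  case 0
  have finV: "finite V" using tri by (simp add: tri_def)
  have "EP s (nerve V) (nerve (V \<union> V))" if "inj_on s (V \<times> UNIV)" for s
    using that finV by (intro nerve_EP_refine) auto
  then show ?case
    using tri aff N m finV by (intro exI[of _ V] exI[of _ b] exI[of _ F] exI[of _ V]) auto
next
  case (Suc n)
  then obtain B b' F' E where B: "tri X B b'" "\<And>x. x \<in> X \<Longrightarrow> f x = (\<Sum>v\<in>B. b' v x *\<^sub>R F' v)"
      "\<And>\<sigma>. \<sigma> \<in> nerve B \<Longrightarrow> card \<sigma> \<le> N"
      "\<And>u v. u \<in> B \<Longrightarrow> v \<in> B \<Longrightarrow> u \<inter> v \<noteq> {} \<Longrightarrow> norm (F' u - F' v) \<le> (1 - 1 / N) ^ n * m"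
      "finite E" "V \<union> B \<subseteq> E" "\<And>v'. v' \<in> B \<Longrightarrow> \<exists>v\<in>V. v' \<subseteq> v"
      "\<And>s. inj_on s (E \<times> UNIV) \<Longrightarrow> EP s (nerve B) (nerve (B \<union> V))"
    by auto
  interpret tri X B b' by (rule B(1))
  interpret sd: tri X sdV sdb by (rule tri_sd)
  have finV: "finite V" using tri by (simp add: tri_def)
  have N1: "0 \<le> 1 - 1 / real N" using N(2) by simp
  define F'' where "F'' s = (1 / card (carrier_of s)) *\<^sub>R (\<Sum>v\<in>carrier_of s. F' v)" for s
  define E' where "E' = E \<union> (B \<union> sdV \<union> top_cell ` B)"
  have ref: "\<exists>v\<in>B. s \<subseteq> v" if "s \<in> sdV" for s using sd_refines[OF B(1) that] .
  have refV: "\<exists>v\<in>V. s \<subseteq> v" if "s \<in> sdV" for s using ref[OF that] B(7) by (meson subset_trans)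
  have EPc: "EP s (nerve sdV) (nerve (sdV \<union> V))" if inj: "inj_on s (E' \<times> UNIV)" for s
  proof -
    have inj': "inj_on s (A \<times> UNIV)" if "A \<subseteq> E'" for A
      using inj by (rule inj_on_subset) (use that in auto)
    have sub: "V \<subseteq> E'" "B \<subseteq> E'" "sdV \<subseteq> E'" using B(6) by (auto simp: E'_def)
    have ref2: "\<exists>t\<in>B \<union> V. s \<subseteq> t" if "s \<in> sdV" for s using ref[OF that] by blast
    have ref3: "\<exists>t\<in>sdV \<union> V. s \<subseteq> t" if "s \<in> B" for s using B(7)[OF that] by blast
    \<comment> \<open>The comparison is assembled in the union of three covers: subdivision relates
      \<open>sdV\<close> to \<open>B\<close>, induction relates \<open>B\<close> to
      \<open>V\<close>, and refinement gives the other inclusions.\<close>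
    let ?D = "sdV \<union> B \<union> V"
    have injD: "inj_on s (\<Union>(nerve ?D) \<times> UNIV)"
      by (rule inj_on_subset[OF inj]) (use sub in \<open>auto simp: nerve_def\<close>)
    have 1: "EP s (nerve sdV) (nerve (sdV \<union> B))"
      by (rule sd_EP[OF B(1)]) (rule inj', auto simp: E'_def)
    have 2: "EP s (nerve B) (nerve (B \<union> V))"
      by (rule B(8), rule inj') (auto simp: E'_def)
    have "EP s (nerve (B \<union> V)) (nerve ((B \<union> V) \<union> sdV))"
      using sub by (intro nerve_EP_refine inj' ref2) (use fin finV sd.fin in auto)
    moreover have "(B \<union> V) \<union> sdV = ?D" by auto
    ultimately have 3: "EP s (nerve (B \<union> V)) (nerve ?D)" by simp
    have 4: "EP s (nerve B) (nerve ?D)"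
      using fin finV sd.fin by (intro EP_trans[OF 2 3] asc_nerve nerve_mono) auto
    have "EP s (nerve B) (nerve (B \<union> sdV))"
      using sub by (intro nerve_EP_refine inj') (use fin finV sd.fin ref in auto)
    then have 5: "EP s (nerve B) (nerve (sdV \<union> B))" by (simp add: Un_commute)
    have 6: "EP s (nerve (sdV \<union> B)) (nerve ?D)"
      using fin finV sd.fin by (intro EP_right_cancel[OF 5 4] asc_nerve nerve_mono injD) auto
    have 7: "EP s (nerve sdV) (nerve ?D)"
      using fin finV sd.fin by (intro EP_trans[OF 1 6] asc_nerve nerve_mono) auto
    have "EP s (nerve (sdV \<union> V)) (nerve ((sdV \<union> V) \<union> B))"
      using sub by (intro nerve_EP_refine inj' ref3) (use fin finV sd.fin in auto)
    moreover have "(sdV \<union> V) \<union> B = ?D" by auto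
    ultimately have 8: "EP s (nerve (sdV \<union> V)) (nerve ?D)" by simp
    show ?thesis
      using fin finV sd.fin by (intro EP_2of6[OF 7 8] asc_nerve nerve_mono) auto
  qed
  have aff': "f x = (\<Sum>v\<in>sdV. sdb v x *\<^sub>R F'' v)" if "x \<in> X" for x
    using affine_sd[OF that, of F'] B(2)[OF that] by (simp add: F''_def)
  have osc: "norm (F'' u - F'' v) \<le> (1 - 1 / N) ^ Suc n * m"
    if "u \<in> sdV" "v \<in> sdV" "u \<inter> v \<noteq> {}" for u v
  proof -
    have "norm (F'' u - F'' v) \<le> (1 - 1 / N) * ((1 - 1 / N) ^ n * m)"
      unfolding F''_def using N1 m(1) by (intro mesh_sd[OF B(3) _ B(4)] that) auto
    then show ?thesis by (simp add: mult.assoc)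
  qed
  have "finite E'" "V \<union> sdV \<subseteq> E'" using B(5,6) fin sd.fin by (auto simp: E'_def)
  moreover have "card \<sigma> \<le> N" if "\<sigma> \<in> nerve sdV" for \<sigma>
    using card_nerve_sd[OF B(3) that] .
  ultimately show ?case
    using tri_sd aff' osc refV EPc
    by (intro exI[of _ sdV] exI[of _ sdb] exI[of _ F''] exI[of _ E'] conjI ballI allI impI) auto
qed

text \<open>\<open>f\<close> carries the cover to a compact subset of a Euclidean space, where it
  has a Lebesgue number \<open>e\<close>. Once the mesh is small enough, any two points of a star
  have images less than \<open>e\<close> apart, so the star lies in one member of the cover.\<close>

lemma fine_subdivision:
  fixes f :: "'x::topological_space \<Rightarrow> 'c::euclidean_space"
  assumes tri: "tri X V b"
    and aff: "\<And>x. x \<in> X \<Longrightarrow> f x = (\<Sum>v\<in>V. b v x *\<^sub>R F v)"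
    and hom: "homeomorphism X Y f g" and Y: "compact Y"
    and op: "\<And>ob. ob \<in> \<O> \<Longrightarrow> openin (top_of_set X) ob" and cov: "X \<subseteq> \<Union>\<O>"
  obtains V' b' F' E where "tri X V' b'" "\<And>x. x \<in> X \<Longrightarrow> f x = (\<Sum>v\<in>V'. b' v x *\<^sub>R F' v)"
     "finite E" "V \<union> V' \<subseteq> E" "\<And>v'. v' \<in> V' \<Longrightarrow> \<exists>v\<in>V. v' \<subseteq> v" "\<And>v'. v' \<in> V' \<Longrightarrow> \<exists>ob\<in>\<O>. v' \<subseteq> ob"
     "\<And>s. inj_on s (E \<times> UNIV) \<Longrightarrow> EP s (nerve V') (nerve (V' \<union> V))"
proof -
  have finV: "finite V" using tri by (simp add: tri_def)
  have XY: "f ` X = Y" "inj_on f X" using hom by (auto simp: homeomorphism_def inj_on_def) metis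
  have "\<exists>G. open G \<and> f ` ob = Y \<inter> G" if "ob \<in> \<O>" for ob
    using homeomorphism_imp_open_map[OF hom op[OF that]] by (auto simp: openin_open)
  then obtain G where G: "\<And>ob. ob \<in> \<O> \<Longrightarrow> open (G ob)" "\<And>ob. ob \<in> \<O> \<Longrightarrow> f ` ob = Y \<inter> G ob" by metis
  have "Y \<subseteq> \<Union>(G ` \<O>)"
  proof
    fix y assume "y \<in> Y"
    then obtain x where x: "x \<in> X" "y = f x" using XY by blast
    then obtain ob' where "ob' \<in> \<O>" "x \<in> ob'" using cov by blast
    then show "y \<in> \<Union>(G ` \<O>)" using G(2)[of ob'] x by blast
  qed
  then obtain e where e: "0 < e" "\<And>y. y \<in> Y \<Longrightarrow> \<exists>H\<in>G ` \<O>. ball y e \<subseteq> H"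
    using Heine_Borel_lemma[OF Y, of "G ` \<O>"] G(1) by (metis imageE)
  \<comment> \<open>A bound on the size of simplices that subdivision preserves; \<open>Suc\<close>
    keeps it positive, so that \<open>1 - 1 / N\<close> is a nonnegative ratio below 1.\<close>
  define N where "N = Suc (card V)"
  have N: "card \<sigma> \<le> N" if "\<sigma> \<in> nerve V" for \<sigma>
  proof -
    have "card \<sigma> \<le> card V" using that finV by (intro card_mono) (auto simp: nerve_def)
    then show ?thesis by (simp add: N_def)
  qed
  \<comment> \<open>Any bound on the distances between adjacent vertices starts the estimate; the
    sum of all distances is a crude one.\<close>
  define m where "m = (\<Sum>u\<in>V. \<Sum>v\<in>V. norm (F u - F v))"
  have m0: "0 \<le> m" unfolding m_def by (intro sum_nonneg) auto
  have m: "norm (F u - F v) \<le> m" if "u \<in> V" "v \<in> V" for u v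
  proof -
    have "norm (F u - F v) \<le> (\<Sum>v\<in>V. norm (F u - F v))"
      using that finV by (intro member_le_sum) auto
    also have "\<dots> \<le> m"
      unfolding m_def using that finV by (intro member_le_sum[of u V "\<lambda>u. \<Sum>v\<in>V. norm (F u - F v)"]) (auto intro: sum_nonneg)
    finally show ?thesis .
  qed
  have "(\<lambda>n. (1 - 1 / real N) ^ n * m) \<longlonglongrightarrow> 0 * m"
    by (intro tendsto_mult tendsto_const LIMSEQ_realpow_zero) (auto simp: N_def field_simps)
  \<comment> \<open>Half of \<open>e\<close>, because two points of a star are compared through its
    vertex.\<close>
  then have "\<forall>\<^sub>F n in sequentially. (1 - 1 / real N) ^ n * m < e / 2"
    using e(1) by (intro order_tendstoD(2)[of _ "0 * m"]) auto
  then obtain n where n: "(1 - 1 / real N) ^ n * m < e / 2"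
    using eventually_happens trivial_limit_sequentially by blast
  obtain V' b' F' E where V': "tri X V' b'" "\<And>x. x \<in> X \<Longrightarrow> f x = (\<Sum>v\<in>V'. b' v x *\<^sub>R F' v)"
     "\<And>u v. u \<in> V' \<Longrightarrow> v \<in> V' \<Longrightarrow> u \<inter> v \<noteq> {} \<Longrightarrow> norm (F' u - F' v) \<le> (1 - 1 / N) ^ n * m"
     "finite E" "V \<union> V' \<subseteq> E" "\<And>v'. v' \<in> V' \<Longrightarrow> \<exists>v\<in>V. v' \<subseteq> v"
     "\<And>s. inj_on s (E \<times> UNIV) \<Longrightarrow> EP s (nerve V') (nerve (V' \<union> V))"
    using iterated_subdivision[of X V b f F N m n] tri aff N m0 m by (auto simp: N_def)
  interpret V': tri X V' b' by (rule V'(1))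
  have "\<exists>ob\<in>\<O>. v \<subseteq> ob" if v: "v \<in> V'" for v
  proof -
    obtain x0 where x0: "x0 \<in> v" using V'.ne v by (metis ex_in_conv)
    have vX: "v \<subseteq> X" using V'.mem_vtx[OF v] by blast
    have near: "norm (f x - F' v) < e / 2" if "x \<in> v" for x
    proof -
      have "norm ((\<Sum>w\<in>V'. b' w x *\<^sub>R F' w) - F' v) \<le> (1 - 1 / N) ^ n * m"
        by (rule V'.vertex_mesh[OF V'(3) v that])
      then show ?thesis using n V'(2)[of x] that vX by auto
    qed
    obtain ob' where ob': "ob' \<in> \<O>" "ball (f x0) e \<subseteq> G ob'" using e(2)[of "f x0"] x0 vX XY by blast
    have "v \<subseteq> ob'"
    proof
      fix x assume x: "x \<in> v"
      have "norm (f x0 - f x) \<le> norm (f x0 - F' v) + norm (f x - F' v)"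
        using norm_triangle_ineq4[of "f x0 - F' v" "f x - F' v"] by simp
      also have "\<dots> < e" using near[OF x0] near[OF x] by simp
      finally have "f x \<in> ball (f x0) e" by (simp add: dist_norm)
      then have "f x \<in> f ` ob'" using ob' G(2)[OF ob'(1)] x vX XY by blast
      moreover have "ob' \<subseteq> X" using op[OF ob'(1)] openin_imp_subset by blast
      ultimately show "x \<in> ob'" using XY(2) x vX by (meson inj_on_image_mem_iff subsetD)
    qed
    then show ?thesis using ob' by blast
  qed
  then show thesis using that[OF V'(1,2) V'(4,5) V'(6) _ V'(7)] by blast
qed

text \<open>The star covers of \<open>V\<close>, \<open>W1\<close>, \<open>V2\<close>, \<open>W3\<close> refine one another in turn, and the inclusions of nerves
  comparing \<open>V\<close> with \<open>V2\<close> and \<open>W1\<close> with \<open>W3\<close> are equivalences; two-out-of-six does the rest.\<close>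

theorem Zc_triangulations:
  fixes f1 :: "'x::topological_space \<Rightarrow> 'c::euclidean_space" and f2 :: "'x \<Rightarrow> 'd::euclidean_space"
  assumes V: "tri X V b" "\<And>x. x \<in> X \<Longrightarrow> f1 x = (\<Sum>v\<in>V. b v x *\<^sub>R F v)"
      "homeomorphism X Y1 f1 g1" "compact Y1"
    and W: "tri X W d" "\<And>x. x \<in> X \<Longrightarrow> f2 x = (\<Sum>v\<in>W. d v x *\<^sub>R F2 v)"
      "homeomorphism X Y2 f2 g2" "compact Y2"
    and r: "inj_on r V" "inj_on r' W"
  shows "Zc r (nerve V) = Zc r' (nerve W)"
proof -
  obtain W1 d1 F1 E1 where W1: "tri X W1 d1" "\<And>x. x \<in> X \<Longrightarrow> f2 x = (\<Sum>v\<in>W1. d1 v x *\<^sub>R F1 v)"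
     "finite E1" "W \<union> W1 \<subseteq> E1" "\<And>v'. v' \<in> W1 \<Longrightarrow> \<exists>v\<in>W. v' \<subseteq> v" "\<And>v'. v' \<in> W1 \<Longrightarrow> \<exists>ob\<in>V. v' \<subseteq> ob"
     "\<And>s. inj_on s (E1 \<times> UNIV) \<Longrightarrow> EP s (nerve W1) (nerve (W1 \<union> W))"
    using fine_subdivision[OF W star_open[OF V(1)] stars_cover[OF V(1)]] by blast
  obtain V2 b2 F2' E2 where V2: "tri X V2 b2" "\<And>x. x \<in> X \<Longrightarrow> f1 x = (\<Sum>v\<in>V2. b2 v x *\<^sub>R F2' v)"
     "finite E2" "V \<union> V2 \<subseteq> E2" "\<And>v'. v' \<in> V2 \<Longrightarrow> \<exists>v\<in>V. v' \<subseteq> v" "\<And>v'. v' \<in> V2 \<Longrightarrow> \<exists>ob\<in>W1. v' \<subseteq> ob"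
     "\<And>s. inj_on s (E2 \<times> UNIV) \<Longrightarrow> EP s (nerve V2) (nerve (V2 \<union> V))"
    using fine_subdivision[OF V star_open[OF W1(1)] stars_cover[OF W1(1)]] by blast
  obtain W3 d3 F3 E3 where W3: "tri X W3 d3" "\<And>x. x \<in> X \<Longrightarrow> f2 x = (\<Sum>v\<in>W3. d3 v x *\<^sub>R F3 v)"
     "finite E3" "W1 \<union> W3 \<subseteq> E3" "\<And>v'. v' \<in> W3 \<Longrightarrow> \<exists>v\<in>W1. v' \<subseteq> v" "\<And>v'. v' \<in> W3 \<Longrightarrow> \<exists>ob\<in>V2. v' \<subseteq> ob"
     "\<And>s. inj_on s (E3 \<times> UNIV) \<Longrightarrow> EP s (nerve W3) (nerve (W3 \<union> W1))"
    using fine_subdivision[OF W1(1,2) W(3,4) star_open[OF V2(1)] stars_cover[OF V2(1)]] by blast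
  define E where "E = E1 \<union> E2 \<union> E3"
  have finE: "finite E" using W1 V2 W3 by (simp add: E_def)
  have sub: "V \<subseteq> E" "W \<subseteq> E" "W1 \<subseteq> E" "V2 \<subseteq> E" "W3 \<subseteq> E" "E1 \<subseteq> E" "E2 \<subseteq> E" "E3 \<subseteq> E"
    using W1(4) V2(4) W3(4) by (auto simp: E_def)
  have finF: "finite A" if "A \<subseteq> E" for A using that finE finite_subset by blast
  obtain e :: "'x set \<Rightarrow> nat" where e: "inj_on e E" using finite_imp_inj_to_nat_seg[OF finE] by blast
  define s where "s = (\<lambda>(v, i). prod_encode (e v, i))"
  have injE: "inj_on s (E \<times> UNIV)"
    using e by (auto simp: s_def inj_on_def)
  have inj: "inj_on s (A \<times> UNIV)" if "A \<subseteq> E" for A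
    using injE by (rule inj_on_subset) (use that in auto)
  have injN: "inj_on s (\<Union>(nerve A) \<times> UNIV)" if "A \<subseteq> E" for A
    using injE by (rule inj_on_subset) (use that in \<open>auto simp: nerve_def\<close>)
  have EPZ: "Zc (\<lambda>v. s (v, 0)) (nerve B) = Zc (\<lambda>v. s (v, 0)) (nerve A)"
    if "EP s (nerve A) (nerve B)" "A \<subseteq> B" "B \<subseteq> E" for A B
    using that by (intro EP_Zc asc_nerve nerve_mono injN finF) auto
  have refine: "EP s (nerve A) (nerve (A \<union> B))" if "A \<subseteq> E" "B \<subseteq> E" "\<And>v. v \<in> B \<Longrightarrow> \<exists>w\<in>A. v \<subseteq> w" for A B
    using that by (intro nerve_EP_refine finF inj) auto
  note mono = asc_nerve nerve_mono finF
  \<comment> \<open>With \<open>W3\<close> in front these form an increasing chain for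
    two-out-of-six. Adding \<open>V2\<close> to \<open>W3\<close> and \<open>W1\<close> is a
    refinement because \<open>V2\<close> refines \<open>W1\<close>; adding \<open>W3\<close> and
    \<open>W1\<close> to \<open>V2\<close> and \<open>V\<close> is one because \<open>W3\<close>
    refines \<open>V2\<close> and \<open>W1\<close> refines \<open>V\<close>.\<close>
  let ?P1 = "W3 \<union> V2" and ?P2 = "W3 \<union> W1 \<union> V2" and ?P3 = "V2 \<union> V \<union> (W3 \<union> W1)"
  have e31: "EP s (nerve W3) (nerve (W3 \<union> W1))" using W3(7) inj[OF sub(8)] .
  have e2: "EP s (nerve V2) (nerve (V2 \<union> V))" using V2(7) inj[OF sub(7)] .
  have e1: "EP s (nerve W1) (nerve (W1 \<union> W))" using W1(7) inj[OF sub(6)] .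
  have a: "EP s (nerve (W3 \<union> W1)) (nerve ?P2)"
  proof (rule refine)
    show "\<exists>w\<in>W3 \<union> W1. v \<subseteq> w" if "v \<in> V2" for v using V2(6)[OF that] by (meson UnI2)
  qed (use sub in simp_all)
  have 02: "EP s (nerve W3) (nerve ?P2)"
    by (rule EP_trans[OF e31 a]) (use sub in \<open>auto intro!: mono\<close>)
  have c: "EP s (nerve (V2 \<union> V)) (nerve ?P3)"
  proof (rule refine)
    fix v assume "v \<in> W3 \<union> W1"
    then show "\<exists>w\<in>V2 \<union> V. v \<subseteq> w" using W3(6)[of v] W1(6)[of v] by (meson UnE UnI1 UnI2)
  qed (use sub in simp_all)
  have d: "EP s (nerve V2) (nerve ?P3)"
    by (rule EP_trans[OF e2 c]) (use sub in \<open>auto intro!: mono\<close>)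
  have "EP s (nerve V2) (nerve (V2 \<union> W3))"
    using sub W3(6) by (intro refine) auto
  then have f: "EP s (nerve V2) (nerve ?P1)" by (simp add: Un_commute)
  have 13: "EP s (nerve ?P1) (nerve ?P3)"
    by (rule EP_right_cancel[OF f d]) (use sub in \<open>auto intro!: mono injN\<close>)
  \<comment> \<open>The bridge between the two triangulations: \<open>?P1\<close> is now equivalent
    to \<open>V2\<close>, a subdivision of \<open>V\<close>, and to \<open>W3\<close>, a subdivision
    of \<open>W1\<close> and so of \<open>W\<close>.\<close>
  have 01: "EP s (nerve W3) (nerve ?P1)"
    by (rule EP_2of6[OF 02 13]) (use sub in \<open>auto intro!: mono\<close>)
  let ?Z = "\<lambda>A. Zc (\<lambda>v. s (v, 0)) (nerve A)"
  have "?Z V = ?Z (V \<union> V2)"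
    using sub V2(5) by (intro EPZ[symmetric] refine) auto
  also have "\<dots> = ?Z V2"
    using EPZ[OF e2] sub by (simp add: Un_commute)
  also have "\<dots> = ?Z ?P1" using EPZ[OF f] sub by simp
  also have "\<dots> = ?Z W3" using EPZ[OF 01] sub by simp
  also have "\<dots> = ?Z (W3 \<union> W1)" using EPZ[OF e31] sub by simp
  also have "\<dots> = ?Z (W1 \<union> W3)" by (simp add: Un_commute)
  also have "\<dots> = ?Z W1"
    using sub W3(5) by (intro EPZ refine) auto
  also have "\<dots> = ?Z (W1 \<union> W)" using EPZ[OF e1] sub by simp
  also have "\<dots> = ?Z (W \<union> W1)" by (simp add: Un_commute)
  also have "\<dots> = ?Z W"
    using sub W1(5) by (intro EPZ refine) auto
  finally have VW: "?Z V = ?Z W" .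
  have ord: "Zc q (nerve A) = ?Z A" if "A \<subseteq> E" "inj_on q A" for A q
  proof (rule Zc_order)
    show "asc (nerve A)" by (rule asc_nerve[OF finF[OF that(1)]])
    have sub: "\<Union>(nerve A) \<subseteq> A" by (auto simp: nerve_def)
    show "inj_on q (\<Union>(nerve A))" using that(2) sub by (rule inj_on_subset)
    have "inj_on (\<lambda>v. s (v, 0)) A"
    proof (rule inj_onI)
      fix v w assume "v \<in> A" "w \<in> A" "s (v, 0) = s (w, 0)"
      then show "v = w" using inj_onD[OF inj[OF that(1)], of "(v, 0)" "(w, 0)"] by simp
    qed
    then show "inj_on (\<lambda>v. s (v, 0)) (\<Union>(nerve A))" using sub by (rule inj_on_subset)
  qed
  show ?thesis using ord[OF sub(1) r(1)] ord[OF sub(2) r(2)] VW by simp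
qed

end

section \<open>Barycentric coordinates on a simplicial complex\<close>

text \<open>The empty simplex, which a geometric complex may contain, is removed here.\<close>

definition abstract_complex :: "'a::euclidean_space set set \<Rightarrow> 'a set set" where
  "abstract_complex K = vertices_of ` (K - {{}})"

lemma vertices_of_hull: "\<not> affine_dependent C \<Longrightarrow> vertices_of (convex hull C) = C"
  by (auto simp: vertices_of_def extreme_point_of_convex_hull_affine_independent)

text \<open>With a vertex \<open>a\<close> other than \<open>v\<close> as origin, the differences
  \<open>w - a\<close> are independent and a linear functional can be prescribed on them. As it is
  defined on the whole space, its continuity needs no argument on the simplex.\<close>

lemma affine_coordinate:
  fixes C :: "'a::euclidean_space set"
  assumes C: "\<not> affine_dependent C" and v: "v \<in> C"
  obtains l :: "'a \<Rightarrow> real" where "continuous_on UNIV l"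
    "\<And>u. sum u C = 1 \<Longrightarrow> l (\<Sum>w\<in>C. u w *\<^sub>R w) = u v"
proof -
  have fin: "finite C" using aff_independent_finite[OF C] .
  show thesis
  proof (cases "C = {v}")
    case True
    then show ?thesis using that[of "\<lambda>_. 1"] by auto
  next
    case False
    then obtain a where a: "a \<in> C" "a \<noteq> v" using v by blast
    have ind: "independent ((\<lambda>x. - a + x) ` (C - {a}))"
      using affine_dependent_iff_dependent2[OF a(1)] C by simp
    obtain g :: "'a \<Rightarrow> real" where g: "linear g" "\<forall>x\<in>(\<lambda>x. - a + x) ` (C - {a}). g x = (if x = - a + v then 1 else 0)"
      using linear_independent_extend[OF ind, of "\<lambda>x. if x = - a + v then 1 else 0"] by blast
    have gw: "g (w - a) = (if w = v then 1 else 0)" if "w \<in> C" for w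
    proof (cases "w = a")
      case True
      then show ?thesis using a linear_0[OF g(1)] by simp
    next
      case False
      then have "- a + w \<in> (\<lambda>x. - a + x) ` (C - {a})" using that by blast
      then have "g (- a + w) = (if - a + w = - a + v then 1 else 0)" using g(2) by blast
      then show ?thesis by simp
    qed
    show ?thesis
    proof (rule that)
      have "bounded_linear g" using g(1) linear_conv_bounded_linear by blast
      then show "continuous_on UNIV (\<lambda>x. g (x - a))"
        by (rule bounded_linear.continuous_on) (intro continuous_intros)
      fix u :: "'a \<Rightarrow> real" assume u: "sum u C = 1"
      have "(\<Sum>w\<in>C. u w *\<^sub>R w) - a = (\<Sum>w\<in>C. u w *\<^sub>R (w - a))"
        using u by (simp add: scaleR_diff_right sum_subtractf flip: scaleR_left.sum)
      then have "g ((\<Sum>w\<in>C. u w *\<^sub>R w) - a) = (\<Sum>w\<in>C. u w * g (w - a))"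
        by (simp add: linear_sum[OF g(1)] linear_scale[OF g(1)])
      also have "\<dots> = (\<Sum>w\<in>C. if w = v then u v else 0)"
        by (rule sum.cong) (auto simp: gw)
      also have "\<dots> = u v" using fin v by simp
      finally show "g ((\<Sum>w\<in>C. u w *\<^sub>R w) - a) = u v" .
    qed
  qed
qed

locale geom_complex =
  fixes K :: "'a::euclidean_space set set"
  assumes K: "simplicial_complex K"
begin

abbreviation "\<K> \<equiv> abstract_complex K"

lemma finK: "finite K"
  using K by (simp add: simplicial_complex_def)

lemma simplex_hull:
  assumes "S \<in> K"
  shows "\<not> affine_dependent (vertices_of S)" "S = convex hull (vertices_of S)" "finite (vertices_of S)"
proof -
  obtain n where "n simplex S" using K assms by (auto simp: simplicial_complex_def)
  then obtain C where C: "\<not> affine_dependent C" "S = convex hull C" by (auto simp: simplex_def)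
  then have "vertices_of S = C" by (simp add: vertices_of_hull)
  then show "\<not> affine_dependent (vertices_of S)" "S = convex hull (vertices_of S)" "finite (vertices_of S)"
    using C aff_independent_finite by auto
qed

lemma simplex_iff_card:
  assumes "S \<in> K"
  shows "i simplex S \<longleftrightarrow> int (card (vertices_of S)) = i + 1"
proof
  assume "i simplex S"
  then obtain C where C: "\<not> affine_dependent C" "int (card C) = i + 1" "S = convex hull C" by (auto simp: simplex_def)
  then show "int (card (vertices_of S)) = i + 1" by (simp add: vertices_of_hull)
next
  assume "int (card (vertices_of S)) = i + 1"
  then show "i simplex S" using simplex_hull[OF assms] simplex_convex_hull by metis
qed

lemma face_in:
  assumes "S \<in> K" "T \<subseteq> vertices_of S"
  shows "convex hull T \<in> K" "vertices_of (convex hull T) = T"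
proof -
  have "convex hull T face_of convex hull (vertices_of S)"
    using face_of_convex_hull_affine_independent[OF simplex_hull(1)[OF assms(1)]] assms(2) by blast
  then have "convex hull T face_of S" using simplex_hull(2)[OF assms(1)] by simp
  then show "convex hull T \<in> K" using K assms(1) unfolding simplicial_complex_def by blast
  have "\<not> affine_dependent T" using affine_independent_subset[OF simplex_hull(1)[OF assms(1)] assms(2)] .
  then show "vertices_of (convex hull T) = T" by (rule vertices_of_hull)
qed

lemma abstract_iff: "\<sigma> \<in> \<K> \<longleftrightarrow> convex hull \<sigma> \<in> K \<and> \<sigma> \<noteq> {} \<and> vertices_of (convex hull \<sigma>) = \<sigma>"
proof
  assume "\<sigma> \<in> \<K>"
  then obtain S where S: "S \<in> K" "S \<noteq> {}" "\<sigma> = vertices_of S" by (auto simp: abstract_complex_def)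
  then show "convex hull \<sigma> \<in> K \<and> \<sigma> \<noteq> {} \<and> vertices_of (convex hull \<sigma>) = \<sigma>"
    using simplex_hull(2)[OF S(1)] by (metis convex_hull_empty)
next
  assume a: "convex hull \<sigma> \<in> K \<and> \<sigma> \<noteq> {} \<and> vertices_of (convex hull \<sigma>) = \<sigma>"
  then have "convex hull \<sigma> \<in> K - {{}}" by simp
  then show "\<sigma> \<in> \<K>" unfolding abstract_complex_def using a by (metis imageI)
qed

lemma vertices_in_abstract: "S \<in> K \<Longrightarrow> S \<noteq> {} \<Longrightarrow> vertices_of S \<in> \<K>"
  by (simp add: abstract_complex_def)

lemma subset_in_abstract:
  assumes "S \<in> K" "\<sigma> \<subseteq> vertices_of S" "\<sigma> \<noteq> {}"
  shows "\<sigma> \<in> \<K>"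
  using face_in[OF assms(1,2)] assms(3) by (simp add: abstract_iff)

lemma asc_abstract: "asc \<K>"
proof (rule asc_I)
  show "finite \<K>" unfolding abstract_complex_def using finK by simp
next
  fix \<sigma> assume "\<sigma> \<in> \<K>"
  then show "finite \<sigma>" "\<sigma> \<noteq> {}" using simplex_hull(3)[of "convex hull \<sigma>"] by (auto simp: abstract_iff)
next
  fix \<sigma> \<tau> assume "\<sigma> \<in> \<K>" "\<tau> \<subseteq> \<sigma>" "\<tau> \<noteq> {}"
  then show "\<tau> \<in> \<K>" using subset_in_abstract[of "convex hull \<sigma>" \<tau>] by (simp add: abstract_iff)
qed

lemma vertex_set_abstract: "\<Union>\<K> = vertex_set K"
proof (intro equalityI subsetI)
  fix v assume "v \<in> \<Union>\<K>"
  then obtain \<sigma> where s: "\<sigma> \<in> \<K>" "v \<in> \<sigma>" by blast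
  then have "{v} \<in> \<K>" using asc_mono[OF asc_abstract s(1), of "{v}"] by simp
  then have "{v} \<in> K" by (simp add: abstract_iff)
  then show "v \<in> vertex_set K" by (simp add: vertex_set_def simplices_def)
next
  fix v assume "v \<in> vertex_set K"
  then have v: "{v} \<in> K" by (simp add: vertex_set_def simplices_def)
  have "vertices_of {v} = {v}" by (auto simp: vertices_of_def)
  then show "v \<in> \<Union>\<K>" using vertices_in_abstract[OF v] by auto
qed

text \<open>Coordinates are total functions vanishing off the simplex, so that those taken in
  different simplices can be compared as functions.\<close>

definition rep :: "'a \<Rightarrow> ('a \<Rightarrow> real) \<Rightarrow> 'a set \<Rightarrow> bool" where
  "rep x u S \<longleftrightarrow> S \<in> K \<and> (\<forall>v. 0 \<le> u v) \<and> (\<forall>v. v \<notin> vertices_of S \<longrightarrow> u v = 0) \<and>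
     sum u (vertices_of S) = 1 \<and> (\<Sum>v\<in>vertices_of S. u v *\<^sub>R v) = x"

lemma rep_exists:
  assumes "S \<in> K" "x \<in> S"
  shows "\<exists>u. rep x u S"
proof -
  have "x \<in> convex hull (vertices_of S)" using simplex_hull(2)[OF assms(1)] assms(2) by simp
  then obtain u where u: "\<forall>v\<in>vertices_of S. 0 \<le> u v" "sum u (vertices_of S) = 1" "(\<Sum>v\<in>vertices_of S. u v *\<^sub>R v) = x"
    using convex_hull_finite[OF simplex_hull(3)[OF assms(1)]] by auto
  let ?u = "\<lambda>v. if v \<in> vertices_of S then u v else 0"
  have "sum ?u (vertices_of S) = 1" "(\<Sum>v\<in>vertices_of S. ?u v *\<^sub>R v) = x"
    using u by (simp_all cong: sum.cong)
  then have "rep x ?u S" using u assms(1) by (simp add: rep_def)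
  then show ?thesis by blast
qed

lemma rep_supp:
  assumes "rep x u S"
  shows "{v. 0 < u v} \<subseteq> vertices_of S" "sum u {v. 0 < u v} = 1" "(\<Sum>v | 0 < u v. u v *\<^sub>R v) = x"
proof -
  have r: "S \<in> K" "\<And>v. 0 \<le> u v" "\<And>v. v \<notin> vertices_of S \<Longrightarrow> u v = 0"
     "sum u (vertices_of S) = 1" "(\<Sum>v\<in>vertices_of S. u v *\<^sub>R v) = x"
    using assms by (auto simp: rep_def)
  show sub: "{v. 0 < u v} \<subseteq> vertices_of S" using r(3) by force
  have fin: "finite (vertices_of S)" using simplex_hull(3)[OF r(1)] .
  have z: "u v = 0" if "v \<notin> {v. 0 < u v}" for v using r(2)[of v] that by simp
  have "sum u {v. 0 < u v} = sum u (vertices_of S)"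
    by (rule sum.mono_neutral_left[OF fin sub]) (metis DiffD2 z scaleR_zero_left)
  then show "sum u {v. 0 < u v} = 1" using r(4) by simp
  have "(\<Sum>v | 0 < u v. u v *\<^sub>R v) = (\<Sum>v\<in>vertices_of S. u v *\<^sub>R v)"
    by (rule sum.mono_neutral_left[OF fin sub]) (metis DiffD2 z scaleR_zero_left)
  then show "(\<Sum>v | 0 < u v. u v *\<^sub>R v) = x" using r(5) by simp
qed

lemma rep_in:
  assumes "rep x u S" shows "x \<in> S"
proof -
  have "S \<in> K" using assms by (simp add: rep_def)
  note h = simplex_hull(2,3)[OF this]
  have "x \<in> convex hull (vertices_of S)"
    unfolding convex_hull_finite[OF h(2)] using assms by (intro CollectI exI[of _ u]) (simp add: rep_def)
  then show ?thesis by (rule ssubst[OF h(1)])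
qed

text \<open>The support of a representation spans a simplex with \<open>x\<close> in its relative interior, so it lies
  in every simplex of the complex containing \<open>x\<close>.\<close>

lemma rep_transfer:
  assumes r: "rep x u S" and S': "S' \<in> K" "x \<in> S'"
  shows "rep x u S'"
proof -
  let ?s = "{v. 0 < u v}"
  have SK: "S \<in> K" using r by (simp add: rep_def)
  note sup = rep_supp[OF r]
  have ind: "\<not> affine_dependent ?s" using affine_independent_subset[OF simplex_hull(1)[OF SK] sup(1)] .
  have xs: "x \<in> rel_interior (convex hull ?s)"
    unfolding rel_interior_convex_hull_explicit[OF ind] using sup by auto
  have hull: "convex hull ?s \<subseteq> S"
    using hull_mono[OF sup(1), of convex] simplex_hull(2)[OF SK] by simp
  have f: "S \<inter> S' face_of S" "S' \<inter> S face_of S'" using K SK S' by (auto simp: simplicial_complex_def)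
  have "x \<in> S \<inter> S'" using rep_in[OF r] S' by simp
  then have sub: "convex hull ?s \<subseteq> S \<inter> S'"
    using subset_of_face_of[OF f(1) hull] xs by blast
  have sv: "?s \<subseteq> vertices_of S'"
  proof
    fix v assume v: "v \<in> ?s"
    then have "v \<in> S \<inter> S'" using sub hull_inc[of v ?s convex] by blast
    moreover have "v extreme_point_of S" using v sup(1) by (auto simp: vertices_of_def)
    ultimately have "v extreme_point_of (S \<inter> S')" using extreme_point_of_face[OF f(1)] by blast
    then have "v extreme_point_of (S' \<inter> S)" by (simp add: Int_commute)
    then show "v \<in> vertices_of S'" using extreme_point_of_face[OF f(2)] by (simp add: vertices_of_def)
  qed
  have z: "u v = 0" if "v \<notin> ?s" for v using r that by (simp add: rep_def) (metis less_eq_real_def)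
  have fin: "finite (vertices_of S')" using simplex_hull(3)[OF S'(1)] .
  have "sum u (vertices_of S') = sum u ?s"
    by (rule sum.mono_neutral_right[OF fin sv]) (metis DiffD2 z scaleR_zero_left)
  then have "sum u (vertices_of S') = 1" using sup(2) by simp
  moreover have "(\<Sum>v\<in>vertices_of S'. u v *\<^sub>R v) = (\<Sum>v | 0 < u v. u v *\<^sub>R v)"
    by (rule sum.mono_neutral_right[OF fin sv]) (metis DiffD2 z scaleR_zero_left)
  moreover have "u v = 0" if "v \<notin> vertices_of S'" for v using z[of v] sv that by blast
  ultimately show ?thesis using r S' sup(3) by (simp add: rep_def)
qed

text \<open>Both representations can be moved to one simplex, where affine independence
  decides.\<close>

lemma rep_unique:
  assumes "rep x u S" "rep x u' S'"
  shows "u = u'"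
proof
  fix v
  have S': "S' \<in> K" using assms(2) by (simp add: rep_def)
  have r: "rep x u S'" using rep_transfer[OF assms(1) S'] rep_in[OF assms(2)] by simp
  show "u v = u' v"
  proof (cases "v \<in> vertices_of S'")
    case False
    then show ?thesis using r assms(2) by (simp add: rep_def)
  next
    case True
    obtain l where l: "\<And>u. sum u (vertices_of S') = 1 \<Longrightarrow> l (\<Sum>w\<in>vertices_of S'. u w *\<^sub>R w) = u v"
      by (rule affine_coordinate[OF simplex_hull(1)[OF S'] True]) blast
    have "l x = u v" using r l[of u] by (simp add: rep_def)
    moreover have "l x = u' v" using assms(2) l[of u'] by (simp add: rep_def)
    ultimately show ?thesis by simp
  qed
qed

definition bc :: "'a \<Rightarrow> 'a \<Rightarrow> real" where
  "bc x = (SOME u. \<exists>S. rep x u S)"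

lemma bc_rep:
  assumes "S \<in> K" "x \<in> S"
  shows "rep x (bc x) S"
proof -
  have "\<exists>u. \<exists>S. rep x u S" using rep_exists[OF assms] by blast
  then have "\<exists>S. rep x (bc x) S" unfolding bc_def by (rule someI_ex)
  then show ?thesis using rep_transfer assms by blast
qed

lemma bc_eqI: "rep x u S \<Longrightarrow> bc x = u"
  using bc_rep[of S x] rep_in[of x u S] rep_unique by (metis rep_def)

text \<open>The simplices form a finite closed cover, and on each of them a coordinate is affine or
  zero, so continuity pastes.\<close>

lemma bc_continuous: "continuous_on (\<Union>K) (\<lambda>x. bc x v)"
proof -
  have "continuous_on (\<Union>S\<in>K. S) (\<lambda>x. bc x v)"
  proof (rule continuous_on_closed_Union[OF finK])
    fix S assume S: "S \<in> K"
    show "closed S"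
      using simplex_hull(2,3)[OF S] finite_imp_compact compact_convex_hull compact_imp_closed by metis
    show "continuous_on S (\<lambda>x. bc x v)"
    proof (cases "v \<in> vertices_of S")
      case False
      then have "bc x v = 0" if "x \<in> S" for x using bc_rep[OF S that] by (simp add: rep_def)
      then show ?thesis by (simp cong: continuous_on_cong)
    next
      case True
      obtain l where l: "continuous_on UNIV l" "\<And>u. sum u (vertices_of S) = 1 \<Longrightarrow> l (\<Sum>w\<in>vertices_of S. u w *\<^sub>R w) = u v"
        using affine_coordinate[OF simplex_hull(1)[OF S] True] by metis
      have "bc x v = l x" if "x \<in> S" for x
        using bc_rep[OF S that] l(2)[of "bc x"] by (simp add: rep_def)
      moreover have "continuous_on S l" using l(1) continuous_on_subset by blast
      ultimately show ?thesis by (simp cong: continuous_on_cong)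
    qed
  qed
  then show ?thesis by simp
qed

lemma finVS: "finite (vertex_set K)"
  using finite_vertices[OF asc_abstract] vertex_set_abstract by simp

lemma bc_props:
  assumes "x \<in> \<Union>K"
  shows "0 \<le> bc x v" "(\<Sum>v\<in>vertex_set K. bc x v) = 1" "(\<Sum>v\<in>vertex_set K. bc x v *\<^sub>R v) = x"
    "{v. 0 < bc x v} \<in> \<K>"
proof -
  obtain S where S: "S \<in> K" "x \<in> S" using assms by blast
  note r = bc_rep[OF S]
  have sub: "vertices_of S \<subseteq> vertex_set K"
    using vertices_in_abstract[OF S(1)] S(2) vertex_set_abstract by blast
  show "0 \<le> bc x v" using r by (simp add: rep_def)
  have z: "bc x w = 0" if "w \<notin> vertices_of S" for w using r that by (simp add: rep_def)
  have "(\<Sum>v\<in>vertices_of S. bc x v) = (\<Sum>v\<in>vertex_set K. bc x v)"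
    by (rule sum.mono_neutral_left[OF finVS sub]) (simp add: z)
  then show "(\<Sum>v\<in>vertex_set K. bc x v) = 1" using r by (simp add: rep_def)
  have "(\<Sum>v\<in>vertices_of S. bc x v *\<^sub>R v) = (\<Sum>v\<in>vertex_set K. bc x v *\<^sub>R v)"
    by (rule sum.mono_neutral_left[OF finVS sub]) (simp add: z)
  then show "(\<Sum>v\<in>vertex_set K. bc x v *\<^sub>R v) = x" using r by (simp add: rep_def)
  have "{v. 0 < bc x v} \<noteq> {}" using rep_supp(2)[OF r] by (metis sum.empty zero_neq_one)
  then show "{v. 0 < bc x v} \<in> \<K>"
    using subset_in_abstract[OF S(1) rep_supp(1)[OF r]] by simp
qed

lemma bc_realize:
  assumes "\<And>v. 0 \<le> u v" "{v. 0 < u v} \<in> \<K>" "sum u {v. 0 < u v} = 1"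
  shows "\<exists>x\<in>\<Union>K. bc x = u"
proof -
  let ?s = "{v. 0 < u v}"
  let ?x = "\<Sum>v\<in>?s. u v *\<^sub>R v"
  have s: "convex hull ?s \<in> K" "vertices_of (convex hull ?s) = ?s" using assms(2) by (auto simp: abstract_iff)
  have "u v = 0" if "v \<notin> ?s" for v using assms(1)[of v] that by simp
  then have "rep ?x u (convex hull ?s)"
    using assms s by (simp add: rep_def)
  then show ?thesis using bc_eqI rep_in s(1) by blast
qed

text \<open>Each vertex becomes its open star, pulled back along \<open>f\<close>. Complexes in
  different Euclidean spaces thus give covers of the same \<open>X\<close>, and \<open>F\<close>
  records \<open>f\<close> as an affine map for the mesh estimate.\<close>

lemma tri_of_complex:
  fixes X :: "'x::topological_space set"
  assumes hom: "homeomorphism X (\<Union>K) f f'"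
  obtains \<phi> b F where "tri X (\<phi> ` vertex_set K) b" "inj_on \<phi> (vertex_set K)"
    "nerve (\<phi> ` vertex_set K) = (`) \<phi> ` \<K>"
    "\<And>x. x \<in> X \<Longrightarrow> f x = (\<Sum>s\<in>\<phi> ` vertex_set K. b s x *\<^sub>R F s)"
proof -
  let ?VS = "vertex_set K"
  define \<phi> where "\<phi> v = {x \<in> X. 0 < bc (f x) v}" for v
  have fX: "f x \<in> \<Union>K" if "x \<in> X" for x using hom that by (auto simp: homeomorphism_def)
  have f'X: "f' y \<in> X" "f (f' y) = y" if "y \<in> \<Union>K" for y using hom that by (auto simp: homeomorphism_def)
  have bcv: "v \<in> \<Union>K" "bc v = (\<lambda>w. if w = v then 1 else 0)" if "v \<in> ?VS" for v
  proof -
    have v: "{v} \<in> K" using that by (simp add: vertex_set_def simplices_def)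
    then show "v \<in> \<Union>K" by blast
    have "vertices_of {v} = {v}" by (auto simp: vertices_of_def)
    then have "rep v (\<lambda>w. if w = v then 1 else 0) {v}" using v by (simp add: rep_def)
    then show "bc v = (\<lambda>w. if w = v then 1 else 0)" by (rule bc_eqI)
  qed
  \<comment> \<open>A vertex has coordinate 1 at itself and all others 0, so it lies in its own star
    only; this separates the stars.\<close>
  have mem: "f' v \<in> \<phi> w \<longleftrightarrow> w = v" if "v \<in> ?VS" for v w
    using bcv[OF that] f'X[of v] by (simp add: \<phi>_def)
  have inj: "inj_on \<phi> ?VS"
  proof (rule inj_onI)
    fix v w assume a: "v \<in> ?VS" "w \<in> ?VS" "\<phi> v = \<phi> w"
    have "f' v \<in> \<phi> v" using mem[OF a(1), of v] by blast
    then have "f' v \<in> \<phi> w" by (subst a(3)[symmetric])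
    then show "v = w" using mem[OF a(1), of w] by blast
  qed
  define inv\<phi> where "inv\<phi> = inv_into ?VS \<phi>"
  have inv: "inv\<phi> (\<phi> v) = v" if "v \<in> ?VS" for v
    unfolding inv\<phi>_def using inv_into_f_f[OF inj that] .
  define b where "b s x = bc (f x) (inv\<phi> s)" for s x
  have sumV: "(\<Sum>s\<in>\<phi> ` ?VS. h s) = (\<Sum>v\<in>?VS. h (\<phi> v))" for h :: "'x set \<Rightarrow> 'e::comm_monoid_add"
    using inj by (simp add: sum.reindex)
  have nerve: "\<phi> ` \<tau> \<in> nerve (\<phi> ` ?VS) \<longleftrightarrow> \<tau> \<in> \<K>" if t: "\<tau> \<subseteq> ?VS" for \<tau>
  proof
    assume n: "\<phi> ` \<tau> \<in> nerve (\<phi> ` ?VS)"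
    then have tne: "\<tau> \<noteq> {}" by (auto simp: nerve_def)
    obtain x where "x \<in> \<Inter>(\<phi> ` \<tau>)" using n by (auto simp: nerve_def)
    then have x: "x \<in> \<phi> v" if "v \<in> \<tau>" for v using that by blast
    then have xX: "x \<in> X" using tne by (auto simp: \<phi>_def)
    have "\<tau> \<subseteq> {v. 0 < bc (f x) v}" using x by (auto simp: \<phi>_def)
    then show "\<tau> \<in> \<K>" using asc_mono[OF asc_abstract bc_props(4)[OF fX[OF xX]]] tne by blast
  next
    assume tK: "\<tau> \<in> \<K>"
    have ft: "finite \<tau>" "\<tau> \<noteq> {}" using asc_simplex[OF asc_abstract tK] by auto
    then have ct: "0 < card \<tau>" by (simp add: card_gt_0_iff)
    \<comment> \<open>The barycentre of \<tau> serves as a common point of the stars of its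
      vertices.\<close>
    let ?u = "\<lambda>v. if v \<in> \<tau> then 1 / real (card \<tau>) else 0"
    have supp: "{v. 0 < ?u v} = \<tau>" using ct by auto
    have "\<exists>y\<in>\<Union>K. bc y = ?u"
      by (rule bc_realize) (use tK ct in \<open>simp_all add: supp\<close>)
    then obtain y where y: "y \<in> \<Union>K" "bc y = ?u" by blast
    have "f' y \<in> \<Inter>(\<phi> ` \<tau>)" using f'X[OF y(1)] y(2) ct by (auto simp: \<phi>_def)
    then have "\<Inter>(\<phi> ` \<tau>) \<noteq> {}" by (metis empty_iff)
    then show "\<phi> ` \<tau> \<in> nerve (\<phi> ` ?VS)"
      unfolding nerve_def using ft image_mono[OF t, of \<phi>] by simp
  qed
  have nerve_eq: "nerve (\<phi> ` ?VS) = (`) \<phi> ` \<K>"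
  proof (intro equalityI subsetI)
    fix \<Gamma> assume G: "\<Gamma> \<in> nerve (\<phi> ` ?VS)"
    then obtain \<tau> where "\<tau> \<subseteq> ?VS" "\<Gamma> = \<phi> ` \<tau>" by (metis (no_types, lifting) nerve_def mem_Collect_eq subset_imageE)
    then show "\<Gamma> \<in> (`) \<phi> ` \<K>" using nerve G by blast
  next
    fix \<Gamma> assume "\<Gamma> \<in> (`) \<phi> ` \<K>"
    then obtain \<tau> where t: "\<tau> \<in> \<K>" "\<Gamma> = \<phi> ` \<tau>" by blast
    have "\<tau> \<subseteq> ?VS" using t(1) vertex_set_abstract by blast
    then show "\<Gamma> \<in> nerve (\<phi> ` ?VS)" using nerve t by blast
  qed
  have "tri X (\<phi> ` ?VS) b"
  proof
    show "finite (\<phi> ` ?VS)" using finVS by simp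
    show "{} \<notin> \<phi> ` ?VS" using mem by blast
    show "s = {x \<in> X. 0 < b s x}" if "s \<in> \<phi> ` ?VS" for s
      using that inv by (auto simp: b_def \<phi>_def)
    show "0 \<le> b s x" if "x \<in> X" for s x using bc_props(1)[OF fX[OF that]] by (simp add: b_def)
    show "(\<Sum>s\<in>\<phi> ` ?VS. b s x) = 1" if "x \<in> X" for x
      using bc_props(2)[OF fX[OF that]] by (simp add: sumV b_def inv cong: sum.cong)
    show "continuous_on X (b s)" for s
      unfolding b_def using hom bc_continuous
      by (intro continuous_on_compose2[of "\<Union>K" "\<lambda>y. bc y (inv\<phi> s)" X f]) (auto simp: homeomorphism_def)
    fix u :: "'x set \<Rightarrow> real"
    assume u: "\<And>s. s \<in> \<phi> ` ?VS \<Longrightarrow> 0 \<le> u s" "sum u (\<phi> ` ?VS) = 1" "{s \<in> \<phi> ` ?VS. 0 < u s} \<in> nerve (\<phi> ` ?VS)"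
    define w where "w v = (if v \<in> ?VS then u (\<phi> v) else 0)" for v
    have supp: "{s \<in> \<phi> ` ?VS. 0 < u s} = \<phi> ` {v. 0 < w v}" by (auto simp: w_def)
    have wVS: "{v. 0 < w v} \<subseteq> ?VS" by (auto simp: w_def)
    have "\<exists>y\<in>\<Union>K. bc y = w"
    proof (rule bc_realize)
      show "0 \<le> w v" for v using u(1) by (simp add: w_def)
      show "{v. 0 < w v} \<in> \<K>" using u(3) nerve[OF wVS] supp by simp
      have "sum w ?VS = 1" using u(2) by (simp add: sumV w_def cong: sum.cong)
      moreover have "sum w {v. 0 < w v} = sum w ?VS"
      proof (rule sum.mono_neutral_left[OF finVS wVS])
        show "\<forall>v\<in>?VS - {v. 0 < w v}. w v = 0" using u(1) by (force simp: w_def)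
      qed
      ultimately show "sum w {v. 0 < w v} = 1" by simp
    qed
    then obtain y where y: "y \<in> \<Union>K" "bc y = w" by blast
    show "\<exists>x\<in>X. \<forall>s\<in>\<phi> ` ?VS. b s x = u s"
      using f'X[OF y(1)] y(2) by (intro bexI[of _ "f' y"]) (auto simp: b_def inv w_def)
  qed
  moreover have "f x = (\<Sum>s\<in>\<phi> ` ?VS. b s x *\<^sub>R inv\<phi> s)" if "x \<in> X" for x
    using bc_props(3)[OF fX[OF that]] by (simp add: sumV b_def inv cong: sum.cong)
  ultimately show thesis using that[of \<phi> b inv\<phi>] inj nerve_eq by blast
qed

lemma compact_carrier: "compact (\<Union>K)"
proof (rule compact_Union[OF finK])
  fix S assume S: "S \<in> K"
  show "compact S"
    using simplex_hull(2,3)[OF S] finite_imp_compact compact_convex_hull by metis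
qed

end

section \<open>The state sum\<close>

text \<open>In an increasing enumeration exactly \<open>a\<close> vertices rank below
  \<open>xs ! a\<close>, so the position in the list is the rank that \<open>vtx\<close> asks
  for.\<close>

lemma vtx_nth:
  assumes xs: "set xs = vertices_of S" "sorted_wrt (\<lambda>x y. rho x < (rho y :: nat)) xs" and i: "i < length xs"
  shows "vtx rho S i = xs ! i"
proof -
  have less: "rho (xs ! a) < rho (xs ! c) \<longleftrightarrow> a < c" if "a < length xs" "c < length xs" for a c
    using that sorted_wrt_nth_less[OF xs(2)] by (metis linorder_neqE_nat order_less_asym order_less_irrefl)
  have dist: "distinct xs"
    unfolding distinct_conv_nth using less by (metis linorder_neqE_nat order_less_irrefl)
  have rank: "card {w \<in> vertices_of S. rho w < rho (xs ! a)} = a" if a: "a < length xs" for a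
  proof -
    have "{w \<in> vertices_of S. rho w < rho (xs ! a)} = (!) xs ` {..<a}"
    proof (intro equalityI subsetI)
      fix w assume w: "w \<in> {w \<in> vertices_of S. rho w < rho (xs ! a)}"
      then obtain c where c: "c < length xs" "w = xs ! c" using xs(1) by (metis (no_types, lifting) in_set_conv_nth mem_Collect_eq)
      then show "w \<in> (!) xs ` {..<a}" using w less[OF c(1) a] by auto
    next
      fix w assume "w \<in> (!) xs ` {..<a}"
      then obtain c where c: "c < a" "w = xs ! c" by auto
      then have l: "c < length xs" using a by simp
      then have "w \<in> vertices_of S" using nth_mem[OF l] c(2) unfolding xs(1) by simp
      then show "w \<in> {w \<in> vertices_of S. rho w < rho (xs ! a)}"
        using less[OF l a] c by simp
    qed
    moreover have "inj_on ((!) xs) {..<a}" using dist a by (auto simp: inj_on_def nth_eq_iff_index_eq)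
    ultimately show ?thesis by (simp add: card_image)
  qed
  show ?thesis
    unfolding vtx_def
  proof (rule the_equality)
    show "xs ! i \<in> vertices_of S \<and> card {w \<in> vertices_of S. rho w < rho (xs ! i)} = i"
      using rank[OF i] nth_mem[OF i] xs(1) by simp
    fix v assume v: "v \<in> vertices_of S \<and> card {w \<in> vertices_of S. rho w < rho v} = i"
    then obtain c where c: "c < length xs" "v = xs ! c" using xs(1) by (metis in_set_conv_nth)
    then show "v = xs ! i" using rank[OF c(1)] v by simp
  qed
qed

locale coloured_complex = geom_complex K + finite_crossed_module H G bd act
  for K :: "'a::euclidean_space set set" and H :: "'h monoid" and G :: "'g monoid"
    and bd :: "'h \<Rightarrow> 'g" and act :: "'g \<Rightarrow> 'h \<Rightarrow> 'h" +
  fixes rho :: "'a \<Rightarrow> nat"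
  assumes rho: "inj_on rho (vertex_set K)"
begin

lemma hull_vertices: "S \<in> K \<Longrightarrow> convex hull (vertices_of S) = S"
  using simplex_hull(2) by metis

lemma simplices_iff: "0 \<le> i \<Longrightarrow> S \<in> simplices K i \<longleftrightarrow> S \<in> K \<and> int (card (vertices_of S)) = i + 1"
  by (auto simp: simplices_def simplex_iff_card)

lemma bij_simplices:
  assumes "0 \<le> i"
  shows "bij_betw vertices_of (simplices K i) {\<sigma> \<in> \<K>. int (card \<sigma>) = i + 1}"
proof (rule bij_betwI[where g = "\<lambda>\<sigma>. convex hull \<sigma>"])
  show "vertices_of \<in> simplices K i \<rightarrow> {\<sigma> \<in> \<K>. int (card \<sigma>) = i + 1}"
  proof
    fix S assume "S \<in> simplices K i"
    then have S: "S \<in> K" "int (card (vertices_of S)) = i + 1" using simplices_iff[OF assms] by auto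
    moreover have "S \<noteq> {}"
    proof
      assume "S = {}"
      then have "vertices_of S = {}" by (simp add: vertices_of_def)
      then show False using S(2) assms by simp
    qed
    ultimately show "vertices_of S \<in> {\<sigma> \<in> \<K>. int (card \<sigma>) = i + 1}" by (simp add: vertices_in_abstract)
  qed
  show "(\<lambda>\<sigma>. convex hull \<sigma>) \<in> {\<sigma> \<in> \<K>. int (card \<sigma>) = i + 1} \<rightarrow> simplices K i"
    using simplices_iff[OF assms] by (auto simp: abstract_iff)
qed (auto simp: simplices_iff[OF assms] abstract_iff hull_vertices)

lemma card_simplices:
  "card (simplices K 0) = card {\<sigma> \<in> \<K>. card \<sigma> = 1}" "card (simplices K 1) = card (edges \<K>)"
  using bij_betw_same_card[OF bij_simplices[of 0]] bij_betw_same_card[OF bij_simplices[of 1]]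
  by (simp_all add: int_eq_iff_numeral)

lemma wt_abstract:
  "wt \<K> = (real (card (carrier G)) / real (card (carrier H))) ^ card (simplices K 0)
     * real (card (carrier H)) ^ card (simplices K 1)"
proof -
  let ?a = "real (card (carrier G)) / real (card (carrier H))" and ?c = "real (card (carrier H))"
  have fin: "finite \<K>" using asc_finite[OF asc_abstract] .
  have "wt \<K> = (\<Prod>S\<in>\<K>. (if card S = 1 then ?a else 1) * (if card S = 2 then ?c else 1))"
    unfolding wt_def by (rule prod.cong) auto
  also have "\<dots> = (\<Prod>S\<in>\<K>. if card S = 1 then ?a else 1) * (\<Prod>S\<in>\<K>. if card S = 2 then ?c else 1)"
    by (rule prod.distrib)
  also have "(\<Prod>S\<in>\<K>. if card S = 1 then ?a else 1) = ?a ^ card {\<sigma> \<in> \<K>. card \<sigma> = 1}"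
    using fin by (subst prod.inter_filter[symmetric]) auto
  also have "(\<Prod>S\<in>\<K>. if card S = 2 then ?c else 1) = ?c ^ card {\<sigma> \<in> \<K>. card \<sigma> = 2}"
    using fin by (subst prod.inter_filter[symmetric]) auto
  finally show ?thesis by (simp add: card_simplices)
qed

lemma vertices_of_in_abstract:
  assumes "T \<in> K" "card (vertices_of T) \<noteq> 0"
  shows "vertices_of T \<in> \<K>"
proof -
  have "T \<noteq> {}" using assms(2) by (auto simp: vertices_of_def)
  then show ?thesis using assms(1) vertices_in_abstract by blast
qed

lemma g_tri_flat:
  assumes T: "T \<in> simplices K 2"
    and g: "\<And>e. e \<in> simplices K 1 \<Longrightarrow> g e \<in> carrier G" and h: "\<And>t. t \<in> simplices K 2 \<Longrightarrow> h t \<in> carrier H"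
  shows "g_tri G bd rho g h T = \<one>\<^bsub>G\<^esub> \<longleftrightarrow>
    flat_at rho (\<lambda>\<sigma>. g (convex hull \<sigma>)) (\<lambda>\<sigma>. h (convex hull \<sigma>)) (vertices_of T)"
proof -
  have TK: "T \<in> K" "card (vertices_of T) = 3" using T simplices_iff[of 2 T] by auto
  then have "vertices_of T \<in> \<K>" by (intro vertices_of_in_abstract) simp_all
  then have sub: "vertices_of T \<subseteq> vertex_set K" using vertex_set_abstract by blast
  have inj: "inj_on rho (vertices_of T)" using rho sub by (rule inj_on_subset)
  obtain j k l where jkl: "vertices_of T = {j,k,l}" "rho j < rho k" "rho k < rho l"
    using sorted3[OF TK(2) inj] by blast
  have v: "vtx rho T 0 = j" "vtx rho T 1 = k" "vtx rho T 2 = l"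
    using vtx_nth[of "[j,k,l]" T rho] jkl by (simp_all add: numeral_2_eq_2)
  have e: "convex hull {a, c} \<in> simplices K 1" if "{a,c} \<subseteq> {j,k,l}" "rho a < rho c" for a c
  proof -
    have "card {a,c} = 2" using that by (subst card_insert_disjoint, auto)+
    then show ?thesis using face_in[OF TK(1), of "{a,c}"] that jkl by (simp add: simplices_iff)
  qed
  have gs: "g (convex hull {k,l}) \<in> carrier G" "g (convex hull {j,k}) \<in> carrier G" "g (convex hull {j,l}) \<in> carrier G"
    by (intro g e; use jkl in simp)+
  have hT: "convex hull {j,k,l} = T" using hull_vertices[OF TK(1)] jkl(1) by simp
  define x a c d where "x = h T" and "a = g (convex hull {k,l})" and "c = g (convex hull {j,k})"
    and "d = g (convex hull {j,l})"
  have C: "x \<in> carrier H" "a \<in> carrier G" "c \<in> carrier G" "d \<in> carrier G"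
    using h[OF T] gs by (auto simp: x_def a_def c_def d_def)
  have "bd x \<otimes>\<^bsub>G\<^esub> a \<otimes>\<^bsub>G\<^esub> c \<otimes>\<^bsub>G\<^esub> inv\<^bsub>G\<^esub> d = \<one>\<^bsub>G\<^esub> \<longleftrightarrow> bd x \<otimes>\<^bsub>G\<^esub> a \<otimes>\<^bsub>G\<^esub> c = d"
  proof
    assume "bd x \<otimes>\<^bsub>G\<^esub> a \<otimes>\<^bsub>G\<^esub> c \<otimes>\<^bsub>G\<^esub> inv\<^bsub>G\<^esub> d = \<one>\<^bsub>G\<^esub>"
    then show "bd x \<otimes>\<^bsub>G\<^esub> a \<otimes>\<^bsub>G\<^esub> c = d"
      using C G.inv_solve_right[of "\<one>\<^bsub>G\<^esub>" "bd x \<otimes>\<^bsub>G\<^esub> a \<otimes>\<^bsub>G\<^esub> c" d] by simp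
  qed (use C in simp)
  then show ?thesis
    unfolding g_tri_def Let_def v sx_def jkl(1) flat_at_triangle[where r = rho, OF jkl(2,3)] tri_eq_def
    using C by (simp add: hT x_def a_def c_def d_def)
qed

lemma h_tet_flat:
  assumes T: "T \<in> simplices K 3"
    and g: "\<And>e. e \<in> simplices K 1 \<Longrightarrow> g e \<in> carrier G" and h: "\<And>t. t \<in> simplices K 2 \<Longrightarrow> h t \<in> carrier H"
  shows "h_tet H act rho g h T = \<one>\<^bsub>H\<^esub> \<longleftrightarrow>
    flat_at rho (\<lambda>\<sigma>. g (convex hull \<sigma>)) (\<lambda>\<sigma>. h (convex hull \<sigma>)) (vertices_of T)"
proof -
  have TK: "T \<in> K" "card (vertices_of T) = 4" using T simplices_iff[of 3 T] by auto
  then have "vertices_of T \<in> \<K>" by (intro vertices_of_in_abstract) simp_all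
  then have sub: "vertices_of T \<subseteq> vertex_set K" using vertex_set_abstract by blast
  have inj: "inj_on rho (vertices_of T)" using rho sub by (rule inj_on_subset)
  obtain j k l m where jkl: "vertices_of T = {j,k,l,m}" "rho j < rho k" "rho k < rho l" "rho l < rho m"
    using sorted4[OF TK(2) inj] by blast
  have v: "vtx rho T 0 = j" "vtx rho T 1 = k" "vtx rho T 2 = l" "vtx rho T 3 = m"
    using vtx_nth[of "[j,k,l,m]" T rho] jkl by (simp_all add: numeral_2_eq_2 numeral_3_eq_3)
  have e: "convex hull {l, m} \<in> simplices K 1"
  proof -
    have "card {l,m} = 2" using jkl by (subst card_insert_disjoint, auto)+
    then show ?thesis using face_in[OF TK(1), of "{l,m}"] jkl by (simp add: simplices_iff)
  qed
  have t: "convex hull {a,c,d} \<in> simplices K 2" if "{a,c,d} \<subseteq> {j,k,l,m}" "rho a < rho c" "rho c < rho d" for a c d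
  proof -
    have "card {a,c,d} = 3" using that(2,3) by (subst card_insert_disjoint, auto)+
    then show ?thesis using face_in[OF TK(1), of "{a,c,d}"] that jkl by (simp add: simplices_iff)
  qed
  define w x y z u where "w = h (convex hull {j,l,m})" and "x = h (convex hull {j,k,l})"
    and "y = h (convex hull {k,l,m})" and "z = h (convex hull {j,k,m})" and "u = g (convex hull {l,m})"
  have C: "w \<in> carrier H" "x \<in> carrier H" "y \<in> carrier H" "z \<in> carrier H" "u \<in> carrier G"
    unfolding w_def x_def y_def z_def u_def by (intro h g t e; use jkl in simp)+
  have "w \<otimes>\<^bsub>H\<^esub> act u x \<otimes>\<^bsub>H\<^esub> inv\<^bsub>H\<^esub> y \<otimes>\<^bsub>H\<^esub> inv\<^bsub>H\<^esub> z = w \<otimes>\<^bsub>H\<^esub> act u x \<otimes>\<^bsub>H\<^esub> inv\<^bsub>H\<^esub> (z \<otimes>\<^bsub>H\<^esub> y)"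
    using C by (simp add: H.inv_mult_group H.m_assoc)
  also have "\<dots> = \<one>\<^bsub>H\<^esub> \<longleftrightarrow> w \<otimes>\<^bsub>H\<^esub> act u x = z \<otimes>\<^bsub>H\<^esub> y"
  proof
    assume "w \<otimes>\<^bsub>H\<^esub> act u x \<otimes>\<^bsub>H\<^esub> inv\<^bsub>H\<^esub> (z \<otimes>\<^bsub>H\<^esub> y) = \<one>\<^bsub>H\<^esub>"
    then show "w \<otimes>\<^bsub>H\<^esub> act u x = z \<otimes>\<^bsub>H\<^esub> y"
      using C H.inv_solve_right[of "\<one>\<^bsub>H\<^esub>" "w \<otimes>\<^bsub>H\<^esub> act u x" "z \<otimes>\<^bsub>H\<^esub> y"] by simp
  qed (use C in simp)
  finally show ?thesis
    unfolding h_tet_def Let_def v sx_def jkl(1) flat_at_tetrahedron[where r = rho, OF jkl(2-4)] tet_eq_def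
    by (simp add: w_def x_def y_def z_def u_def)
qed

text \<open>Each delta contributes a group order at a satisfied relation and 0 otherwise, so the
  state sum is the number of flat colourings times a power of each order. Convex hulls and vertex
  sets translate colourings of geometric simplices into colourings of the abstract complex.\<close>

theorem Z_inv_Zc: "Z_inv H G bd act K rho = Zc rho \<K>"
proof -
  let ?nG = "real (card (carrier G))" and ?nH = "real (card (carrier H))"
  let ?s = "simplices K"
  let ?PG = "?s 1 \<rightarrow>\<^sub>E carrier G" and ?PH = "?s 2 \<rightarrow>\<^sub>E carrier H"
  let ?ga = "\<lambda>g \<sigma>. g (convex hull \<sigma>)"
  have fins: "finite (?s i)" for i unfolding simplices_def using finK by simp
  \<comment> \<open>That the colours lie in the groups is built into \<open>?PG\<close> and
    \<open>?PH\<close>, so only triangles and tetrahedra are tested.\<close>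
  define ok where "ok g h \<longleftrightarrow> (\<forall>T\<in>?s 2 \<union> ?s 3. flat_at rho (?ga g) (?ga h) (vertices_of T))"
    for g :: "'a set \<Rightarrow> 'g" and h :: "'a set \<Rightarrow> 'h"
  have summand: "(\<Prod>T\<in>?s 2. delta G (g_tri G bd rho g h T)) * (\<Prod>T\<in>?s 3. delta H (h_tet H act rho g h T))
      = (if ok g h then ?nG ^ card (?s 2) * ?nH ^ card (?s 3) else 0)"
    if g: "g \<in> ?PG" and h: "h \<in> ?PH" for g h
  proof -
    have g': "\<And>e. e \<in> ?s 1 \<Longrightarrow> g e \<in> carrier G" and h': "\<And>t. t \<in> ?s 2 \<Longrightarrow> h t \<in> carrier H" using g h by auto
    have 2: "delta G (g_tri G bd rho g h T) = (if flat_at rho (?ga g) (?ga h) (vertices_of T) then ?nG else 0)"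
      if "T \<in> ?s 2" for T
      using g_tri_flat[OF that g' h'] by (simp add: delta_def)
    have 3: "delta H (h_tet H act rho g h T) = (if flat_at rho (?ga g) (?ga h) (vertices_of T) then ?nH else 0)"
      if "T \<in> ?s 3" for T
      using h_tet_flat[OF that g' h'] by (simp add: delta_def)
    show ?thesis
    proof (cases "ok g h")
      case True
      then show ?thesis using 2 3 by (simp add: ok_def)
    next
      case False
      then consider T where "T \<in> ?s 2" "\<not> flat_at rho (?ga g) (?ga h) (vertices_of T)"
        | T where "T \<in> ?s 3" "\<not> flat_at rho (?ga g) (?ga h) (vertices_of T)" by (auto simp: ok_def)
      then show ?thesis
      proof cases
        case 1
        then have "(\<Prod>T\<in>?s 2. delta G (g_tri G bd rho g h T)) = 0" using 2 fins by (intro prod_zero) auto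
        then show ?thesis using False by simp
      next
        case 2
        then have "(\<Prod>T\<in>?s 3. delta H (h_tet H act rho g h T)) = 0" using 3 fins by (intro prod_zero) auto
        then show ?thesis using False by simp
      qed
    qed
  qed
  define A where "A = {(g, h). g \<in> ?PG \<and> h \<in> ?PH \<and> ok g h}"
  have finP: "finite ?PG" "finite ?PH" using fins finG finH by (auto intro!: finite_PiE)
  have "(\<Sum>g\<in>?PG. \<Sum>h\<in>?PH. (\<Prod>T\<in>?s 2. delta G (g_tri G bd rho g h T)) * (\<Prod>T\<in>?s 3. delta H (h_tet H act rho g h T)))
      = (\<Sum>g\<in>?PG. \<Sum>h\<in>?PH. if ok g h then ?nG ^ card (?s 2) * ?nH ^ card (?s 3) else 0)"
    by (intro sum.cong refl summand)
  also have "\<dots> = (\<Sum>c\<in>?PG \<times> ?PH. if ok (fst c) (snd c) then ?nG ^ card (?s 2) * ?nH ^ card (?s 3) else 0)"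
    by (simp add: sum.cartesian_product split_beta)
  also have "\<dots> = (\<Sum>c\<in>{c \<in> ?PG \<times> ?PH. ok (fst c) (snd c)}. ?nG ^ card (?s 2) * ?nH ^ card (?s 3))"
    using finP by (intro sum.inter_filter[symmetric]) auto
  also have "{c \<in> ?PG \<times> ?PH. ok (fst c) (snd c)} = A" by (auto simp: A_def)
  finally have S: "(\<Sum>g\<in>?PG. \<Sum>h\<in>?PH. (\<Prod>T\<in>?s 2. delta G (g_tri G bd rho g h T)) * (\<Prod>T\<in>?s 3. delta H (h_tet H act rho g h T)))
      = real (card A) * (?nG ^ card (?s 2) * ?nH ^ card (?s 3))" by simp
  have hs: "convex hull \<sigma> \<in> ?s 1" if "\<sigma> \<in> edges \<K>" for \<sigma>
    using that by (auto simp: simplices_iff abstract_iff)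
  have ht: "convex hull \<sigma> \<in> ?s 2" if "\<sigma> \<in> triangles \<K>" for \<sigma>
    using that by (auto simp: simplices_iff abstract_iff)
  have ve: "vertices_of T \<in> edges \<K>" "convex hull (vertices_of T) = T" if "T \<in> ?s 1" for T
  proof -
    have "T \<in> K" "card (vertices_of T) = 2" using that by (auto simp: simplices_iff)
    then show "vertices_of T \<in> edges \<K>" "convex hull (vertices_of T) = T" using vertices_of_in_abstract hull_vertices by auto
  qed
  have vt: "vertices_of T \<in> triangles \<K>" "convex hull (vertices_of T) = T" if "T \<in> ?s 2" for T
  proof -
    have "T \<in> K" "card (vertices_of T) = 3" using that by (auto simp: simplices_iff)
    then show "vertices_of T \<in> triangles \<K>" "convex hull (vertices_of T) = T" using vertices_of_in_abstract hull_vertices by auto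
  qed
  have vh: "vertices_of (convex hull \<sigma>) = \<sigma>" if "\<sigma> \<in> \<K>" for \<sigma> using that by (simp add: abstract_iff)
  have okflat: "flat rho \<K> (?ga g) (?ga h)" if "g \<in> ?PG" "h \<in> ?PH" "ok g h" for g h
    unfolding flat_def
  proof
    fix \<sigma> assume s: "\<sigma> \<in> \<K>"
    have K: "convex hull \<sigma> \<in> K" using s by (simp add: abstract_iff)
    consider "card \<sigma> = 2" | "card \<sigma> = 3" | "card \<sigma> = 4" | "card \<sigma> \<noteq> 2" "card \<sigma> \<noteq> 3" "card \<sigma> \<noteq> 4" by blast
    then show "flat_at rho (?ga g) (?ga h) \<sigma>"
    proof cases
      case 1
      then show ?thesis using that(1) hs[of \<sigma>] s by (auto simp: flat_at_edge)
    next
      case 2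
      then have "convex hull \<sigma> \<in> ?s 2" using ht s by auto
      then show ?thesis using that(3) vh[OF s] unfolding ok_def by (metis UnI1)
    next
      case 3
      then have "convex hull \<sigma> \<in> ?s 3" using s vh[OF s] K by (simp add: simplices_iff)
      then show ?thesis using that(3) vh[OF s] unfolding ok_def by (metis UnI2)
    qed (rule flat_at_other)
  qed
  define \<Phi> where "\<Phi> = (\<lambda>(g :: 'a set \<Rightarrow> 'g, h :: 'a set \<Rightarrow> 'h). rst \<K> (?ga g, ?ga h))"
  define \<Psi> where "\<Psi> = (\<lambda>(g :: 'a set \<Rightarrow> 'g, h :: 'a set \<Rightarrow> 'h).
     (restrict (\<lambda>T. g (vertices_of T)) (?s 1), restrict (\<lambda>T. h (vertices_of T)) (?s 2)))"
  have "bij_betw \<Phi> A (col rho \<K>)"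
  proof (rule bij_betwI[where g = \<Psi>])
    show "\<Phi> \<in> A \<rightarrow> col rho \<K>"
    proof
      fix c assume c: "c \<in> A"
      obtain g h where gh: "c = (g, h)" by fastforce
      have "flat rho \<K> (?ga g) (?ga h)" using c by (intro okflat) (auto simp: A_def gh)
      from rst_flat[OF asc_abstract this] show "\<Phi> c \<in> col rho \<K>"
        by (simp add: \<Phi>_def gh rst_def col_def)
    qed
    show "\<Psi> \<in> col rho \<K> \<rightarrow> A"
    proof
      fix c assume c: "c \<in> col rho \<K>"
      obtain g h where gh: "c = (g, h)" by fastforce
      have fl: "flat rho \<K> g h" using c by (simp add: col_def gh)
      let ?g = "restrict (\<lambda>T. g (vertices_of T)) (?s 1)" and ?h = "restrict (\<lambda>T. h (vertices_of T)) (?s 2)"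
      have PG: "?g \<in> ?PG"
      proof (rule restrict_PiE_iff[THEN iffD2], rule ballI)
        fix T assume "T \<in> ?s 1"
        then have "vertices_of T \<in> edges \<K>" using ve by blast
        then show "g (vertices_of T) \<in> carrier G" using fl by (auto simp: flat_def flat_at_def)
      qed
      have PH: "?h \<in> ?PH"
      proof (rule restrict_PiE_iff[THEN iffD2], rule ballI)
        fix T assume "T \<in> ?s 2"
        then have "vertices_of T \<in> triangles \<K>" using vt by blast
        then show "h (vertices_of T) \<in> carrier H" using fl by (auto simp: flat_def flat_at_def)
      qed
      have "agree \<K> g h (?ga ?g) (?ga ?h)"
        unfolding agree_def using hs ht vh by simp
      then have fl': "flat rho \<K> (?ga ?g) (?ga ?h)" using flat_cong[OF asc_abstract] fl by blast
      have "ok ?g ?h"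
        unfolding ok_def
      proof
        fix T assume "T \<in> ?s 2 \<union> ?s 3"
        then have "T \<in> K" "card (vertices_of T) \<noteq> 0" by (auto simp: simplices_iff)
        then have "vertices_of T \<in> \<K>" by (rule vertices_of_in_abstract)
        then show "flat_at rho (?ga ?g) (?ga ?h) (vertices_of T)" using fl' by (simp add: flat_def)
      qed
      then show "\<Psi> c \<in> A" using PG PH by (simp add: \<Psi>_def gh A_def)
    qed
  next
    fix c assume c: "c \<in> A"
    obtain g h where gh: "c = (g, h)" by fastforce
    have ext: "g \<in> extensional (?s 1)" "h \<in> extensional (?s 2)" using c by (auto simp: A_def gh PiE_def)
    have "restrict (\<lambda>T. restrict (?ga g) (edges \<K>) (vertices_of T)) (?s 1) = g"
      by (rule extensionalityI[OF restrict_extensional ext(1)]) (use ve in simp)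
    moreover have "restrict (\<lambda>T. restrict (?ga h) (triangles \<K>) (vertices_of T)) (?s 2) = h"
      by (rule extensionalityI[OF restrict_extensional ext(2)]) (use vt in simp)
    ultimately show "\<Psi> (\<Phi> c) = c" by (simp add: \<Psi>_def \<Phi>_def gh rst_def)
  next
    fix d assume d: "d \<in> col rho \<K>"
    obtain g h where gh: "d = (g, h)" by fastforce
    have ext: "g \<in> extensional (edges \<K>)" "h \<in> extensional (triangles \<K>)" using d by (auto simp: col_def gh)
    have "restrict (?ga (restrict (\<lambda>T. g (vertices_of T)) (?s 1))) (edges \<K>) = g"
      by (rule extensionalityI[OF restrict_extensional ext(1)]) (use hs vh in simp)
    moreover have "restrict (?ga (restrict (\<lambda>T. h (vertices_of T)) (?s 2))) (triangles \<K>) = h"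
      by (rule extensionalityI[OF restrict_extensional ext(2)]) (use ht vh in simp)
    ultimately show "\<Phi> (\<Psi> d) = d" by (simp add: \<Psi>_def \<Phi>_def gh rst_def)
  qed
  then have cardA: "card A = card (col rho \<K>)" by (rule bij_betw_same_card)
  have pos: "?nG \<noteq> 0" "?nH \<noteq> 0" using card_G_pos card_H_pos by auto
  \<comment> \<open>Here \<open>a\<close>, \<open>c\<close>, \<open>d\<close>, \<open>e\<close>
    stand for the numbers of simplices of dimension 0 to 3. The powers coming from triangles and
    tetrahedra cancel against the deltas, and the weight of vertices and edges is left.\<close>
  have powers: "x powi (- int a + int c - int d) * (y powi (int a - int c + int d - int e)) * (x powi (- int c) * y powi (- int d)) * (N * (x ^ d * y ^ e))
      = N / ((x / y) ^ a * y ^ c)" if "x \<noteq> 0" "y \<noteq> 0" for x y N :: real and a c d e :: nat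
  proof -
    have e1: "x powi (- int a + int c - int d) = x ^ c / (x ^ a * x ^ d)"
      using that by (simp add: power_int_add power_int_diff power_int_minus field_simps)
    have e2: "y powi (int a - int c + int d - int e) = y ^ a * y ^ d / (y ^ c * y ^ e)"
      using that by (simp add: power_int_add power_int_diff power_int_minus field_simps)
    have e3: "x powi (- int c) = 1 / x ^ c" "y powi (- int d) = 1 / y ^ d"
      by (simp_all add: power_int_minus field_simps)
    show ?thesis unfolding e1 e2 e3 using that by (simp add: field_simps)
  qed
  show ?thesis
    unfolding Z_inv_def Let_def S Zc_def wt_abstract cardA using powers[OF pos] by simp
qed

end

theorem theorem4p1:
  fixes M :: "'m topology"
    and H :: "'h monoid" and G :: "'g monoid"
    and bd :: "'h \<Rightarrow> 'g" and act :: "'g \<Rightarrow> 'h \<Rightarrow> 'h"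
    and K1 :: "'a::euclidean_space set set" and rho1 :: "'a \<Rightarrow> nat"
    and K2 :: "'b::euclidean_space set set" and rho2 :: "'b \<Rightarrow> nat"
  assumes "compact_3manifold_with_boundary M"
    and "crossed_module H G bd act"
    and "finite (carrier H)" and "finite (carrier G)"
    and "is_triangulation_of K1 M" and "vertex_order K1 rho1"
    and "is_triangulation_of K2 M" and "vertex_order K2 rho2"
  shows "Z_inv H G bd act K1 rho1 = Z_inv H G bd act K2 rho2"
proof -
  interpret K1: coloured_complex K1 H G bd act rho1
    by unfold_locales (use assms in \<open>auto simp: is_triangulation_of_def vertex_order_def\<close>)
  interpret K2: coloured_complex K2 H G bd act rho2
    by unfold_locales (use assms in \<open>auto simp: is_triangulation_of_def vertex_order_def\<close>)
  have "top_of_set (\<Union>K1) homeomorphic_space top_of_set (\<Union>K2)"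
    using assms(5,7) homeomorphic_space_sym homeomorphic_space_trans
    unfolding is_triangulation_of_def by blast
  then obtain f f' where "homeomorphic_maps (top_of_set (\<Union>K1)) (top_of_set (\<Union>K2)) f f'"
    unfolding homeomorphic_space_def by blast
  then have hom2: "homeomorphism (\<Union>K1) (\<Union>K2) f f'"
    by (simp add: homeomorphic_maps_def homeomorphism_def) (auto simp: image_iff Pi_iff; metis)
  \<comment> \<open>Both complexes triangulate the space \<open>\<Union>K1\<close>, one through the
    identity and the other along \<open>f\<close>, so that their stars are subsets of one
    set.\<close>
  have hom1: "homeomorphism (\<Union>K1) (\<Union>K1) id id" by (auto simp: homeomorphism_def)
  obtain \<phi> b F where V: "tri (\<Union>K1) (\<phi> ` vertex_set K1) b" "inj_on \<phi> (vertex_set K1)"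
    "nerve (\<phi> ` vertex_set K1) = (`) \<phi> ` K1.\<K>"
    "\<And>x. x \<in> \<Union>K1 \<Longrightarrow> id x = (\<Sum>s\<in>\<phi> ` vertex_set K1. b s x *\<^sub>R F s)"
    using K1.tri_of_complex[OF hom1] by blast
  obtain \<psi> d F2 where W: "tri (\<Union>K1) (\<psi> ` vertex_set K2) d" "inj_on \<psi> (vertex_set K2)"
    "nerve (\<psi> ` vertex_set K2) = (`) \<psi> ` K2.\<K>"
    "\<And>x. x \<in> \<Union>K1 \<Longrightarrow> f x = (\<Sum>s\<in>\<psi> ` vertex_set K2. d s x *\<^sub>R F2 s)"
    using K2.tri_of_complex[OF hom2] by blast
  define r where "r s = rho1 (inv_into (vertex_set K1) \<phi> s)" for s
  define r' where "r' s = rho2 (inv_into (vertex_set K2) \<psi> s)" for s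
  have r: "r (\<phi> v) = rho1 v" if "v \<in> vertex_set K1" for v
    using inv_into_f_f[OF V(2) that] by (simp add: r_def)
  have r': "r' (\<psi> v) = rho2 v" if "v \<in> vertex_set K2" for v
    using inv_into_f_f[OF W(2) that] by (simp add: r'_def)
  have inj: "inj_on r (\<phi> ` vertex_set K1)" "inj_on r' (\<psi> ` vertex_set K2)"
    using K1.rho K2.rho r r' by (auto simp: inj_on_def)
  have 1: "K1.Zc r (nerve (\<phi> ` vertex_set K1)) = K1.Zc rho1 K1.\<K>"
  proof -
    have i: "inj_on (\<lambda>v. r (\<phi> v)) (\<Union>K1.\<K>)" "inj_on rho1 (\<Union>K1.\<K>)" "inj_on \<phi> (\<Union>K1.\<K>)"
      using K1.rho V(2) r by (auto simp: K1.vertex_set_abstract inj_on_def)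
    show ?thesis
      unfolding V(3) K1.Zc_image[OF K1.asc_abstract i(3)] by (rule K1.Zc_order[OF K1.asc_abstract i(1,2)])
  qed
  have 2: "K1.Zc r' (nerve (\<psi> ` vertex_set K2)) = K1.Zc rho2 K2.\<K>"
  proof -
    have i: "inj_on (\<lambda>v. r' (\<psi> v)) (\<Union>K2.\<K>)" "inj_on rho2 (\<Union>K2.\<K>)" "inj_on \<psi> (\<Union>K2.\<K>)"
      using K2.rho W(2) r' by (auto simp: K2.vertex_set_abstract inj_on_def)
    show ?thesis
      unfolding W(3) K1.Zc_image[OF K2.asc_abstract i(3)] by (rule K1.Zc_order[OF K2.asc_abstract i(1,2)])
  qed
  have "K1.Zc r (nerve (\<phi> ` vertex_set K1)) = K1.Zc r' (nerve (\<psi> ` vertex_set K2))"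
    by (rule K1.Zc_triangulations[OF V(1,4) hom1 K1.compact_carrier W(1,4) hom2 K2.compact_carrier inj])
  then show ?thesis
    unfolding K1.Z_inv_Zc K2.Z_inv_Zc using 1 2 by simp
qed

end
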